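(* (Soundness of bisimilarity.) For all CPC processes $P,Q$: if $P\sim Q$ then $P\simeq Q$, i.e. $\sim\ \subseteq\ \simeq$.
   Context: Concurrent pattern calculus (CPC). Fix a countable set $\mathcal N$ of names. Patterns are $p ::= \lambda x \mid x \mid \ulcorner x\urcorner \mid p\bullet p$ (binding name, variable name, protected name, compound; $\bullet$ is left associative). ${\sf bn}(p)$, ${\sf vn}(p)$, ${\sf pn}(p)$ denote the sets of names occurring in $p$ as binding, variable and protected names (unions for compounds), and ${\sf fn}(p)={\sf vn}(p)\cup{\sf pn}(p)$. A pattern is well formed if its binding names are pairwise distinct and distinct from its free names; all patterns are assumed well formed. A pattern is communicable if it contains no protected and no binding names; protection extends to communicable patterns by $\ulcorner p\bullet q\urcorner=\ulcorner p\urcorner\bullet\ulcorner q\urcorner$. A substitution is a partial function with finite domain from names to communicable patterns; ${\sf fn}(\sigma)=\bigcup_{x\in{\sf dom}(\sigma)}{\sf fn}(\sigma(x))$, ${\sf names}(\sigma)={\sf dom}(\sigma)\cup{\sf fn}(\sigma)$, and ${\sf id}_X$ is the identity substitution on a finite set $X$. On patterns: $\sigma x=\sigma(x)$ if $x\in{\sf dom}(\sigma)$ else $x$; $\sigma\ulcorner x\urcorner=\ulcorner\sigma(x)\urcorner$ if $x\in{\sf dom}(\sigma)$ else $\ulcorner x\urcorner$; $\sigma(\lambda x)=\lambda x$; $\sigma(p\bullet q)=\sigma p\bullet\sigma q$. The dual action $\hat\sigma$ is: $\hat\sigma x=x$, $\hat\sigma\ulcorner x\urcorner=\ulcorner x\urcorner$,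 $\hat\sigma(\lambda x)=\sigma(x)$ if $x\in{\sf dom}(\sigma)$ else $\lambda x$, $\hat\sigma(p\bullet q)=\hat\sigma p\bullet\hat\sigma q$. Unification $\{p\,\|\,q\}$ is a pair of substitutions or undefined: $\{x\|x\}=\{x\|\ulcorner x\urcorner\}=\{\ulcorner x\urcorner\|x\}=\{\ulcorner x\urcorner\|\ulcorner x\urcorner\}=(\{\},\{\})$; $\{\lambda x\|q\}=(\{q/x\},\{\})$ if $q$ is communicable; $\{p\|\lambda x\}=(\{\},\{p/x\})$ if $p$ is communicable; $\{p_1\bullet p_2\|q_1\bullet q_2\}=(\sigma_1\cup\sigma_2,\rho_1\cup\rho_2)$ if $\{p_i\|q_i\}=(\sigma_i,\rho_i)$ for $i=1,2$; undefined otherwise. Processes: $P ::= 0 \mid P|P \mid\ !P \mid (\nu x)P \mid p\to P$ (the binding names of $p$ bind in $P$; ${\sf fn}(p\to P)={\sf fn}(p)\cup({\sf fn}(P)\setminus{\sf bn}(p))$; other free names as usual). Substitution on processes is capture avoiding (up to $\alpha$-conversion). Structural congruence $\equiv$ is the least congruence containing $\alpha$-conversion and $P|0\equiv P$, $P|Q\equiv Q|P$, $P|(Q|R)\equiv(P|Q)|R$, $(\nu n)0\equiv 0$, $(\nu n)(\nu m)P\equiv(\nu m)(\nu n)P$, $!P\equiv P|!P$, $P|(\nu n)Q\equiv(\nu n)(P|Q)$ if $n\notin{\sf fn}(P)$. Reduction $\to$ is the least relation with $(p\to P)|(q\to Q)\to\sigma P|\rho Q$ whenever $\{p\|q\}=(\sigma,\rho)$,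 closed under $P\to P'\Rightarrow P|Q\to P'|Q$ and $(\nu n)P\to(\nu n)P'$, and under $\equiv$ on both sides. $(\nu\tilde n)$ abbreviates a sequence of restrictions. Barbs: $P\downarrow_{\tilde m}$ iff $P\equiv(\nu\tilde n)(p\to P'|P'')$ with ${\sf pn}(p)\cap\tilde n=\emptyset$ and $\tilde m={\sf fn}(p)\setminus\tilde n$. A relation $\mathcal R$ is barb preserving if $(P,Q)\in\mathcal R$ and $P\downarrow_{\tilde m}$ imply $Q\downarrow_{\tilde m}$; reduction closed if $(P,Q)\in\mathcal R$ and $P\to P'$ imply $Q\to Q'$ with $(P',Q')\in\mathcal R$; context closed if $(P,Q)\in\mathcal R$ implies $(C[P],C[Q])\in\mathcal R$ for every context $C[\cdot]$ (a process with one hole). Barbed congruence $\simeq$ is the largest symmetric, barb preserving, reduction closed and context closed relation on processes. Labelled transitions: labels $\mu::=\tau\mid(\nu\tilde n)p$. Rules (up to $\alpha$-conversion; parint and parext also have symmetric versions): case: $p\to P\xrightarrow{p}P$; resnon: $P\xrightarrow{\mu}P'$ implies $(\nu n)P\xrightarrow{\mu}(\nu n)P'$ if $n$ does not occur in $\mu$; open: $P\xrightarrow{(\nu\tilde n)p}P'$ implies $(\nu m)P\xrightarrow{(\nu\tilde n,m)p}P'$ if $m\in{\sf vn}(p)\setminus(\tilde n\cup{\sf pn}(p)\cup{\sf bn}(p))$; unify: $P\xrightarrow{(\nu\tilde m)p}P'$ and $Q\xrightarrow{(\nu\tilde n)q}Q'$ imply $P|Q\xrightarrow{\tau}(\nu\tilde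 m\tilde n)(\sigma P'|\rho Q')$ if $\{p\|q\}=(\sigma,\rho)$, $\tilde m\cap{\sf fn}(Q)=\tilde n\cap{\sf fn}(P)=\tilde m\cap\tilde n=\emptyset$; parint: $P\xrightarrow{\tau}P'$ implies $P|Q\xrightarrow{\tau}P'|Q$; parext: $P\xrightarrow{(\nu\tilde n)p}P'$ implies $P|Q\xrightarrow{(\nu\tilde n)p}P'|Q$ if $(\tilde n\cup{\sf bn}(p))\cap{\sf fn}(Q)=\emptyset$; rep: $!P|P\xrightarrow{\mu}P'$ implies $!P\xrightarrow{\mu}P'$. A match $(p,\sigma)$ is a pattern with a substitution such that ${\sf dom}(\sigma)={\sf bn}(p)$. Compatibility $p,\sigma\sqsubseteq q,\rho$ between matches is the least relation with: $p,\sigma\sqsubseteq\lambda y,\{\hat\sigma p/y\}$ if ${\sf fn}(p)=\emptyset$; $n,\{\}\sqsubseteq n,\{\}$; $\ulcorner n\urcorner,\{\}\sqsubseteq\ulcorner n\urcorner,\{\}$; $\ulcorner n\urcorner,\{\}\sqsubseteq n,\{\}$; $p_1\bullet p_2,\sigma_1\cup\sigma_2\sqsubseteq q_1\bullet q_2,\rho_1\cup\rho_2$ if $p_i,\sigma_i\sqsubseteq q_i,\rho_i$ for $i=1,2$. A symmetric relation $\mathcal R$ on processes is a bisimulation if for every $(P,Q)\in\mathcal R$ and $P\xrightarrow{\mu}P'$: if $\mu=\tau$ then $Q\xrightarrow{\tau}Q'$ with $(P',Q')\in\mathcal R$; if $\mu=(\nu\tilde n)p$ with $({\sf bn}(p)\cup\tilde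 n)\cap{\sf fn}(Q)=\emptyset$, then for every match $(p,\sigma)$ with ${\sf fn}(\sigma)\cap\tilde n=\emptyset$ there are a match $(q,\rho)$ and $Q'$ with $p,\sigma\sqsubseteq q,\rho$, $Q\xrightarrow{(\nu\tilde n)q}Q'$ and $(\sigma P',\rho Q')\in\mathcal R$. Bisimilarity $\sim$ is the largest bisimulation closed under all substitutions. *)

theory Defs
  imports Main
begin

type_synonym name = nat

datatype pat = Bind name | Var name | Prot name | Comp pat pat

fun bnl :: "pat \<Rightarrow> name list" where
  "bnl (Bind x) = [x]"
| "bnl (Var x) = []"
| "bnl (Prot x) = []"
| "bnl (Comp p q) = bnl p @ bnl q"

definition bn :: "pat \<Rightarrow> name set" where "bn p = set (bnl p)"

fun vn :: "pat \<Rightarrow> name set" where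
  "vn (Bind x) = {}"
| "vn (Var x) = {x}"
| "vn (Prot x) = {}"
| "vn (Comp p q) = vn p \<union> vn q"

fun pn :: "pat \<Rightarrow> name set" where
  "pn (Bind x) = {}"
| "pn (Var x) = {}"
| "pn (Prot x) = {x}"
| "pn (Comp p q) = pn p \<union> pn q"

definition fn_pat :: "pat \<Rightarrow> name set" where "fn_pat p = vn p \<union> pn p"

definition names_pat :: "pat \<Rightarrow> name set" where "names_pat p = bn p \<union> fn_pat p"

definition wf_pat :: "pat \<Rightarrow> bool" where
  "wf_pat p \<longleftrightarrow> distinct (bnl p) \<and> bn p \<inter> fn_pat p = {}"

definition communicable :: "pat \<Rightarrow> bool" where
  "communicable p \<longleftrightarrow> bn p = {} \<and> pn p = {}"

text \<open>Protection, extended to communicable patterns.\<close>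
fun prot :: "pat \<Rightarrow> pat" where
  "prot (Var x) = Prot x"
| "prot (Comp p q) = Comp (prot p) (prot q)"
| "prot p = p"

type_synonym subst = "name \<Rightarrow> pat option"

definition is_subst :: "subst \<Rightarrow> bool" where
  "is_subst \<sigma> \<longleftrightarrow> finite (dom \<sigma>) \<and> (\<forall>p\<in>ran \<sigma>. communicable p)"

definition fn_subst :: "subst \<Rightarrow> name set" where
  "fn_subst \<sigma> = (\<Union>p\<in>ran \<sigma>. fn_pat p)"

definition names_subst :: "subst \<Rightarrow> name set" where
  "names_subst \<sigma> = dom \<sigma> \<union> fn_subst \<sigma>"

fun psubst :: "subst \<Rightarrow> pat \<Rightarrow> pat" where
  "psubst \<sigma> (Var x) = (case \<sigma> x of Some q \<Rightarrow> q | None \<Rightarrow> Var x)"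
| "psubst \<sigma> (Prot x) = (case \<sigma> x of Some q \<Rightarrow> prot q | None \<Rightarrow> Prot x)"
| "psubst \<sigma> (Bind x) = Bind x"
| "psubst \<sigma> (Comp p q) = Comp (psubst \<sigma> p) (psubst \<sigma> q)"

fun hsubst :: "subst \<Rightarrow> pat \<Rightarrow> pat" where
  "hsubst \<sigma> (Var x) = Var x"
| "hsubst \<sigma> (Prot x) = Prot x"
| "hsubst \<sigma> (Bind x) = (case \<sigma> x of Some q \<Rightarrow> q | None \<Rightarrow> Bind x)"
| "hsubst \<sigma> (Comp p q) = Comp (hsubst \<sigma> p) (hsubst \<sigma> q)"

fun unify :: "pat \<Rightarrow> pat \<Rightarrow> (subst \<times> subst) option" where
  "unify (Var x) (Var y) = (if x = y then Some (Map.empty, Map.empty) else None)"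
| "unify (Var x) (Prot y) = (if x = y then Some (Map.empty, Map.empty) else None)"
| "unify (Prot x) (Var y) = (if x = y then Some (Map.empty, Map.empty) else None)"
| "unify (Prot x) (Prot y) = (if x = y then Some (Map.empty, Map.empty) else None)"
| "unify (Bind x) q = (if communicable q then Some ([x \<mapsto> q], Map.empty) else None)"
| "unify p (Bind x) = (if communicable p then Some (Map.empty, [x \<mapsto> p]) else None)"
| "unify (Comp p1 p2) (Comp q1 q2) =
     (case (unify p1 q1, unify p2 q2) of
        (Some (\<sigma>1, \<rho>1), Some (\<sigma>2, \<rho>2)) \<Rightarrow> Some (\<sigma>1 ++ \<sigma>2, \<rho>1 ++ \<rho>2)
      | _ \<Rightarrow> None)"
| "unify _ _ = None"

datatype proc = Nil | Par proc proc | Rep proc | Res name proc | Case pat proc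

fun fn_proc :: "proc \<Rightarrow> name set" where
  "fn_proc Nil = {}"
| "fn_proc (Par P Q) = fn_proc P \<union> fn_proc Q"
| "fn_proc (Rep P) = fn_proc P"
| "fn_proc (Res x P) = fn_proc P - {x}"
| "fn_proc (Case p P) = fn_pat p \<union> (fn_proc P - bn p)"

fun all_names :: "proc \<Rightarrow> name set" where
  "all_names Nil = {}"
| "all_names (Par P Q) = all_names P \<union> all_names Q"
| "all_names (Rep P) = all_names P"
| "all_names (Res x P) = insert x (all_names P)"
| "all_names (Case p P) = names_pat p \<union> all_names P"

fun wf_proc :: "proc \<Rightarrow> bool" where
  "wf_proc Nil = True"
| "wf_proc (Par P Q) = (wf_proc P \<and> wf_proc Q)"
| "wf_proc (Rep P) = wf_proc P"
| "wf_proc (Res x P) = wf_proc P"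
| "wf_proc (Case p P) = (wf_pat p \<and> wf_proc P)"

definition swap_name :: "name \<Rightarrow> name \<Rightarrow> name \<Rightarrow> name" where
  "swap_name a b x = (if x = a then b else if x = b then a else x)"

fun swap_pat :: "name \<Rightarrow> name \<Rightarrow> pat \<Rightarrow> pat" where
  "swap_pat a b (Bind x) = Bind (swap_name a b x)"
| "swap_pat a b (Var x) = Var (swap_name a b x)"
| "swap_pat a b (Prot x) = Prot (swap_name a b x)"
| "swap_pat a b (Comp p q) = Comp (swap_pat a b p) (swap_pat a b q)"

fun swap_proc :: "name \<Rightarrow> name \<Rightarrow> proc \<Rightarrow> proc" where
  "swap_proc a b Nil = Nil"
| "swap_proc a b (Par P Q) = Par (swap_proc a b P) (swap_proc a b Q)"
| "swap_proc a b (Rep P) = Rep (swap_proc a b P)"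
| "swap_proc a b (Res x P) = Res (swap_name a b x) (swap_proc a b P)"
| "swap_proc a b (Case p P) = Case (swap_pat a b p) (swap_proc a b P)"

lemma size_swap_proc[simp]: "size (swap_proc a b P) = size P"
  by (induction P) auto

definition swaps_pat :: "(name \<times> name) list \<Rightarrow> pat \<Rightarrow> pat" where
  "swaps_pat ps p = fold (\<lambda>(a, b). swap_pat a b) ps p"

definition swaps_proc :: "(name \<times> name) list \<Rightarrow> proc \<Rightarrow> proc" where
  "swaps_proc ps P = fold (\<lambda>(a, b). swap_proc a b) ps P"

lemma size_swaps_proc[simp]: "size (swaps_proc ps P) = size P"
  unfolding swaps_proc_def by (induction ps arbitrary: P) auto

definition fresh :: "name set \<Rightarrow> name" where
  "fresh A = Suc (Max (insert 0 A))"

definition rename_pairs :: "name set \<Rightarrow> pat \<Rightarrow> (name \<times> name) list" where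
  "rename_pairs A p =
     (let xs = sorted_list_of_set (bn p); m = fresh A in zip xs [m..<m + length xs])"

function subst :: "subst \<Rightarrow> proc \<Rightarrow> proc" where
  "subst \<sigma> Nil = Nil"
| "subst \<sigma> (Par P Q) = Par (subst \<sigma> P) (subst \<sigma> Q)"
| "subst \<sigma> (Rep P) = Rep (subst \<sigma> P)"
| "subst \<sigma> (Res x P) =
     (if x \<in> names_subst \<sigma>
      then (let y = fresh (names_subst \<sigma> \<union> all_names (Res x P))
            in Res y (subst \<sigma> (swap_proc x y P)))
      else Res x (subst \<sigma> P))"
| "subst \<sigma> (Case p P) =
     (if bn p \<inter> names_subst \<sigma> = {}
      then Case (psubst \<sigma> p) (subst \<sigma> P)
      else (let ps = rename_pairs (names_subst \<sigma> \<union> all_names (Case p P)) p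
            in Case (psubst \<sigma> (swaps_pat ps p)) (subst \<sigma> (swaps_proc ps P))))"
  by pat_completeness auto
termination
  by (relation "measure (\<lambda>(\<sigma>, P). size P)") auto

definition resl :: "name list \<Rightarrow> proc \<Rightarrow> proc" where
  "resl ns P = foldr Res ns P"

definition resS :: "name set \<Rightarrow> proc \<Rightarrow> proc" where
  "resS N P = resl (sorted_list_of_set N) P"

inductive alpha :: "proc \<Rightarrow> proc \<Rightarrow> bool" where
  alpha_refl: "alpha P P"
| alpha_sym: "alpha P Q \<Longrightarrow> alpha Q P"
| alpha_trans: "alpha P Q \<Longrightarrow> alpha Q R \<Longrightarrow> alpha P R"
| alpha_par: "alpha P P' \<Longrightarrow> alpha Q Q' \<Longrightarrow> alpha (Par P Q) (Par P' Q')"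
| alpha_rep: "alpha P P' \<Longrightarrow> alpha (Rep P) (Rep P')"
| alpha_res: "alpha P P' \<Longrightarrow> alpha (Res x P) (Res x P')"
| alpha_case: "alpha P P' \<Longrightarrow> alpha (Case p P) (Case p P')"
| alpha_res_ren: "y \<notin> fn_proc (Res x P) \<Longrightarrow> alpha (Res x P) (Res y (swap_proc x y P))"
| alpha_case_ren: "x \<in> bn p \<Longrightarrow> y \<notin> fn_proc (Case p P) \<Longrightarrow>
     alpha (Case p P) (Case (swap_pat x y p) (swap_proc x y P))"

inductive scong :: "proc \<Rightarrow> proc \<Rightarrow> bool" where
  sc_alpha: "alpha P Q \<Longrightarrow> scong P Q"
| sc_refl: "scong P P"
| sc_sym: "scong P Q \<Longrightarrow> scong Q P"
| sc_trans: "scong P Q \<Longrightarrow> scong Q R \<Longrightarrow> scong P R"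
| sc_par: "scong P P' \<Longrightarrow> scong Q Q' \<Longrightarrow> scong (Par P Q) (Par P' Q')"
| sc_rep: "scong P P' \<Longrightarrow> scong (Rep P) (Rep P')"
| sc_res: "scong P P' \<Longrightarrow> scong (Res x P) (Res x P')"
| sc_case: "scong P P' \<Longrightarrow> scong (Case p P) (Case p P')"
| sc_par_nil: "scong (Par P Nil) P"
| sc_par_comm: "scong (Par P Q) (Par Q P)"
| sc_par_assoc: "scong (Par P (Par Q R)) (Par (Par P Q) R)"
| sc_res_nil: "scong (Res n Nil) Nil"
| sc_res_comm: "scong (Res n (Res m P)) (Res m (Res n P))"
| sc_rep_unfold: "scong (Rep P) (Par P (Rep P))"
| sc_scope: "n \<notin> fn_proc P \<Longrightarrow> scong (Par P (Res n Q)) (Res n (Par P Q))"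

inductive red :: "proc \<Rightarrow> proc \<Rightarrow> bool" where
  red_comm: "unify p q = Some (\<sigma>, \<rho>) \<Longrightarrow>
     red (Par (Case p P) (Case q Q)) (Par (subst \<sigma> P) (subst \<rho> Q))"
| red_par: "red P P' \<Longrightarrow> red (Par P Q) (Par P' Q)"
| red_res: "red P P' \<Longrightarrow> red (Res n P) (Res n P')"
| red_struct: "scong P P0 \<Longrightarrow> red P0 Q0 \<Longrightarrow> scong Q0 Q \<Longrightarrow> red P Q"

definition barb :: "proc \<Rightarrow> name set \<Rightarrow> bool" where
  "barb P M \<longleftrightarrow> (\<exists>ns p P' P''. scong P (resl ns (Par (Case p P') P''))
       \<and> pn p \<inter> set ns = {} \<and> M = fn_pat p - set ns)"

datatype ctx = Hole | CParL ctx proc | CParR proc ctx | CRep ctx | CRes name ctx | CCase pat ctx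

fun fill :: "ctx \<Rightarrow> proc \<Rightarrow> proc" where
  "fill Hole P = P"
| "fill (CParL C Q) P = Par (fill C P) Q"
| "fill (CParR Q C) P = Par Q (fill C P)"
| "fill (CRep C) P = Rep (fill C P)"
| "fill (CRes x C) P = Res x (fill C P)"
| "fill (CCase p C) P = Case p (fill C P)"

fun wf_ctx :: "ctx \<Rightarrow> bool" where
  "wf_ctx Hole = True"
| "wf_ctx (CParL C Q) = (wf_ctx C \<and> wf_proc Q)"
| "wf_ctx (CParR Q C) = (wf_proc Q \<and> wf_ctx C)"
| "wf_ctx (CRep C) = wf_ctx C"
| "wf_ctx (CRes x C) = wf_ctx C"
| "wf_ctx (CCase p C) = (wf_pat p \<and> wf_ctx C)"

definition barb_preserving :: "(proc \<times> proc) set \<Rightarrow> bool" where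
  "barb_preserving R \<longleftrightarrow> (\<forall>P Q M. (P, Q) \<in> R \<and> barb P M \<longrightarrow> barb Q M)"

definition reduction_closed :: "(proc \<times> proc) set \<Rightarrow> bool" where
  "reduction_closed R \<longleftrightarrow>
     (\<forall>P Q P'. (P, Q) \<in> R \<and> red P P' \<longrightarrow> (\<exists>Q'. red Q Q' \<and> (P', Q') \<in> R))"

definition context_closed :: "(proc \<times> proc) set \<Rightarrow> bool" where
  "context_closed R \<longleftrightarrow>
     (\<forall>C P Q. wf_ctx C \<and> (P, Q) \<in> R \<longrightarrow> (fill C P, fill C Q) \<in> R)"

definition barbed_cong :: "proc \<Rightarrow> proc \<Rightarrow> bool" where
  "barbed_cong P Q \<longleftrightarrow> (\<exists>R. R \<subseteq> {(P, Q). wf_proc P \<and> wf_proc Q} \<and> sym R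
      \<and> barb_preserving R \<and> reduction_closed R \<and> context_closed R \<and> (P, Q) \<in> R)"

datatype label = Tau | Out "name set" pat

fun names_label :: "label \<Rightarrow> name set" where
  "names_label Tau = {}"
| "names_label (Out N p) = N \<union> names_pat p"

inductive lts :: "proc \<Rightarrow> label \<Rightarrow> proc \<Rightarrow> bool" where
  tr_case: "lts (Case p P) (Out {} p) P"
| tr_resnon: "lts P \<mu> P' \<Longrightarrow> n \<notin> names_label \<mu> \<Longrightarrow> lts (Res n P) \<mu> (Res n P')"
| tr_open: "lts P (Out N p) P' \<Longrightarrow> m \<in> vn p - (N \<union> pn p \<union> bn p) \<Longrightarrow>
     lts (Res m P) (Out (insert m N) p) P'"
| tr_unify: "lts P (Out M p) P' \<Longrightarrow> lts Q (Out N q) Q' \<Longrightarrow> unify p q = Some (\<sigma>, \<rho>) \<Longrightarrow>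
     M \<inter> fn_proc Q = {} \<Longrightarrow> N \<inter> fn_proc P = {} \<Longrightarrow> M \<inter> N = {} \<Longrightarrow>
     lts (Par P Q) Tau (resS (M \<union> N) (Par (subst \<sigma> P') (subst \<rho> Q')))"
| tr_parint_l: "lts P Tau P' \<Longrightarrow> lts (Par P Q) Tau (Par P' Q)"
| tr_parint_r: "lts P Tau P' \<Longrightarrow> lts (Par Q P) Tau (Par Q P')"
| tr_parext_l: "lts P (Out N p) P' \<Longrightarrow> (N \<union> bn p) \<inter> fn_proc Q = {} \<Longrightarrow>
     lts (Par P Q) (Out N p) (Par P' Q)"
| tr_parext_r: "lts P (Out N p) P' \<Longrightarrow> (N \<union> bn p) \<inter> fn_proc Q = {} \<Longrightarrow>
     lts (Par Q P) (Out N p) (Par Q P')"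
| tr_rep: "lts (Par (Rep P) P) \<mu> P' \<Longrightarrow> lts (Rep P) \<mu> P'"
| tr_alpha: "alpha P P0 \<Longrightarrow> lts P0 \<mu> P1 \<Longrightarrow> alpha P1 P' \<Longrightarrow> lts P \<mu> P'"

definition is_match :: "pat \<Rightarrow> subst \<Rightarrow> bool" where
  "is_match p \<sigma> \<longleftrightarrow> is_subst \<sigma> \<and> dom \<sigma> = bn p"

inductive compat :: "pat \<Rightarrow> subst \<Rightarrow> pat \<Rightarrow> subst \<Rightarrow> bool" where
  cp_bind: "fn_pat p = {} \<Longrightarrow> dom \<sigma> = bn p \<Longrightarrow> compat p \<sigma> (Bind y) [y \<mapsto> hsubst \<sigma> p]"
| cp_var: "compat (Var n) Map.empty (Var n) Map.empty"
| cp_prot: "compat (Prot n) Map.empty (Prot n) Map.empty"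
| cp_prot_var: "compat (Prot n) Map.empty (Var n) Map.empty"
| cp_comp: "compat p1 \<sigma>1 q1 \<rho>1 \<Longrightarrow> compat p2 \<sigma>2 q2 \<rho>2 \<Longrightarrow>
     compat (Comp p1 p2) (\<sigma>1 ++ \<sigma>2) (Comp q1 q2) (\<rho>1 ++ \<rho>2)"

definition bisimulation :: "(proc \<times> proc) set \<Rightarrow> bool" where
  "bisimulation R \<longleftrightarrow> sym R \<and>
     (\<forall>P Q P' \<mu>. (P, Q) \<in> R \<and> lts P \<mu> P' \<longrightarrow>
        (case \<mu> of
           Tau \<Rightarrow> (\<exists>Q'. lts Q Tau Q' \<and> (P', Q') \<in> R)
         | Out N p \<Rightarrow> ((bn p \<union> N) \<inter> fn_proc Q = {} \<longrightarrow>
              (\<forall>\<sigma>. is_match p \<sigma> \<and> fn_subst \<sigma> \<inter> N = {} \<longrightarrow>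
                 (\<exists>q \<rho> Q'. is_match q \<rho> \<and> compat p \<sigma> q \<rho> \<and> lts Q (Out N q) Q'
                    \<and> (subst \<sigma> P', subst \<rho> Q') \<in> R)))))"

definition subst_closed :: "(proc \<times> proc) set \<Rightarrow> bool" where
  "subst_closed R \<longleftrightarrow> (\<forall>\<sigma> P Q. is_subst \<sigma> \<and> (P, Q) \<in> R \<longrightarrow> (subst \<sigma> P, subst \<sigma> Q) \<in> R)"

definition bisimilar :: "proc \<Rightarrow> proc \<Rightarrow> bool" where
  "bisimilar P Q \<longleftrightarrow> (\<exists>R. R \<subseteq> {(P, Q). wf_proc P \<and> wf_proc Q} \<and> bisimulation R
      \<and> subst_closed R \<and> (P, Q) \<in> R)"

end

theory Submission
  imports Defs
begin

text \<open>Let S be a bisimulation closed under substitutions, and close it under all process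
  constructors and under structural congruence on both sides. The closure is context closed by
  construction, and closure under substitutions makes it compatible with prefixes. By induction on
  its derivation it still has the simulation property of a bisimulation, so it remains to read
  reductions and barbs as transitions. Two changes of presentation keep the bureaucracy of binders
  and of structural congruence small. Substitution is replaced by a simultaneous substitution that
  always renames binders to canonical fresh names (Stoughton), so that composition of substitutions
  and invariance under alpha-equivalence are equations between terms. The transition system is
  replaced by one without a rule for alpha-equivalence whose targets are structural congruence
  classes; it is invariant under structural congruence of the source.\<close>

subsection \<open>Simultaneous substitution\<close>

text \<open>The free choice of \<beta> and \<open>m\<close> in the binder rules of \<open>st\<close>
  takes the place of \<open>tr_alpha\<close>, which may occur anywhere in a derivation of
  \<open>lts\<close> and so blocks inversion along the structure of a process. Targets have to be
  classes because moving a scope or unfolding a replication changes a target only up to structural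
  congruence; on classes label and target stay literally the same. Bound names of a label must often
  be changed, to keep them off a bystander or to meet the side conditions of the bisimulation game;
  this rests on equivariance of \<open>st\<close> under permutations that fix the free names of the
  source. The core of the argument for parallel composition is a property of compatibility: if
  \<open>p\<close> unifies with \<open>r\<close> giving \<sigma>, \<theta> and the match
  \<open>p\<close>, \<sigma> is compatible with \<open>q\<close>, \<rho>, then \<open>q\<close>
  unifies with \<open>r\<close> giving \<rho>, \<theta>. Applied once on each side it turns a
  communication of one pair of processes into a communication of the related pair. Compatibility
  also keeps the set of free names of the pattern, from which barbs are read off.\<close>

definition csub :: "(name \<Rightarrow> pat) \<Rightarrow> bool" where
  "csub \<theta> \<longleftrightarrow> (\<forall>x. communicable (\<theta> x))"

text \<open>The binders are renamed along with the free names, by a second argument \<beta>, so that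
  one traversal performs a substitution together with the alpha-renaming it needs.\<close>

fun psub :: "(name \<Rightarrow> pat) \<Rightarrow> (name \<Rightarrow> name) \<Rightarrow> pat \<Rightarrow> pat" where
  "psub \<theta> \<beta> (Var x) = \<theta> x"
| "psub \<theta> \<beta> (Prot x) = prot (\<theta> x)"
| "psub \<theta> \<beta> (Bind x) = Bind (\<beta> x)"
| "psub \<theta> \<beta> (Comp p q) = Comp (psub \<theta> \<beta> p) (psub \<theta> \<beta> q)"

definition cmp :: "(name \<Rightarrow> pat) \<Rightarrow> (name \<Rightarrow> pat) \<Rightarrow> name \<Rightarrow> pat" where
  "cmp \<theta>' \<theta> x = psub \<theta>' id (\<theta> x)"

definition fimg :: "(name \<Rightarrow> pat) \<Rightarrow> name set \<Rightarrow> name set" where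
  "fimg \<theta> A = (\<Union>z\<in>A. fn_pat (\<theta> z))"

text \<open>New binders of a pattern are numbered by position. A position does not change when the
  binders are renamed injectively, hence alpha-variants of a prefix receive the same new
  binders.\<close>

definition idx :: "name list \<Rightarrow> name \<Rightarrow> nat" where
  "idx xs x = length (takeWhile (\<lambda>y. y \<noteq> x) xs)"

definition updb :: "(name \<Rightarrow> pat) \<Rightarrow> (name \<Rightarrow> name) \<Rightarrow> name set \<Rightarrow> name \<Rightarrow> pat" where
  "updb \<theta> \<beta> B x = (if x \<in> B then Var (\<beta> x) else \<theta> x)"

text \<open>The new binder depends on nothing but the free names of the result,
  \<open>fimg \<theta> (fn_proc ...)\<close>. No bound name of the argument influences this set, and
  this is why alpha-equivalent processes have equal images.\<close>

fun esub :: "(name \<Rightarrow> pat) \<Rightarrow> proc \<Rightarrow> proc" where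
  "esub \<theta> Nil = Nil"
| "esub \<theta> (Par P Q) = Par (esub \<theta> P) (esub \<theta> Q)"
| "esub \<theta> (Rep P) = Rep (esub \<theta> P)"
| "esub \<theta> (Res x P) =
     (let y = fresh (fimg \<theta> (fn_proc (Res x P))) in Res y (esub (\<theta>(x := Var y)) P))"
| "esub \<theta> (Case p P) =
     (let \<beta> = (\<lambda>x. fresh (fimg \<theta> (fn_proc (Case p P))) + idx (bnl p) x)
      in Case (psub \<theta> \<beta> p) (esub (updb \<theta> \<beta> (bn p)) P))"

section \<open>Elementary facts on patterns, free names and fresh names\<close>

lemma bn_simps [simp]:
  "bn (Bind x) = {x}" "bn (Var x) = {}" "bn (Prot x) = {}" "bn (Comp p q) = bn p \<union> bn q"
  by (auto simp: bn_def)

lemma fn_pat_simps [simp]: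
  "fn_pat (Bind x) = {}" "fn_pat (Var x) = {x}" "fn_pat (Prot x) = {x}"
  "fn_pat (Comp p q) = fn_pat p \<union> fn_pat q"
  by (auto simp: fn_pat_def)

lemma names_pat_simps [simp]:
  "names_pat (Bind x) = {x}" "names_pat (Var x) = {x}" "names_pat (Prot x) = {x}"
  "names_pat (Comp p q) = names_pat p \<union> names_pat q"
  by (auto simp: names_pat_def)

lemma communicable_simps [simp]:
  "\<not> communicable (Bind x)" "communicable (Var x)" "\<not> communicable (Prot x)"
  "communicable (Comp p q) \<longleftrightarrow> communicable p \<and> communicable q"
  by (auto simp: communicable_def)

lemma set_bnl: "set (bnl p) = bn p"
  by (simp add: bn_def)

lemma finite_pat [simp]: "finite (bn p)" "finite (vn p)" "finite (pn p)" "finite (fn_pat p)"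
  "finite (names_pat p)"
  by (induction p) auto

lemma finite_fn_proc [simp]: "finite (fn_proc P)"
  by (induction P) auto

lemma finite_all_names [simp]: "finite (all_names P)"
  by (induction P) auto

lemma finite_fimg [simp]: "finite A \<Longrightarrow> finite (fimg \<theta> A)"
  by (simp add: fimg_def)

lemma fresh_less: "finite A \<Longrightarrow> x \<in> A \<Longrightarrow> x < fresh A"
  by (simp add: fresh_def less_Suc_eq_le)

lemma fresh_notin: "finite A \<Longrightarrow> fresh A \<notin> A"
  using fresh_less by blast

lemma fresh_add_notin: "finite A \<Longrightarrow> fresh A + k \<notin> A"
  using fresh_less[of A "fresh A + k"] by auto

lemma ex_fresh: "finite A \<Longrightarrow> \<exists>y::name. y \<notin> A"
  using fresh_notin by blast

lemma csubD: "csub \<theta> \<Longrightarrow> communicable (\<theta> x)"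
  by (simp add: csub_def)

lemma csub_Var [simp]: "csub Var" "csub (\<lambda>x. Var (f x))" "csub (Var \<circ> f)"
  by (auto simp: csub_def)

lemma csub_upd [simp]: "csub \<theta> \<Longrightarrow> csub (\<theta>(x := Var y))"
  by (auto simp: csub_def)

lemma csub_updb [simp]: "csub \<theta> \<Longrightarrow> csub (updb \<theta> \<beta> B)"
  by (auto simp: csub_def updb_def)

lemma communicable_psub: "csub \<theta> \<Longrightarrow> communicable q \<Longrightarrow> communicable (psub \<theta> \<beta> q)"
  by (induction q) (auto simp: csubD)

lemma csub_cmp [simp]: "csub \<theta> \<Longrightarrow> csub \<theta>' \<Longrightarrow> csub (cmp \<theta>' \<theta>)"
  by (auto simp: csub_def cmp_def intro: communicable_psub[unfolded csub_def])

lemma csub_comp [simp]: "csub \<theta> \<Longrightarrow> csub (\<theta> \<circ> f)"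
  by (auto simp: csub_def)

lemma psub_communicable_cong: "communicable q \<Longrightarrow> (\<And>x. x \<in> fn_pat q \<Longrightarrow> \<theta> x = \<theta>' x) \<Longrightarrow>
    psub \<theta> \<beta> q = psub \<theta>' \<beta>' q"
  by (induction q) auto

lemma psub_cong: "(\<And>x. x \<in> fn_pat p \<Longrightarrow> \<theta> x = \<theta>' x) \<Longrightarrow> (\<And>x. x \<in> bn p \<Longrightarrow> \<beta> x = \<beta>' x) \<Longrightarrow>
    psub \<theta> \<beta> p = psub \<theta>' \<beta>' p"
  by (induction p) auto

lemma psub_id: "(\<And>x. x \<in> fn_pat p \<Longrightarrow> \<theta> x = Var x) \<Longrightarrow> (\<And>x. x \<in> bn p \<Longrightarrow> \<beta> x = x) \<Longrightarrow>
    psub \<theta> \<beta> p = p"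
  by (induction p) auto

lemma bnl_prot [simp]: "communicable q \<Longrightarrow> bnl (prot q) = []"
  by (induction q) auto

lemma bnl_communicable: "communicable q \<Longrightarrow> bnl q = []"
  by (induction q) auto

lemma fn_prot [simp]: "communicable q \<Longrightarrow> fn_pat (prot q) = fn_pat q"
  by (induction q) auto

lemma psub_prot: "csub \<theta> \<Longrightarrow> communicable q \<Longrightarrow> psub \<theta> \<beta> (prot q) = prot (psub \<theta> \<beta> q)"
  by (induction q) auto

lemma bnl_psub: "csub \<theta> \<Longrightarrow> bnl (psub \<theta> \<beta> p) = map \<beta> (bnl p)"
  by (induction p) (auto simp: bnl_communicable csubD)

lemma bn_psub: "csub \<theta> \<Longrightarrow> bn (psub \<theta> \<beta> p) = \<beta> ` bn p"
  by (simp add: bn_def bnl_psub)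

lemma fimg_simps [simp]:
  "fimg \<theta> {} = {}" "fimg \<theta> (A \<union> B) = fimg \<theta> A \<union> fimg \<theta> B"
  "fimg \<theta> (insert x A) = fn_pat (\<theta> x) \<union> fimg \<theta> A" "fimg Var A = A"
  "fimg (Var \<circ> f) A = f ` A"
  by (auto simp: fimg_def)

lemma fn_psub: "csub \<theta> \<Longrightarrow> fn_pat (psub \<theta> \<beta> p) = fimg \<theta> (fn_pat p)"
  by (induction p) (auto simp: csubD fimg_def)

lemma psub_psub: "csub \<theta> \<Longrightarrow> csub \<theta>' \<Longrightarrow>
    psub \<theta>' \<beta>' (psub \<theta> \<beta> p) = psub (cmp \<theta>' \<theta>) (\<beta>' \<circ> \<beta>) p"
proof (induction p)
  case (Prot x)
  then show ?case
    using psub_communicable_cong[of "\<theta> x" \<theta>' \<theta>' \<beta>' id] by (simp add: cmp_def csubD psub_prot)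
qed (auto simp: cmp_def csubD intro: psub_communicable_cong)

lemma cmp_Var [simp]: "cmp \<theta> Var = \<theta>"
  by (auto simp: cmp_def)

lemma psub_Var_id [simp]: "psub Var id p = p"
  by (rule psub_id) auto

lemma cmp_Var' [simp]: "cmp Var \<theta> = \<theta>"
  by (auto simp: cmp_def)

lemma cmp_Var_comp [simp]: "cmp \<theta> (Var \<circ> f) = \<theta> \<circ> f"
  by (auto simp: cmp_def)

lemma fimg_cmp: "csub \<theta> \<Longrightarrow> csub \<theta>' \<Longrightarrow> fimg (cmp \<theta>' \<theta>) A = fimg \<theta>' (fimg \<theta> A)"
  by (auto simp: fimg_def cmp_def fn_psub)

lemma fimg_cong: "(\<And>x. x \<in> A \<Longrightarrow> \<theta> x = \<theta>' x) \<Longrightarrow> fimg \<theta> A = fimg \<theta>' A"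
  by (auto simp: fimg_def)

lemma fimg_comp: "fimg (\<theta> \<circ> f) A = fimg \<theta> (f ` A)"
  by (auto simp: fimg_def)

lemma fimg_upd_diff: "y \<notin> fimg \<theta> (A - {x}) \<Longrightarrow> fimg (\<theta>(x := Var y)) A - {y} = fimg \<theta> (A - {x})"
  by (auto simp: fimg_def split: if_splits)

lemma fimg_updb_diff: "\<beta> ` B \<inter> fimg \<theta> (A - B) = {} \<Longrightarrow>
    fimg (updb \<theta> \<beta> B) A - \<beta> ` B = fimg \<theta> (A - B)"
  by (auto simp: fimg_def updb_def split: if_splits)

lemma idx_inj: "inj_on (idx xs) (set xs)"
proof (rule inj_onI)
  fix x y assume xy: "x \<in> set xs" "y \<in> set xs" "idx xs x = idx xs y"
  have *: "xs ! idx xs z = z" if "z \<in> set xs" for z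
  proof -
    have "takeWhile (\<lambda>y. y \<noteq> z) xs \<noteq> xs" using that by (auto simp: takeWhile_eq_all_conv)
    then have "length (takeWhile (\<lambda>y. y \<noteq> z) xs) < length xs"
      by (metis length_takeWhile_le le_neq_implies_less takeWhile_eq_take take_all_iff order_refl)
    from nth_length_takeWhile[OF this] show ?thesis by (simp add: idx_def)
  qed
  show "x = y" using *[OF xy(1)] *[OF xy(2)] xy(3) by metis
qed

text \<open>Injectivity makes the search for \<open>f x\<close> in the renamed list stop exactly
  where the search for \<open>x\<close> stops.\<close>

lemma idx_map: "inj_on f (insert x (set xs)) \<Longrightarrow> idx (map f xs) (f x) = idx xs x"
  unfolding idx_def takeWhile_map length_map
proof (rule arg_cong[where f = length], rule takeWhile_cong)
  fix z assume a: "inj_on f (insert x (set xs))" "z \<in> set xs"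
  show "((\<lambda>y. y \<noteq> f x) \<circ> f) z = (z \<noteq> x)"
    using inj_on_eq_iff[OF a(1), of z x] a(2) by simp
qed simp

text \<open>The new binder lies outside the image of the other free names, so removing it takes away
  the contribution of the old binder and nothing else.\<close>

lemma fn_esub: "csub \<theta> \<Longrightarrow> fn_proc (esub \<theta> P) = fimg \<theta> (fn_proc P)"
proof (induction P arbitrary: \<theta>)
  case (Res x P)
  define y where "y = fresh (fimg \<theta> (fn_proc (Res x P)))"
  have "y \<notin> fimg \<theta> (fn_proc P - {x})" 
    using fresh_notin[of "fimg \<theta> (fn_proc (Res x P))"] by (simp add: y_def)
  then show ?case
    using Res.IH[OF csub_upd, OF Res.prems, of x y] fimg_upd_diff[of y \<theta> "fn_proc P" x]
    unfolding esub.simps Let_def y_def[symmetric] by (simp del: fun_upd_apply)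
next
  case (Case p P)
  define \<beta> where "\<beta> = (\<lambda>x. fresh (fimg \<theta> (fn_proc (Case p P))) + idx (bnl p) x)"
  have "\<beta> ` bn p \<inter> fimg \<theta> (fn_proc (Case p P)) = {}"
    using fresh_add_notin[of "fimg \<theta> (fn_proc (Case p P))"] by (auto simp: \<beta>_def simp del: fn_proc.simps)
  then have "\<beta> ` bn p \<inter> fimg \<theta> (fn_proc P - bn p) = {}" by auto
  from fimg_updb_diff[OF this] show ?case
    using Case.IH[of "updb \<theta> \<beta> (bn p)"] Case.prems
    unfolding esub.simps Let_def \<beta>_def[symmetric] by (simp add: bn_psub fn_psub)
qed auto

text \<open>The choice of new binders also looks at \<theta> only on the free names, so both sides
  choose the same ones and the equation is syntactic.\<close>

lemma esub_cong: "(\<And>x. x \<in> fn_proc P \<Longrightarrow> \<theta> x = \<theta>' x) \<Longrightarrow> esub \<theta> P = esub \<theta>' P"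
proof (induction P arbitrary: \<theta> \<theta>')
  case Nil
  show ?case by simp
next
  case (Par P Q)
  show ?case using Par.IH(1)[of \<theta> \<theta>'] Par.IH(2)[of \<theta> \<theta>'] Par.prems by simp
next
  case (Rep P)
  show ?case using Rep.IH[of \<theta> \<theta>'] Rep.prems by simp
next
  case (Res x P)
  have *: "fimg \<theta> (fn_proc (Res x P)) = fimg \<theta>' (fn_proc (Res x P))"
    using Res.prems by (intro fimg_cong) auto
  have "esub (\<theta>(x := Var y)) P = esub (\<theta>'(x := Var y)) P" for y
    by (rule Res.IH) (use Res.prems in auto)
  then show ?case
    unfolding esub.simps * Let_def by (rule arg_cong)
next
  case (Case p P)
  have *: "fimg \<theta> (fn_proc (Case p P)) = fimg \<theta>' (fn_proc (Case p P))"
    using Case.prems by (intro fimg_cong) auto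
  have "esub (updb \<theta> \<beta> (bn p)) P = esub (updb \<theta>' \<beta> (bn p)) P" for \<beta>
    by (rule Case.IH) (use Case.prems in \<open>auto simp: updb_def\<close>)
  moreover have "psub \<theta> \<beta> p = psub \<theta>' \<beta> p" for \<beta>
    by (rule psub_cong) (use Case.prems in auto)
  ultimately show ?case
    unfolding esub.simps * Let_def by (intro arg_cong2[where f = Case])
qed

text \<open>The name \<open>y\<close> is an arbitrary fresh intermediate binder: the outer
  substitution forgets it and chooses again from the free names, which do not depend on
  \<open>y\<close>. The composition law for the body is a premise, so that the lemma can serve
  inside the induction that proves this law and again afterwards.\<close>

lemma esub_Res_gen:
  assumes "csub \<theta>" "csub \<theta>'" "y \<notin> fimg \<theta> (fn_proc (Res x P))"
    and IH: "\<And>\<theta> \<theta>'. csub \<theta> \<Longrightarrow> csub \<theta>' \<Longrightarrow> esub \<theta>' (esub \<theta> P) = esub (cmp \<theta>' \<theta>) P"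
  shows "esub \<theta>' (Res y (esub (\<theta>(x := Var y)) P)) = esub (cmp \<theta>' \<theta>) (Res x P)"
proof -
  have fn: "fn_proc (Res y (esub (\<theta>(x := Var y)) P)) = fimg \<theta> (fn_proc (Res x P))"
    using assms by (simp add: fn_esub fimg_upd_diff)
  define z where "z = fresh (fimg \<theta>' (fimg \<theta> (fn_proc (Res x P))))"
  have "esub (cmp (\<theta>'(y := Var z)) (\<theta>(x := Var y))) P = esub ((cmp \<theta>' \<theta>)(x := Var z)) P"
  proof (rule esub_cong)
    fix u assume "u \<in> fn_proc P"
    then show "cmp (\<theta>'(y := Var z)) (\<theta>(x := Var y)) u = ((cmp \<theta>' \<theta>)(x := Var z)) u"
      using assms by (auto simp: cmp_def csubD fimg_def intro!: psub_communicable_cong)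
  qed
  then show ?thesis
    using assms fn by (simp add: Let_def fimg_cmp IH z_def del: fn_proc.simps)
qed

lemma esub_Case_gen:
  assumes "csub \<theta>" "csub \<theta>'" "inj_on \<beta> (bn p)" "\<beta> ` bn p \<inter> fimg \<theta> (fn_proc (Case p P)) = {}"
    and IH: "\<And>\<theta> \<theta>'. csub \<theta> \<Longrightarrow> csub \<theta>' \<Longrightarrow> esub \<theta>' (esub \<theta> P) = esub (cmp \<theta>' \<theta>) P"
  shows "esub \<theta>' (Case (psub \<theta> \<beta> p) (esub (updb \<theta> \<beta> (bn p)) P)) = esub (cmp \<theta>' \<theta>) (Case p P)"
proof -
  have "\<beta> ` bn p \<inter> fimg \<theta> (fn_proc P - bn p) = {}" using assms(4) by auto
  then have fn: "fn_proc (Case (psub \<theta> \<beta> p) (esub (updb \<theta> \<beta> (bn p)) P)) = fimg \<theta> (fn_proc (Case p P))"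
    using assms by (simp add: fn_esub fn_psub bn_psub fimg_updb_diff)
  define m where "m = fresh (fimg \<theta>' (fimg \<theta> (fn_proc (Case p P))))"
  define \<gamma> where "\<gamma> = (\<lambda>x. m + idx (map \<beta> (bnl p)) x)"
  define \<delta> where "\<delta> = (\<lambda>x. m + idx (bnl p) x)"
  \<comment> \<open>An injective \<beta> keeps positions, so the canonical names chosen after
    \<beta> are those chosen directly for \<open>p\<close>.\<close>
  have gd: "\<gamma> (\<beta> x) = \<delta> x" if "x \<in> bn p" for x
    unfolding \<gamma>_def \<delta>_def using that assms(3) by (subst idx_map) (auto simp: set_bnl insert_absorb)
  have "psub \<theta>' \<gamma> (psub \<theta> \<beta> p) = psub (cmp \<theta>' \<theta>) \<delta> p"
    using assms gd by (auto simp: psub_psub intro: psub_cong)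
  moreover have "esub (cmp (updb \<theta>' \<gamma> (\<beta> ` bn p)) (updb \<theta> \<beta> (bn p))) P = esub (updb (cmp \<theta>' \<theta>) \<delta> (bn p)) P"
  proof (rule esub_cong)
    fix u assume u: "u \<in> fn_proc P"
    show "cmp (updb \<theta>' \<gamma> (\<beta> ` bn p)) (updb \<theta> \<beta> (bn p)) u = updb (cmp \<theta>' \<theta>) \<delta> (bn p) u"
    proof (cases "u \<in> bn p")
      case True then show ?thesis by (auto simp: cmp_def updb_def gd)
    next
      case False
      then have "v \<notin> \<beta> ` bn p" if "v \<in> fn_pat (\<theta> u)" for v
        using assms(4) u that by (auto simp: fimg_def)
      then show ?thesis using False assms
        by (auto simp: cmp_def updb_def csubD intro!: psub_communicable_cong)
    qed
  qed
  ultimately show ?thesis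
    using assms fn
    by (simp add: Let_def fimg_cmp IH m_def \<gamma>_def \<delta>_def bnl_psub bn_psub del: fn_proc.simps)
qed

lemma fresh_idx_props:
  assumes "finite A" "\<beta> = (\<lambda>x. fresh A + idx (bnl p) x)"
  shows "inj_on \<beta> (bn p)" "\<beta> ` bn p \<inter> A = {}"
  using assms idx_inj[of "bnl p"] fresh_add_notin[of A] by (auto simp: inj_on_def set_bnl)

text \<open>Composition is an equation between terms because the outer substitution forgets the
  canonical binders of the inner one. With \<open>Var\<close> as one of the two it makes
  \<open>esub Var\<close> a normal form that every substitution absorbs.\<close>

lemma esub_esub: "csub \<theta> \<Longrightarrow> csub \<theta>' \<Longrightarrow> esub \<theta>' (esub \<theta> P) = esub (cmp \<theta>' \<theta>) P"
proof (induction P arbitrary: \<theta> \<theta>')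
  case (Res x P)
  show ?case
    unfolding esub.simps(4)[of \<theta>] Let_def
    by (rule esub_Res_gen[OF Res.prems fresh_notin Res.IH]) simp_all
next
  case (Case p P)
  define A where "A = fimg \<theta> (fn_proc (Case p P))"
  have "finite A" by (simp add: A_def)
  then show ?case
    unfolding esub.simps(5)[of \<theta>] Let_def A_def[symmetric]
    by (intro esub_Case_gen[OF Case.prems _ _ Case.IH])
       (auto simp: A_def[symmetric] simp del: fn_proc.simps dest: fresh_idx_props[OF _ refl])
qed auto

lemma esub_Res: "csub \<theta> \<Longrightarrow> csub \<theta>' \<Longrightarrow> y \<notin> fimg \<theta> (fn_proc (Res x P)) \<Longrightarrow>
  esub \<theta>' (Res y (esub (\<theta>(x := Var y)) P)) = esub (cmp \<theta>' \<theta>) (Res x P)"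
  by (rule esub_Res_gen) (auto simp: esub_esub)

lemma esub_Case: "csub \<theta> \<Longrightarrow> csub \<theta>' \<Longrightarrow> inj_on \<beta> (bn p) \<Longrightarrow>
  \<beta> ` bn p \<inter> fimg \<theta> (fn_proc (Case p P)) = {} \<Longrightarrow>
  esub \<theta>' (Case (psub \<theta> \<beta> p) (esub (updb \<theta> \<beta> (bn p)) P)) = esub (cmp \<theta>' \<theta>) (Case p P)"
  by (rule esub_Case_gen) (auto simp: esub_esub)

section \<open>Swapping two names\<close>

lemma swap_name_inj: "inj (swap_name a b)" 
  by (auto simp: inj_def swap_name_def)

lemma swap_name_swap_name [simp]: "swap_name a b (swap_name a b x) = x"
  by (auto simp: swap_name_def)

lemma bij_swap_name [simp]: "bij (swap_name a b)"
  by (rule o_bij[of "swap_name a b"]) auto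

lemma swap_name_inj_simp [simp]: "swap_name a b x = swap_name a b y \<longleftrightarrow> x = y"
  using swap_name_inj[of a b] by (auto simp: inj_def)

lemma swap_pat_psub: "swap_pat a b p = psub (Var \<circ> swap_name a b) (swap_name a b) p"
  by (induction p) auto

lemma fn_swap_proc: "fn_proc (swap_proc a b P) = swap_name a b ` fn_proc P"
proof (induction P)
  case (Res x P)
  then show ?case by (auto simp: image_set_diff[OF swap_name_inj])
next
  case (Case p P)
  then show ?case by (auto simp: image_set_diff[OF swap_name_inj] swap_pat_psub fn_psub bn_psub)
qed auto

text \<open>A swap of all names, bound ones included, is absorbed into the substitution: positions
  of binders and the free names of the result are the same on both sides, hence so are the new
  binders.\<close>

lemma esub_swap: "csub \<theta> \<Longrightarrow> esub \<theta> (swap_proc a b P) = esub (\<theta> \<circ> swap_name a b) P"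
proof (induction P arbitrary: \<theta>)
  case (Res x P)
  define y where "y = fresh (fimg \<theta> (fn_proc (swap_proc a b (Res x P))))"
  have "y = fresh (fimg (\<theta> \<circ> swap_name a b) (fn_proc (Res x P)))"
    unfolding y_def fn_swap_proc fimg_comp ..
  moreover have "(\<theta>(swap_name a b x := Var y)) \<circ> swap_name a b = (\<theta> \<circ> swap_name a b)(x := Var y)"
    by (auto simp: fun_eq_iff)
  ultimately show ?case using Res.IH[OF csub_upd[OF Res.prems], of "swap_name a b x" y]
    unfolding swap_proc.simps esub.simps Let_def y_def[unfolded swap_proc.simps, symmetric] by metis
next
  case (Case p P)
  define m where "m = fresh (fimg \<theta> (fn_proc (swap_proc a b (Case p P))))"
  define \<beta> where "\<beta> = (\<lambda>x. m + idx (bnl (swap_pat a b p)) x)"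
  define \<beta>' where "\<beta>' = (\<lambda>x. m + idx (bnl p) x)"
  have m: "m = fresh (fimg (\<theta> \<circ> swap_name a b) (fn_proc (Case p P)))"
    unfolding m_def fn_swap_proc fimg_comp ..
  have "idx (bnl (swap_pat a b p)) (swap_name a b x) = idx (bnl p) x" for x
    by (simp add: swap_pat_psub bnl_psub) (rule idx_map, meson inj_on_subset subset_UNIV swap_name_inj)
  then have \<beta>: "\<beta> (swap_name a b x) = \<beta>' x" for x by (simp add: \<beta>_def \<beta>'_def)
  have "bn (swap_pat a b p) = swap_name a b ` bn p" by (simp add: swap_pat_psub bn_psub)
  then have e1: "updb \<theta> \<beta> (bn (swap_pat a b p)) \<circ> swap_name a b = updb (\<theta> \<circ> swap_name a b) \<beta>' (bn p)"
    using \<beta> by (auto simp: fun_eq_iff updb_def)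
  have e2: "psub \<theta> \<beta> (swap_pat a b p) = psub (\<theta> \<circ> swap_name a b) \<beta>' p"
    using Case.prems by (auto simp: swap_pat_psub psub_psub \<beta> intro: psub_cong)
  note IH = Case.IH[OF csub_updb[OF Case.prems], of \<beta> "bn (swap_pat a b p)"]
  show ?case
    unfolding swap_proc.simps esub.simps Let_def m[symmetric] m_def[unfolded swap_proc.simps, symmetric]
      \<beta>_def[symmetric] \<beta>'_def[symmetric] IH e1 e2 ..
qed auto

subsection \<open>Alpha-equivalence\<close>

lemma wf_pat_psub: "csub \<theta> \<Longrightarrow> wf_pat p \<Longrightarrow> inj_on \<beta> (bn p) \<Longrightarrow> \<beta> ` bn p \<inter> fimg \<theta> (fn_pat p) = {} \<Longrightarrow>
    wf_pat (psub \<theta> \<beta> p)"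
  by (simp add: wf_pat_def bnl_psub bn_psub fn_psub distinct_map set_bnl)

lemma wf_esub: "csub \<theta> \<Longrightarrow> wf_proc P \<Longrightarrow> wf_proc (esub \<theta> P)"
proof (induction P arbitrary: \<theta>)
  case (Res x P)
  then show ?case by (simp add: Let_def del: fun_upd_apply)
next
  case (Case p P)
  define \<beta> where "\<beta> = (\<lambda>x. fresh (fimg \<theta> (fn_proc (Case p P))) + idx (bnl p) x)"
  have "inj_on \<beta> (bn p)" "\<beta> ` bn p \<inter> fimg \<theta> (fn_proc (Case p P)) = {}"
    using fresh_idx_props[OF _ \<beta>_def] by simp_all
  then have "wf_pat (psub \<theta> \<beta> p)" using Case.prems by (intro wf_pat_psub) auto
  then show ?case using Case
    by (simp only: esub.simps Let_def \<beta>_def[symmetric] wf_proc.simps csub_updb)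
qed auto

lemma wf_pat_swap: "wf_pat (swap_pat a b p) \<longleftrightarrow> wf_pat p"
proof -
  have "wf_pat (swap_pat a b p)" if "wf_pat p" for p
    unfolding swap_pat_psub using that
    by (intro wf_pat_psub) (auto simp: inj_on_def wf_pat_def)
  moreover have "swap_pat a b (swap_pat a b p) = p" by (induction p) auto
  ultimately show ?thesis by metis
qed

lemma wf_swap_proc [simp]: "wf_proc (swap_proc a b P) \<longleftrightarrow> wf_proc P"
  by (induction P) (auto simp: wf_pat_swap)

lemma fn_Case_wf: "wf_pat p \<Longrightarrow> bn p \<inter> fn_proc (Case p P) = {}"
  by (auto simp: wf_pat_def)

text \<open>Both renaming rules swap two names that are not free in the process, so
  \<open>esub_swap\<close> and \<open>esub_cong\<close> make the swap invisible to
  \<open>esub\<close>. For a prefix this uses well-formedness: otherwise the renamed binder could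
  also occur free in the pattern.\<close>

lemma alpha_esub_aux:
  "alpha P Q \<Longrightarrow> (wf_proc P \<longleftrightarrow> wf_proc Q) \<and>
    (wf_proc P \<longrightarrow> fn_proc P = fn_proc Q \<and> (\<forall>\<theta>. csub \<theta> \<longrightarrow> esub \<theta> P = esub \<theta> Q))"
proof (induction rule: alpha.induct)
  case (alpha_case P P' p)
  then show ?case by simp
next
  case (alpha_res_ren y x P)
  have "esub \<theta> (swap_proc x y (Res x P)) = esub \<theta> (Res x P)" if "csub \<theta>" for \<theta>
    unfolding esub_swap[OF that] by (rule esub_cong) (use alpha_res_ren in \<open>auto simp: swap_name_def\<close>)
  moreover have "fn_proc (swap_proc x y (Res x P)) = fn_proc (Res x P)"
    unfolding fn_swap_proc using alpha_res_ren by (force simp: swap_name_def image_def)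
  moreover have "swap_proc x y (Res x P) = Res y (swap_proc x y P)" by (simp add: swap_name_def)
  ultimately show ?case by (metis wf_proc.simps(4) wf_swap_proc)
next
  case (alpha_case_ren x p y P)
  have n: "z \<noteq> x \<and> z \<noteq> y" if "wf_pat p" "z \<in> fn_proc (Case p P)" for z
    using that alpha_case_ren fn_Case_wf[OF that(1), of P] by blast
  have "esub \<theta> (swap_proc x y (Case p P)) = esub \<theta> (Case p P)" if "csub \<theta>" "wf_pat p" for \<theta>
    unfolding esub_swap[OF that(1)] by (rule esub_cong) (use n[OF that(2)] in \<open>auto simp: swap_name_def\<close>)
  moreover have "fn_proc (swap_proc x y (Case p P)) = fn_proc (Case p P)" if "wf_pat p"
  proof -
    have "swap_name x y ` fn_proc (Case p P) = id ` fn_proc (Case p P)"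
      using n[OF that] by (intro image_cong) (auto simp: swap_name_def)
    then show ?thesis unfolding fn_swap_proc by simp
  qed
  ultimately show ?case by (metis swap_proc.simps(5) wf_proc.simps(5) wf_swap_proc wf_pat_swap)
qed (simp_all add: Let_def del: fun_upd_apply)

lemma alpha_wf: "alpha P Q \<Longrightarrow> wf_proc P \<longleftrightarrow> wf_proc Q"
  and alpha_fn: "alpha P Q \<Longrightarrow> wf_proc P \<Longrightarrow> fn_proc P = fn_proc Q"
  and alpha_esub: "alpha P Q \<Longrightarrow> wf_proc P \<Longrightarrow> csub \<theta> \<Longrightarrow> esub \<theta> P = esub \<theta> Q"
  using alpha_esub_aux by blast+

lemma esub_norm [simp]: "csub \<theta> \<Longrightarrow> esub \<theta> (esub Var P) = esub \<theta> P"
  by (simp add: esub_esub)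

lemma norm_esub [simp]: "csub \<theta> \<Longrightarrow> esub Var (esub \<theta> P) = esub \<theta> P"
  by (simp add: esub_esub)

lemma fn_norm [simp]: "fn_proc (esub Var P) = fn_proc P"
  by (simp add: fn_esub)

text \<open>A simultaneous renaming of the binders has to be built from swaps of single binders, and
  a target name may itself be a binder still to be treated. The permutation \<pi> accumulates the
  swaps made so far, and \<open>A\<close> holds the binders already in place. The body
  \<open>R\<close> is known only through its substitution instances, which is enough to compute its
  normal form.\<close>

lemma alpha_Case_chain:
  assumes "wf_pat p" "wf_proc P" "inj_on \<beta> (bn p)" "\<beta> ` bn p \<inter> fn_proc (Case p P) = {}" "A \<subseteq> bn p"
  shows "\<exists>\<pi> R. inj \<pi> \<and> alpha (Case p P) (Case (psub (Var \<circ> \<pi>) \<pi> p) R) \<and> size R = size P \<and> wf_proc R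
    \<and> (\<forall>\<theta>. csub \<theta> \<longrightarrow> esub \<theta> R = esub (\<theta> \<circ> \<pi>) P) \<and> (\<forall>x\<in>A. \<pi> x = \<beta> x) \<and> (\<forall>x\<in>fn_proc (Case p P). \<pi> x = x)"
proof -
  have "finite A" by (rule finite_subset[OF assms(5)]) simp
  then show ?thesis using assms(5)
  proof (induction A)
    case empty
    have "psub (Var \<circ> id) id p = p" by simp
    then show ?case using assms(2)
      by (intro exI[of _ id] exI[of _ P]) (simp only: comp_id alpha_refl, simp)
  next
    case (insert x A)
    then have "A \<subseteq> bn p" by simp
    with insert.IH obtain \<pi> R where *: "inj \<pi>" "alpha (Case p P) (Case (psub (Var \<circ> \<pi>) \<pi> p) R)" "size R = size P"
      "wf_proc R" "\<And>\<theta>. csub \<theta> \<Longrightarrow> esub \<theta> R = esub (\<theta> \<circ> \<pi>) P" "\<And>z. z\<in>A \<Longrightarrow> \<pi> z = \<beta> z"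
      "\<And>z. z\<in>fn_proc (Case p P) \<Longrightarrow> \<pi> z = z" by blast
    \<comment> \<open>The next swap exchanges the present name of the binder \<open>x\<close> with
      its target.\<close>
    define a where "a = \<pi> x"
    define b where "b = \<beta> x"
    have wf: "wf_proc (Case p P)" using assms by simp
    have x: "x \<in> bn p" using insert by simp
    have "a \<in> bn (psub (Var \<circ> \<pi>) \<pi> p)" using x by (simp add: bn_psub a_def)
    moreover have "b \<notin> fn_proc (Case (psub (Var \<circ> \<pi>) \<pi> p) R)"
      using alpha_fn[OF *(2) wf] assms(4) x by (auto simp: b_def)
    ultimately have "alpha (Case p P) (Case (swap_pat a b (psub (Var \<circ> \<pi>) \<pi> p)) (swap_proc a b R))"
      using *(2) alpha_trans alpha_case_ren by blast
    moreover have "swap_pat a b (psub (Var \<circ> \<pi>) \<pi> p) = psub (Var \<circ> (swap_name a b \<circ> \<pi>)) (swap_name a b \<circ> \<pi>) p"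
      by (auto simp: swap_pat_psub psub_psub comp_assoc)
    moreover have "esub \<theta> (swap_proc a b R) = esub (\<theta> \<circ> (swap_name a b \<circ> \<pi>)) P" if "csub \<theta>" for \<theta>
      using that *(5)[of "\<theta> \<circ> swap_name a b"] by (simp add: esub_swap comp_assoc)
    \<comment> \<open>Binders in place stay there: their names differ from \<open>a\<close> because
      \<pi> is injective and from \<open>b\<close> because \<beta> is.\<close>
    moreover have "(swap_name a b \<circ> \<pi>) z = \<beta> z" if "z \<in> insert x A" for z
    proof (cases "z = x")
      case True then show ?thesis by (simp add: swap_name_def a_def b_def)
    next
      case False
      with that insert.prems have z: "z \<in> A" "z \<in> bn p" by auto
      have "\<pi> z = \<beta> z" by (rule *(6)[OF z(1)])
      moreover have "\<pi> z \<noteq> a" using False inj_eq[OF *(1)] by (simp add: a_def)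
      moreover have "\<beta> z \<noteq> b" using False inj_on_eq_iff[OF assms(3)] z(2) x by (simp add: b_def)
      ultimately show ?thesis by (simp add: swap_name_def)
    qed
    moreover have "(swap_name a b \<circ> \<pi>) z = z" if "z \<in> fn_proc (Case p P)" for z
    proof -
      have "z \<noteq> x" using that x fn_Case_wf[OF assms(1)] by blast
      then have "\<pi> z \<noteq> a" using inj_eq[OF *(1)] by (simp add: a_def)
      moreover have "z \<noteq> b" using that assms(4) x by (auto simp: b_def)
      ultimately show ?thesis using *(7)[OF that] by (simp add: swap_name_def)
    qed
    moreover have "inj (swap_name a b \<circ> \<pi>)" using *(1) swap_name_inj by (rule inj_compose[rotated])
    ultimately show ?case using *(3,4)
      by (intro exI[of _ "swap_name a b \<circ> \<pi>"] exI[of _ "swap_proc a b R"]) (auto simp del: fn_proc.simps comp_apply)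
  qed
qed

lemma alpha_Case_rename_aux:
  assumes "wf_pat p" "wf_proc P" "inj_on \<beta> (bn p)" "\<beta> ` bn p \<inter> fn_proc (Case p P) = {}"
    and IH: "\<And>R. size R = size P \<Longrightarrow> wf_proc R \<Longrightarrow> alpha R (esub Var R)"
  shows "alpha (Case p P) (Case (psub Var \<beta> p) (esub (updb Var \<beta> (bn p)) P))"
proof -
  obtain \<pi> R where *: "inj \<pi>" "alpha (Case p P) (Case (psub (Var \<circ> \<pi>) \<pi> p) R)" "size R = size P"
      "wf_proc R" "\<And>\<theta>. csub \<theta> \<Longrightarrow> esub \<theta> R = esub (\<theta> \<circ> \<pi>) P" "\<And>z. z\<in>bn p \<Longrightarrow> \<pi> z = \<beta> z"
      "\<And>z. z\<in>fn_proc (Case p P) \<Longrightarrow> \<pi> z = z" using alpha_Case_chain[OF assms(1-4) order_refl] by blast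
  have "psub (Var \<circ> \<pi>) \<pi> p = psub Var \<beta> p" using * by (intro psub_cong) auto
  moreover have "esub Var R = esub (updb Var \<beta> (bn p)) P"
    using *(5)[of Var] * by (auto intro!: esub_cong simp: updb_def)
  ultimately show ?thesis using *(2) IH[OF *(3,4)] alpha_trans alpha.alpha_case by metis
qed

text \<open>Induction on size, since the bodies produced by swaps are not subterms but keep the
  size.\<close>

lemma alpha_norm: "wf_proc P \<Longrightarrow> alpha P (esub Var P)"
proof (induction "size P" arbitrary: P rule: less_induct)
  case less
  show ?case
  proof (cases P)
    case Nil then show ?thesis by (simp add: alpha_refl)
  next
    case (Par P Q) then show ?thesis using less by (auto intro!: alpha.alpha_par)
  next
    case (Rep P) then show ?thesis using less by (auto intro!: alpha.alpha_rep)
  next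
    case (Res x Q)
    define y where "y = fresh (fn_proc (Res x Q))"
    have y: "y \<notin> fn_proc (Res x Q)" unfolding y_def by (intro fresh_notin) simp
    have "esub Var (swap_proc x y Q) = esub (Var(x := Var y)) Q"
      using y by (subst esub_swap) (auto intro!: esub_cong simp: swap_name_def)
    then have "alpha (swap_proc x y Q) (esub (Var(x := Var y)) Q)"
      using less(1)[of "swap_proc x y Q"] less(2) Res by simp
    then have "alpha (Res x Q) (Res y (esub (Var(x := Var y)) Q))"
      using y alpha.alpha_res alpha_res_ren alpha_trans by blast
    then show ?thesis unfolding Res esub.simps Let_def fimg_simps(4) y_def .
  next
    case (Case p Q)
    define \<beta> where "\<beta> = (\<lambda>x. fresh (fn_proc (Case p Q)) + idx (bnl p) x)"
    have "alpha (Case p Q) (Case (psub Var \<beta> p) (esub (updb Var \<beta> (bn p)) Q))"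
      using less Case fresh_idx_props[OF finite_fn_proc \<beta>_def] by (intro alpha_Case_rename_aux) auto
    then show ?thesis unfolding Case esub.simps Let_def fimg_simps(4) \<beta>_def[symmetric] .
  qed
qed

text \<open>Together with \<open>alpha_esub\<close> this reduces alpha-equivalence of well-formed
  processes to equality of normal forms.\<close>

lemma alphaI: "wf_proc P \<Longrightarrow> wf_proc Q \<Longrightarrow> esub Var P = esub Var Q \<Longrightarrow> alpha P Q"
  using alpha_norm alpha_sym alpha_trans by metis

lemma alpha_esub_Res:
  "csub \<theta> \<Longrightarrow> wf_proc P \<Longrightarrow> y \<notin> fimg \<theta> (fn_proc (Res x P)) \<Longrightarrow>
    alpha (esub \<theta> (Res x P)) (Res y (esub (\<theta>(x := Var y)) P))"
  using esub_Res[of \<theta> Var y x P] by (intro alphaI) (simp_all add: wf_esub del: fn_proc.simps esub.simps)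

lemma wf_Case_rename:
  "csub \<theta> \<Longrightarrow> wf_proc (Case p P) \<Longrightarrow> inj_on \<beta> (bn p) \<Longrightarrow> \<beta> ` bn p \<inter> fimg \<theta> (fn_proc (Case p P)) = {} \<Longrightarrow>
    wf_proc (Case (psub \<theta> \<beta> p) (esub (updb \<theta> \<beta> (bn p)) P))"
  by (auto intro!: wf_esub wf_pat_psub)

lemma alpha_esub_Case:
  "csub \<theta> \<Longrightarrow> wf_proc (Case p P) \<Longrightarrow> inj_on \<beta> (bn p) \<Longrightarrow> \<beta> ` bn p \<inter> fimg \<theta> (fn_proc (Case p P)) = {} \<Longrightarrow>
    alpha (esub \<theta> (Case p P)) (Case (psub \<theta> \<beta> p) (esub (updb \<theta> \<beta> (bn p)) P))"
  by (rule alphaI[OF wf_esub wf_Case_rename]) (simp_all only: norm_esub esub_Case cmp_Var' csub_Var)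

text \<open>Equality of normal forms is a congruence: the normal form of the body determines its
  free names and all its substitution instances, which is all that \<open>esub\<close> uses of the
  body.\<close>

lemma esub_Res_body:
  assumes "esub Var P = esub Var Q" "csub \<theta>"
  shows "esub \<theta> (Res x P) = esub \<theta> (Res x Q)"
proof -
  have "fn_proc (Res x P) = fn_proc (Res x Q)"
    using fn_norm[of P] fn_norm[of Q] assms by simp
  moreover have "esub \<phi> P = esub \<phi> Q" if "csub \<phi>" for \<phi>
    using esub_norm[OF that, of P] esub_norm[OF that, of Q] assms(1) by simp
  ultimately show ?thesis unfolding esub.simps Let_def using assms(2) by (metis csub_upd)
qed

lemma esub_Case_body:
  assumes "esub Var P = esub Var Q" "csub \<theta>"
  shows "esub \<theta> (Case p P) = esub \<theta> (Case p Q)"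
proof -
  have "fn_proc (Case p P) = fn_proc (Case p Q)"
    using fn_norm[of P] fn_norm[of Q] assms by simp
  moreover have "esub \<phi> P = esub \<phi> Q" if "csub \<phi>" for \<phi>
    using esub_norm[OF that, of P] esub_norm[OF that, of Q] assms(1) by simp
  ultimately show ?thesis unfolding esub.simps Let_def using assms(2) by (metis csub_updb)
qed

section \<open>The given substitution is \<open>esub\<close> up to alpha-equivalence\<close>

definition tot :: "subst \<Rightarrow> name \<Rightarrow> pat" where
  "tot \<sigma> x = (case \<sigma> x of Some q \<Rightarrow> q | None \<Rightarrow> Var x)"

lemma csub_tot: "is_subst \<sigma> \<Longrightarrow> csub (tot \<sigma>)"
  by (auto simp: csub_def tot_def is_subst_def ran_def split: option.splits)

lemma tot_notin [simp]: "x \<notin> dom \<sigma> \<Longrightarrow> tot \<sigma> x = Var x"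
  by (auto simp: tot_def domIff)

lemma psubst_psub: "psubst \<sigma> p = psub (tot \<sigma>) id p"
  by (induction p) (auto simp: tot_def split: option.splits)

lemma fimg_tot: "fimg (tot \<sigma>) A \<subseteq> fn_subst \<sigma> \<union> (A - dom \<sigma>)"
  by (auto simp: fimg_def tot_def fn_subst_def ran_def dom_def split: option.splits) metis+

lemma finite_names_subst: "is_subst \<sigma> \<Longrightarrow> finite (names_subst \<sigma>)"
  by (auto simp: names_subst_def fn_subst_def is_subst_def finite_ran)

definition swaps_name :: "(name \<times> name) list \<Rightarrow> name \<Rightarrow> name" where
  "swaps_name ps x = fold (\<lambda>(a, b). swap_name a b) ps x"

lemma swaps_Nil [simp]: "swaps_name [] = id" "swaps_pat [] p = p" "swaps_proc [] P = P"
  by (auto simp: fun_eq_iff swaps_name_def swaps_pat_def swaps_proc_def)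

lemma swaps_Cons [simp]: "swaps_name ((a, b) # ps) = swaps_name ps \<circ> swap_name a b"
  "swaps_pat ((a, b) # ps) p = swaps_pat ps (swap_pat a b p)"
  "swaps_proc ((a, b) # ps) P = swaps_proc ps (swap_proc a b P)"
  by (auto simp: fun_eq_iff swaps_name_def swaps_pat_def swaps_proc_def)

lemma swaps_name_inj: "inj (swaps_name ps)"
  by (induction ps) (force simp: inj_def)+

lemma swaps_pat_psub: "swaps_pat ps p = psub (Var \<circ> swaps_name ps) (swaps_name ps) p"
proof (induction ps arbitrary: p)
  case Nil
  have "psub Var id p = p" by simp
  then show ?case by (simp only: swaps_Nil comp_id)
next
  case (Cons ab ps)
  obtain a b where ab: "ab = (a, b)" by force
  show ?case unfolding ab
    by (simp only: swaps_Cons Cons swap_pat_psub psub_psub csub_Var cmp_Var_comp comp_assoc)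
qed

lemma wf_swaps [simp]: "wf_proc (swaps_proc ps P) \<longleftrightarrow> wf_proc P"
proof (induction ps arbitrary: P)
  case (Cons ab ps)
  obtain a b where ab: "ab = (a, b)" by force
  show ?case unfolding ab by (simp only: swaps_Cons Cons wf_swap_proc)
qed simp

lemma esub_swaps: "csub \<theta> \<Longrightarrow> esub \<theta> (swaps_proc ps P) = esub (\<theta> \<circ> swaps_name ps) P"
proof (induction ps arbitrary: P)
  case (Cons ab ps)
  obtain a b where ab: "ab = (a, b)" by force
  have "csub (\<theta> \<circ> swaps_name ps)" using Cons.prems by (rule csub_comp)
  then show ?case unfolding ab
    by (simp only: swaps_Cons Cons esub_swap comp_assoc)
qed simp

lemma swaps_name_zip:
  assumes "set xs \<inter> set ys = {}" "distinct xs" "distinct ys" "length xs = length ys"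
  shows "x \<notin> set xs \<Longrightarrow> x \<notin> set ys \<Longrightarrow> swaps_name (zip xs ys) x = x"
    and "x \<in> set xs \<Longrightarrow> swaps_name (zip xs ys) x \<in> set ys"
proof -
  have "(x \<notin> set xs \<and> x \<notin> set ys \<longrightarrow> swaps_name (zip xs ys) x = x)
      \<and> (x \<in> set xs \<longrightarrow> swaps_name (zip xs ys) x \<in> set ys)" for x
    using assms(4,1-3)
    by (induction xs ys arbitrary: x rule: list_induct2) (auto simp: swap_name_def)
  then show "x \<notin> set xs \<Longrightarrow> x \<notin> set ys \<Longrightarrow> swaps_name (zip xs ys) x = x"
    "x \<in> set xs \<Longrightarrow> swaps_name (zip xs ys) x \<in> set ys" by auto
qed

text \<open>The targets form a block of consecutive names above everything in \<open>A\<close>,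
  hence disjoint from the binders, so that the swaps do not interfere with each other.\<close>

lemma rename_pairs_swaps:
  assumes "finite A" "names_pat p \<subseteq> A"
  defines "\<pi> \<equiv> swaps_name (rename_pairs A p)"
  shows "x \<in> bn p \<Longrightarrow> \<pi> x \<notin> A" "x \<in> A - bn p \<Longrightarrow> \<pi> x = x"
proof -
  define xs where "xs = sorted_list_of_set (bn p)"
  define m where "m = fresh A"
  have \<pi>: "\<pi> = swaps_name (zip xs [m..<m + length xs])"
    by (simp add: \<pi>_def rename_pairs_def xs_def m_def Let_def)
  have xs: "set xs = bn p" "distinct xs" by (auto simp: xs_def)
  have m: "y < m" if "y \<in> A" for y using that assms(1) fresh_less by (auto simp: m_def)
  then have "set xs \<inter> set [m..<m + length xs] = {}"
    using assms(2) by (auto simp: xs names_pat_def) (meson less_le_not_le subsetD)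
  note z = swaps_name_zip[OF this xs(2)]
  show "x \<in> bn p \<Longrightarrow> \<pi> x \<notin> A" using z(2)[of x] m by (auto simp: \<pi> xs) (metis linorder_not_le)
  show "x \<in> A - bn p \<Longrightarrow> \<pi> x = x" using z(1)[of x] m by (auto simp: \<pi> xs) (metis linorder_not_le)
qed

text \<open>\<open>subst\<close> keeps a binder that does not clash, whereas \<open>esub\<close>
  always renames, so the two agree only after normalisation. In each case the binder that
  \<open>subst\<close> leaves is fresh for the image and can serve as the intermediate binder of
  \<open>esub_Res\<close> or \<open>esub_Case\<close>.\<close>

lemma subst_esub_aux:
  "is_subst \<sigma> \<Longrightarrow> wf_proc P \<Longrightarrow> wf_proc (subst \<sigma> P) \<and> esub Var (subst \<sigma> P) = esub (tot \<sigma>) P"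
proof (induction \<sigma> P rule: subst.induct)
  case (4 \<sigma> x P)
  note cs = csub_tot[OF 4(3)]
  show ?case
  proof (cases "x \<in> names_subst \<sigma>")
    case True
    define y where "y = fresh (names_subst \<sigma> \<union> all_names (Res x P))"
    have "y \<notin> names_subst \<sigma> \<union> all_names (Res x P)"
      unfolding y_def using finite_names_subst[OF 4(3)] by (intro fresh_notin) auto
    moreover have "fn_proc Q \<subseteq> all_names Q" for Q by (induction Q) (auto simp: names_pat_def)
    ultimately have y: "y \<notin> names_subst \<sigma>" "y \<notin> fn_proc P" "y \<noteq> x" by auto
    have IH: "wf_proc (subst \<sigma> (swap_proc x y P))" "esub Var (subst \<sigma> (swap_proc x y P)) = esub (tot \<sigma>) (swap_proc x y P)"
      using 4(1)[OF True y_def] 4(3,4) by auto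
    have "y \<notin> fimg (tot \<sigma>) (fn_proc (Res x P))"
      using y fimg_tot[of \<sigma> "fn_proc (Res x P)"] by (auto simp: names_subst_def)
    from esub_Res[OF cs csub_Var(1) this]
    have "esub (tot \<sigma>) (Res x P) = esub Var (Res y (esub ((tot \<sigma>)(x := Var y)) P))" by simp
    also have "\<dots> = esub Var (Res y (subst \<sigma> (swap_proc x y P)))"
    proof (rule esub_Res_body)
      have "esub (tot \<sigma>) (swap_proc x y P) = esub ((tot \<sigma>)(x := Var y)) P"
        unfolding esub_swap[OF cs]
        by (rule esub_cong) (use y in \<open>auto simp: swap_name_def names_subst_def\<close>)
      then show "esub Var (esub ((tot \<sigma>)(x := Var y)) P) = esub Var (subst \<sigma> (swap_proc x y P))"
        using IH(2) cs by (simp del: fun_upd_apply)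
    qed simp
    finally have "esub (tot \<sigma>) (Res x P) = esub Var (Res y (subst \<sigma> (swap_proc x y P)))" .
    moreover have "subst \<sigma> (Res x P) = Res y (subst \<sigma> (swap_proc x y P))"
      using True by (simp only: subst.simps if_True Let_def y_def)
    ultimately show ?thesis using IH by (simp del: esub.simps)
  next
    case False
    then have IH: "wf_proc (subst \<sigma> P)" "esub Var (subst \<sigma> P) = esub (tot \<sigma>) P" using 4(2)[OF False] 4(3,4) by auto
    have "x \<notin> fimg (tot \<sigma>) (fn_proc (Res x P))"
      using False fimg_tot[of \<sigma> "fn_proc (Res x P)"] by (auto simp: names_subst_def)
    from esub_Res[OF cs csub_Var(1) this]
    have "esub (tot \<sigma>) (Res x P) = esub Var (Res x (esub ((tot \<sigma>)(x := Var x)) P))" by simp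
    also have "\<dots> = esub Var (Res x (subst \<sigma> P))"
    proof (rule esub_Res_body)
      have "(tot \<sigma>)(x := Var x) = tot \<sigma>" using False by (auto simp: names_subst_def fun_eq_iff)
      then show "esub Var (esub ((tot \<sigma>)(x := Var x)) P) = esub Var (subst \<sigma> P)" using IH(2) cs by simp
    qed simp
    finally have "esub (tot \<sigma>) (Res x P) = esub Var (Res x (subst \<sigma> P))" .
    moreover have "subst \<sigma> (Res x P) = Res x (subst \<sigma> P)"
      using False by simp
    ultimately show ?thesis using IH by (simp del: esub.simps)
  qed
next
  case (5 \<sigma> p P)
  note cs = csub_tot[OF 5(3)]
  have wf: "wf_pat p" "wf_proc P" using 5(4) by auto
  show ?case
  proof (cases "bn p \<inter> names_subst \<sigma> = {}")
    case True
    have IH: "wf_proc (subst \<sigma> P)" "esub Var (subst \<sigma> P) = esub (tot \<sigma>) P"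
      using 5(1)[OF True] 5(3,4) by auto
    have fr: "id ` bn p \<inter> fimg (tot \<sigma>) (fn_proc (Case p P)) = {}"
      using fimg_tot[of \<sigma> "fn_proc (Case p P)"] True fn_Case_wf[OF wf(1), of P] by (fastforce simp: names_subst_def)
    have "wf_pat (psub (tot \<sigma>) id p)" using wf fr by (intro wf_pat_psub cs) auto
    moreover have "updb (tot \<sigma>) id (bn p) = tot \<sigma>"
    proof
      fix x show "updb (tot \<sigma>) id (bn p) x = tot \<sigma> x"
      proof (cases "x \<in> bn p")
        case x: True
        then have "x \<notin> dom \<sigma>" using True by (auto simp: names_subst_def)
        then show ?thesis using x by (simp add: updb_def)
      qed (simp add: updb_def)
    qed
    ultimately show ?thesis
      using esub_Case[OF cs csub_Var(1) _ fr] IH True cs esub_Case_body[of "subst \<sigma> P" "esub (tot \<sigma>) P" Var "psub (tot \<sigma>) id p"]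
      by (simp add: psubst_psub del: esub.simps)
  next
    case False
    define A where "A = names_subst \<sigma> \<union> all_names (Case p P)"
    define ps where "ps = rename_pairs A p"
    define \<pi> where "\<pi> = swaps_name ps"
    have IH: "wf_proc (subst \<sigma> (swaps_proc ps P))"
       "esub Var (subst \<sigma> (swaps_proc ps P)) = esub (tot \<sigma>) (swaps_proc ps P)"
      using 5(2)[OF False ps_def[unfolded A_def]] 5(3,4) by auto
    have "finite A" "names_pat p \<subseteq> A" using finite_names_subst[OF 5(3)] by (auto simp: A_def)
    note \<pi> = rename_pairs_swaps[OF this, folded ps_def, folded \<pi>_def]
    have "fn_proc Q \<subseteq> all_names Q" for Q by (induction Q) (auto simp: names_pat_def)
    then have fnA: "fn_proc (Case p P) \<subseteq> A" unfolding A_def by blast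
    have inj: "inj_on \<pi> (bn p)" unfolding \<pi>_def by (rule inj_on_subset[OF swaps_name_inj]) simp
    have fr: "\<pi> ` bn p \<inter> fimg (tot \<sigma>) (fn_proc (Case p P)) = {}"
      using fimg_tot[of \<sigma> "fn_proc (Case p P)"] \<pi>(1) fnA by (fastforce simp: names_subst_def A_def)
    have id: "\<pi> x = x" if "x \<in> fn_proc (Case p P)" for x
      using that \<pi>(2)[of x] fnA fn_Case_wf[OF wf(1), of P] by blast
    have 1: "psubst \<sigma> (swaps_pat ps p) = psub (tot \<sigma>) \<pi> p"
      unfolding psubst_psub swaps_pat_psub \<pi>_def[symmetric] using cs id
      by (auto simp: psub_psub intro!: psub_cong)
    have 2: "esub (tot \<sigma>) (swaps_proc ps P) = esub (updb (tot \<sigma>) \<pi> (bn p)) P"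
      unfolding esub_swaps[OF cs] \<pi>_def[symmetric] 
    proof (rule esub_cong)
      fix x assume x: "x \<in> fn_proc P"
      show "(tot \<sigma> \<circ> \<pi>) x = updb (tot \<sigma>) \<pi> (bn p) x"
        using \<pi>(1)[of x] id[of x] x by (cases "x \<in> bn p") (auto simp: updb_def A_def names_subst_def)
    qed
    have "wf_pat (psub (tot \<sigma>) \<pi> p)" using wf fr inj by (intro wf_pat_psub cs) auto
    then show ?thesis
      using esub_Case[OF cs csub_Var(1) inj fr] IH False cs
        esub_Case_body[of "subst \<sigma> (swaps_proc ps P)" "esub (updb (tot \<sigma>) \<pi> (bn p)) P" Var "psub (tot \<sigma>) \<pi> p"]
      by (simp add: Let_def A_def[symmetric] ps_def[symmetric] 1 2 del: esub.simps all_names.simps)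
  qed
qed auto

lemma wf_subst: "is_subst \<sigma> \<Longrightarrow> wf_proc P \<Longrightarrow> wf_proc (subst \<sigma> P)"
  and alpha_subst: "is_subst \<sigma> \<Longrightarrow> wf_proc P \<Longrightarrow> alpha (subst \<sigma> P) (esub (tot \<sigma>) P)"
  using subst_esub_aux[of \<sigma> P] csub_tot[of \<sigma>] by (auto intro!: alphaI wf_esub)

subsection \<open>Processes modulo structural congruence\<close>

declare sc_trans [trans]

lemma scong_wf: "scong P Q \<Longrightarrow> wf_proc P \<longleftrightarrow> wf_proc Q"
  by (induction rule: scong.induct) (auto simp: alpha_wf)

lemma scong_fn: "scong P Q \<Longrightarrow> wf_proc P \<Longrightarrow> fn_proc P = fn_proc Q"
proof (induction rule: scong.induct)
  case (sc_alpha P Q)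
  then show ?case by (simp add: alpha_fn)
qed (auto simp: scong_wf)

text \<open>No axiom deletes a vacuous restriction directly; scope extrusion moves it onto an added
  \<open>Nil\<close>.\<close>

lemma scong_Res_fresh: assumes "n \<notin> fn_proc P" shows "scong (Res n P) P"
proof -
  have "scong (Res n P) (Res n (Par P Nil))" by (intro sc_res sc_sym[OF sc_par_nil])
  also have "scong \<dots> (Par P (Res n Nil))" using assms by (intro sc_sym[OF sc_scope])
  also have "scong \<dots> (Par P Nil)" by (intro sc_par sc_refl sc_res_nil)
  also have "scong \<dots> P" by (rule sc_par_nil)
  finally show ?thesis .
qed

lemma scong_esub_Res: "csub \<theta> \<Longrightarrow> wf_proc P \<Longrightarrow> y \<notin> fimg \<theta> (fn_proc (Res x P)) \<Longrightarrow>
    scong (esub \<theta> (Res x P)) (Res y (esub (\<theta>(x := Var y)) P))"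
  by (intro sc_alpha alpha_esub_Res)

text \<open>The canonical names of the two restrictions depend on the order of nesting. Both sides
  are therefore opened with the same fresh \<open>u\<close> for \<open>n\<close> and
  \<open>v\<close> for \<open>m\<close>, where the axiom applies.\<close>

lemma scong_esub_res_comm:
  assumes "csub \<theta>" "wf_proc P"
  shows "scong (esub \<theta> (Res n (Res m P))) (esub \<theta> (Res m (Res n P)))"
proof (cases "n = m")
  case True
  then show ?thesis by (simp only: sc_refl)
next
  case False
  define A where "A = fimg \<theta> (fn_proc P)"
  have "finite A" by (simp add: A_def)
  then obtain u where u: "u \<notin> A" using ex_fresh by blast
  obtain v where v: "v \<notin> insert u A" using ex_fresh[of "insert u A"] \<open>finite A\<close> by blast
  have fr: "y \<notin> fimg (\<theta>(x := Var u)) (fn_proc P - {z})" if "y \<notin> insert u A" for x y z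
    using that by (auto simp: fimg_def A_def split: if_splits)
  have fr': "y \<notin> fimg \<theta> B" if "y \<notin> A" "B \<subseteq> fn_proc P" for y B
    using that by (auto simp: fimg_def A_def)
  have fr2: "y \<notin> fimg (\<theta>(x := Var v)) (fn_proc P - {z})" if "y \<notin> insert v A" for x y z
    using that by (auto simp: fimg_def A_def split: if_splits)
  have "scong (esub \<theta> (Res n (Res m P))) (Res u (esub (\<theta>(n := Var u)) (Res m P)))"
    using assms by (intro scong_esub_Res fr'[OF u]) auto
  also have "scong \<dots> (Res u (Res v (esub (\<theta>(n := Var u, m := Var v)) P)))"
    using assms fr[OF v] by (intro sc_res scong_esub_Res) simp_all
  also have "scong \<dots> (Res v (Res u (esub (\<theta>(n := Var u, m := Var v)) P)))"
    by (rule sc_res_comm)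
  also have "\<theta>(n := Var u, m := Var v) = \<theta>(m := Var v, n := Var u)"
    using False by (auto simp: fun_eq_iff)
  also have "scong (Res v (Res u (esub (\<theta>(m := Var v, n := Var u)) P))) (Res v (esub (\<theta>(m := Var v)) (Res n P)))"
    using assms fr2[of u] u v by (intro sc_res sc_sym[OF scong_esub_Res]) simp_all
  also have "scong \<dots> (esub \<theta> (Res m (Res n P)))"
    using assms v by (intro sc_sym[OF scong_esub_Res] fr') auto
  finally show ?thesis .
qed

text \<open>In the congruence rules for binders both sides choose the same new name, because
  structural congruence preserves free names. The axioms that move a restriction past something else
  call for a common fresh name.\<close>

lemma scong_esub: "scong P Q \<Longrightarrow> wf_proc P \<Longrightarrow> csub \<theta> \<Longrightarrow> scong (esub \<theta> P) (esub \<theta> Q)"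
proof (induction arbitrary: \<theta> rule: scong.induct)
  case (sc_alpha P Q)
  then show ?case by (simp add: alpha_esub sc_refl)
next
  case (sc_refl P)
  show ?case by (rule scong.sc_refl)
next
  case (sc_sym P Q)
  then show ?case using scong.sc_sym scong_wf by blast
next
  case (sc_trans P Q R)
  then show ?case using scong.sc_trans scong_wf by blast
next
  case (sc_par P P' Q Q')
  then show ?case by (simp add: scong.sc_par)
next
  case (sc_rep P P')
  then show ?case by (simp add: scong.sc_rep)
next
  case (sc_res P P' x)
  then have "fn_proc P = fn_proc P'" using scong_fn by simp
  then show ?case using sc_res by (simp add: Let_def scong.sc_res del: fun_upd_apply)
next
  case (sc_case P P' p)
  then have "fn_proc P = fn_proc P'" using scong_fn by simp
  then show ?case using sc_case by (simp add: Let_def scong.sc_case)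
next
  case (sc_par_nil P)
  then show ?case by (simp add: scong.sc_par_nil)
next
  case (sc_par_comm P Q)
  then show ?case by (simp add: scong.sc_par_comm)
next
  case (sc_par_assoc P Q R)
  then show ?case by (simp add: scong.sc_par_assoc)
next
  case (sc_res_nil n)
  then show ?case by (simp add: scong.sc_res_nil)
next
  case (sc_res_comm n m P)
  then show ?case by (intro scong_esub_res_comm) auto
next
  case (sc_rep_unfold P)
  then show ?case by (simp add: scong.sc_rep_unfold)
next
  case (sc_scope n P Q)
  obtain y where y: "y \<notin> fimg \<theta> (fn_proc P \<union> fn_proc Q)" using ex_fresh[of "fimg \<theta> (fn_proc P \<union> fn_proc Q)"] by auto
  have y': "y \<notin> fimg \<theta> (fn_proc (Res n Q))" "y \<notin> fimg \<theta> (fn_proc (Res n (Par P Q)))"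
    using y by (auto simp: fimg_def)
  have eq: "esub (\<theta>(n := Var y)) P = esub \<theta> P" using sc_scope(1) by (intro esub_cong) auto
  have "scong (esub \<theta> (Par P (Res n Q))) (Par (esub \<theta> P) (Res y (esub (\<theta>(n := Var y)) Q)))"
    using sc_scope y' scong_esub_Res[of \<theta> Q y n] by (simp add: scong.sc_refl scong.sc_par del: fun_upd_apply esub.simps(4))
  also have "scong \<dots> (Res y (Par (esub \<theta> P) (esub (\<theta>(n := Var y)) Q)))"
    using y sc_scope by (intro scong.sc_scope) (auto simp: fn_esub)
  also have "scong \<dots> (esub \<theta> (Res n (Par P Q)))"
    using scong_esub_Res[of \<theta> "Par P Q" y n] sc_scope y' eq by (simp add: scong.sc_sym del: fun_upd_apply esub.simps(4) fn_proc.simps)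
  finally show ?case .
qed

definition scong_wf_rel :: "proc \<Rightarrow> proc \<Rightarrow> bool" where
  "scong_wf_rel P Q \<longleftrightarrow> wf_proc P \<and> wf_proc Q \<and> scong P Q"

text \<open>The quotient is partial because, on ill-formed patterns, renaming a binder may also rename free
  occurrences, so that alpha-equivalence does not preserve free names there.\<close>
quotient_type cproc = proc / partial: scong_wf_rel
proof (rule part_equivpI)
  show "\<exists>x. scong_wf_rel x x" by (intro exI[of _ Nil]) (simp add: scong_wf_rel_def sc_refl)
qed (auto simp: symp_def transp_def scong_wf_rel_def intro: sc_sym sc_trans)

definition cls :: "proc \<Rightarrow> cproc" where "cls = abs_cproc"

lemma cls_eq: "wf_proc P \<Longrightarrow> wf_proc Q \<Longrightarrow> cls P = cls Q \<longleftrightarrow> scong P Q"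
  unfolding cls_def using Quotient_rel[OF Quotient_cproc, of P Q] by (auto simp: scong_wf_rel_def sc_refl)

lemma cls_cases: obtains P where "wf_proc P" "X = cls P"
proof -
  have "abs_cproc (rep_cproc X) = X" "scong_wf_rel (rep_cproc X) (rep_cproc X)"
    using Quotient_cproc unfolding Quotient_def by blast+
  then show ?thesis using that[of "rep_cproc X"] by (auto simp: cls_def scong_wf_rel_def)
qed

lift_definition cnil :: cproc is Nil by (simp add: scong_wf_rel_def sc_refl)
lift_definition cpar :: "cproc \<Rightarrow> cproc \<Rightarrow> cproc" is Par by (simp add: scong_wf_rel_def sc_par)
lift_definition cres :: "name \<Rightarrow> cproc \<Rightarrow> cproc" is Res by (simp add: scong_wf_rel_def sc_res)
lift_definition cfn :: "cproc \<Rightarrow> name set" is fn_proc by (simp add: scong_wf_rel_def scong_fn)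
text \<open>The guard makes the function respect the relation for every \<theta>; substitutions with
  non-communicable values get the identity as a dummy.\<close>

lift_definition csubst :: "(name \<Rightarrow> pat) \<Rightarrow> cproc \<Rightarrow> cproc" is "\<lambda>\<theta> P. if csub \<theta> then esub \<theta> P else P"
  by (simp add: scong_wf_rel_def scong_esub wf_esub)

lemma rel_self: "scong_wf_rel P P \<longleftrightarrow> wf_proc P"
  by (simp add: scong_wf_rel_def sc_refl)

lemma cls_Nil: "cls Nil = cnil"
  by (simp add: cls_def cnil.abs_eq)

lemma cls_Par: "wf_proc P \<Longrightarrow> wf_proc Q \<Longrightarrow> cls (Par P Q) = cpar (cls P) (cls Q)"
  by (simp add: cls_def cpar.abs_eq rel_self)

lemma cls_Res: "wf_proc P \<Longrightarrow> cls (Res n P) = cres n (cls P)"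
  by (simp add: cls_def cres.abs_eq rel_self)

lemma cfn_cls: "wf_proc P \<Longrightarrow> cfn (cls P) = fn_proc P"
  by (simp add: cls_def cfn.abs_eq rel_self)

lemma csubst_cls: "wf_proc P \<Longrightarrow> csub \<theta> \<Longrightarrow> csubst \<theta> (cls P) = cls (esub \<theta> P)"
  by (simp add: cls_def csubst.abs_eq rel_self)

lemmas cls_simps = cls_Nil[symmetric] cls_Par[symmetric] cls_Res[symmetric] cfn_cls csubst_cls cls_eq wf_esub

interpretation cpar: comm_monoid cpar cnil
proof
  fix X Y Z
  obtain P Q R where [simp]: "wf_proc P" "X = cls P" "wf_proc Q" "Y = cls Q" "wf_proc R" "Z = cls R"
    by (metis cls_cases)
  show "cpar (cpar X Y) Z = cpar X (cpar Y Z)" by (simp add: cls_simps sc_sym sc_par_assoc)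
  show "cpar X Y = cpar Y X" by (simp add: cls_simps sc_par_comm)
  show "cpar X cnil = X" by (simp add: cls_simps sc_par_nil)
qed

lemma finite_cfn [simp]: "finite (cfn X)"
  by (cases X rule: cls_cases) (simp add: cls_simps)

lemma cfn_simps [simp]: "cfn (cpar X Y) = cfn X \<union> cfn Y" "cfn (cres n X) = cfn X - {n}" "cfn cnil = {}"
  by (cases X rule: cls_cases; cases Y rule: cls_cases; simp add: cls_simps)+

lemma cres_comm: "cres n (cres m X) = cres m (cres n X)"
  by (cases X rule: cls_cases) (simp add: cls_simps sc_res_comm)

lemma cres_fresh: "n \<notin> cfn X \<Longrightarrow> cres n X = X"
  by (cases X rule: cls_cases) (simp add: cls_simps scong_Res_fresh)

lemma cpar_cres: "n \<notin> cfn X \<Longrightarrow> cpar X (cres n Y) = cres n (cpar X Y)"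
  by (cases X rule: cls_cases; cases Y rule: cls_cases) (simp add: cls_simps sc_scope)

lemma cres_cpar: "n \<notin> cfn Y \<Longrightarrow> cpar (cres n X) Y = cres n (cpar X Y)"
  using cpar_cres by (simp add: cpar.commute)

text \<open>A copy next to its replication is absorbed; this identity removes the idle copy that a
  transition of \<open>Rep P\<close> leaves over.\<close>

lemma cls_Rep: "wf_proc P \<Longrightarrow> cpar (cls P) (cls (Rep P)) = cls (Rep P)"
  by (simp add: cls_simps sc_sym sc_rep_unfold)

lemma csubst_cpar: "csub \<theta> \<Longrightarrow> csubst \<theta> (cpar X Y) = cpar (csubst \<theta> X) (csubst \<theta> Y)"
  by (cases X rule: cls_cases; cases Y rule: cls_cases) (simp add: cls_simps sc_refl)

lemma csubst_csubst: "csub \<theta> \<Longrightarrow> csub \<theta>' \<Longrightarrow> csubst \<theta>' (csubst \<theta> X) = csubst (cmp \<theta>' \<theta>) X"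
  by (cases X rule: cls_cases) (simp add: cls_simps esub_esub sc_refl)

lemma cls_norm: "wf_proc P \<Longrightarrow> cls (esub Var P) = cls P"
  by (simp add: cls_simps sc_sym[OF sc_alpha] alpha_norm)

lemma csubst_Var [simp]: "csubst Var X = X"
  by (cases X rule: cls_cases) (simp add: csubst_cls cls_norm)

lemma cls_alpha: "alpha P Q \<Longrightarrow> wf_proc P \<Longrightarrow> cls P = cls Q"
  using alpha_wf[of P Q] by (simp add: cls_simps sc_alpha)

lemma cfn_csubst: "csub \<theta> \<Longrightarrow> cfn (csubst \<theta> X) = fimg \<theta> (cfn X)"
  by (cases X rule: cls_cases) (simp add: cls_simps fn_esub)

lemma csubst_cong: "csub \<theta> \<Longrightarrow> csub \<theta>' \<Longrightarrow> (\<And>x. x \<in> cfn X \<Longrightarrow> \<theta> x = \<theta>' x) \<Longrightarrow> csubst \<theta> X = csubst \<theta>' X"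
  using esub_cong[of _ \<theta> \<theta>'] by (cases X rule: cls_cases) (simp add: csubst_cls cfn_cls)

lemma csubst_id: "csub \<theta> \<Longrightarrow> (\<And>x. x \<in> cfn X \<Longrightarrow> \<theta> x = Var x) \<Longrightarrow> csubst \<theta> X = X"
  using csubst_cong[of \<theta> Var X] by simp

text \<open>On classes every fresh \<open>y\<close> may serve as the new binder, no longer only the
  canonical one.\<close>

lemma csubst_cres: "csub \<theta> \<Longrightarrow> y \<notin> fimg \<theta> (cfn (cres x X)) \<Longrightarrow>
    csubst \<theta> (cres x X) = cres y (csubst (\<theta>(x := Var y)) X)"
  by (cases X rule: cls_cases) (simp add: cls_simps scong_esub_Res del: fun_upd_apply esub.simps)

lemma csubst_cres_fresh: "csub \<theta> \<Longrightarrow> x \<notin> fimg \<theta> (cfn X - {x}) \<Longrightarrow> \<theta> x = Var x \<Longrightarrow>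
    csubst \<theta> (cres x X) = cres x (csubst \<theta> X)"
  using csubst_cres[of \<theta> x x X] by (simp add: fun_upd_idem)

section \<open>Restriction by a finite set of names\<close>

definition cresS :: "name set \<Rightarrow> cproc \<Rightarrow> cproc" where
  "cresS N X = Finite_Set.fold cres X N"

text \<open>Idempotence holds because the outer of two equal restrictions is vacuous. It frees
  \<open>cresS_insert\<close> and \<open>cresS_Un\<close> from side conditions on membership or
  disjointness.\<close>

interpretation cres: comp_fun_idem_on UNIV cres
proof
  show "cres y \<circ> cres x = cres x \<circ> cres y" for x y by (simp add: fun_eq_iff cres_comm)
  show "cres x \<circ> cres x = cres x" for x by (simp add: fun_eq_iff cres_fresh)
qed

lemma cresS_empty [simp]: "cresS {} X = X"
  by (simp add: cresS_def)

lemma cresS_insert: "finite N \<Longrightarrow> cresS (insert n N) X = cres n (cresS N X)"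
  by (simp add: cresS_def)

lemma cresS_Un: "finite M \<Longrightarrow> finite N \<Longrightarrow> cresS (M \<union> N) X = cresS M (cresS N X)"
  by (induction M rule: finite_induct) (auto simp: cresS_insert)

lemma cfn_cresS [simp]: "finite N \<Longrightarrow> cfn (cresS N X) = cfn X - N"
  by (induction N rule: finite_induct) (auto simp: cresS_insert)

lemma cpar_cresS: "finite N \<Longrightarrow> N \<inter> cfn X = {} \<Longrightarrow> cpar X (cresS N Y) = cresS N (cpar X Y)"
  by (induction N rule: finite_induct) (auto simp: cresS_insert cpar_cres)

lemma cresS_cpar: "finite N \<Longrightarrow> N \<inter> cfn Y = {} \<Longrightarrow> cpar (cresS N X) Y = cresS N (cpar X Y)"
  using cpar_cresS by (simp add: cpar.commute)

lemma cres_cresS: "finite N \<Longrightarrow> cres n (cresS N X) = cresS N (cres n X)"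
  by (induction N rule: finite_induct) (auto simp: cresS_insert cres_comm[of n])

lemma cls_resS: "finite N \<Longrightarrow> wf_proc P \<Longrightarrow> wf_proc (resS N P) \<and> cls (resS N P) = cresS N (cls P)"
proof -
  have "wf_proc (resl xs P) \<and> cls (resl xs P) = cresS (set xs) (cls P)" if "wf_proc P" for xs
    using that by (induction xs) (auto simp: resl_def cls_Res cresS_insert)
  then show "finite N \<Longrightarrow> wf_proc P \<Longrightarrow> wf_proc (resS N P) \<and> cls (resS N P) = cresS N (cls P)"
    by (simp add: resS_def)
qed

lemma csubst_ren_cresS:
  assumes "finite N" "inj \<pi>"
  shows "csubst (Var \<circ> \<pi>) (cresS N X) = cresS (\<pi> ` N) (csubst (Var \<circ> \<pi>) X)"
  using assms(1)
proof (induction N rule: finite_induct)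
  case (insert n N)
  have "(Var \<circ> \<pi>)(n := Var (\<pi> n)) = Var \<circ> \<pi>" by (auto simp: fun_eq_iff)
  moreover have "\<pi> n \<notin> fimg (Var \<circ> \<pi>) (cfn (cres n (cresS N X)))"
    using inj_eq[OF assms(2)] by (auto simp: simp del: comp_apply)
  ultimately show ?case
    using insert csubst_cres[of "Var \<circ> \<pi>" "\<pi> n" n "cresS N X"] by (simp add: cresS_insert del: comp_apply fun_upd_apply)
qed simp

lemma csubst_cresS:
  assumes "finite N" "csub \<theta>" "\<And>x. x \<in> N \<Longrightarrow> \<theta> x = Var x" "N \<inter> fimg \<theta> (cfn X - N) = {}"
  shows "csubst \<theta> (cresS N X) = cresS N (csubst \<theta> X)"
proof -
  \<comment> \<open>For a subset \<open>M\<close> the class \<open>cresS M X\<close> may have free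
    names in \<open>N - M\<close>; they are fixed by \<theta> and hence cause no capture.\<close>
  have "csubst \<theta> (cresS M X) = cresS M (csubst \<theta> X)" if "finite M" "M \<subseteq> N" for M
    using that
  proof (induction M rule: finite_induct)
    case (insert n M)
    have "n \<notin> fimg \<theta> (cfn (cresS M X) - {n})"
    proof
      assume "n \<in> fimg \<theta> (cfn (cresS M X) - {n})"
      then obtain z where z: "z \<in> cfn X" "z \<noteq> n" "n \<in> fn_pat (\<theta> z)" using insert by (auto simp: fimg_def)
      then show False using assms(3)[of z] assms(4) insert.prems by (cases "z \<in> N") (auto simp: fimg_def)
    qed
    then show ?case using insert assms by (simp add: cresS_insert csubst_cres_fresh)
  qed simp
  then show ?thesis using assms(1) by blast
qed

subsection \<open>Transitions modulo structural congruence\<close>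

declare fun_upd_apply [simp del]

section \<open>Partial substitutions and unification\<close>

lemma fn_subst_simps [simp]: "fn_subst Map.empty = {}" "fn_subst [x \<mapsto> q] = fn_pat q"
  by (auto simp: fn_subst_def fun_upd_apply)

lemma fn_subst_add: "fn_subst (\<sigma> ++ \<tau>) \<subseteq> fn_subst \<sigma> \<union> fn_subst \<tau>"
  by (auto simp: fn_subst_def ran_def map_add_Some_iff)

lemma is_subst_simps [simp]: "is_subst Map.empty" "is_subst [x \<mapsto> q] \<longleftrightarrow> communicable q"
  by (auto simp: is_subst_def)

lemma is_subst_add: "is_subst \<sigma> \<Longrightarrow> is_subst \<tau> \<Longrightarrow> is_subst (\<sigma> ++ \<tau>)"
  by (auto simp: is_subst_def ran_def map_add_Some_iff)

lemma communicable_bn: "communicable q \<Longrightarrow> bn q = {}" and communicable_pn: "communicable q \<Longrightarrow> pn q = {}"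
  by (auto simp: communicable_def)

text \<open>Relational form of \<open>unify\<close> that admits rule induction. The two rules for
  binding names do not conflict, since a binding name is not communicable.\<close>

inductive unifies :: "pat \<Rightarrow> pat \<Rightarrow> subst \<Rightarrow> subst \<Rightarrow> bool" where
  unifies_name: "p \<in> {Var x, Prot x} \<Longrightarrow> q \<in> {Var x, Prot x} \<Longrightarrow> unifies p q Map.empty Map.empty"
| unifies_left: "communicable q \<Longrightarrow> unifies (Bind x) q [x \<mapsto> q] Map.empty"
| unifies_right: "communicable p \<Longrightarrow> unifies p (Bind x) Map.empty [x \<mapsto> p]"
| unifies_comp: "unifies p1 q1 \<sigma>1 \<rho>1 \<Longrightarrow> unifies p2 q2 \<sigma>2 \<rho>2 \<Longrightarrow>
     unifies (Comp p1 p2) (Comp q1 q2) (\<sigma>1 ++ \<sigma>2) (\<rho>1 ++ \<rho>2)"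

lemma unify_iff: "unify p q = Some (\<sigma>, \<rho>) \<longleftrightarrow> unifies p q \<sigma> \<rho>"
proof
  show "unify p q = Some (\<sigma>, \<rho>) \<Longrightarrow> unifies p q \<sigma> \<rho>"
    by (induction p q arbitrary: \<sigma> \<rho> rule: unify.induct)
       (auto split: if_splits option.splits intro: unifies_name unifies_left unifies_right,
        rule unifies_comp)
  show "unifies p q \<sigma> \<rho> \<Longrightarrow> unify p q = Some (\<sigma>, \<rho>)"
  proof (induction rule: unifies.induct)
    case (unifies_right p x)
    then show ?case by (cases p) auto
  qed auto
qed

lemma unify_dom: "unify p q = Some (\<sigma>, \<rho>) \<Longrightarrow> dom \<sigma> = bn p \<and> dom \<rho> = bn q"
  unfolding unify_iff by (induction rule: unifies.induct) (auto simp: communicable_bn simp del: domIff)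

lemma unify_is_subst: "unify p q = Some (\<sigma>, \<rho>) \<Longrightarrow> is_subst \<sigma> \<and> is_subst \<rho>"
  unfolding unify_iff by (induction rule: unifies.induct) (simp_all add: is_subst_add)

lemma unify_fn_subst: "unify p q = Some (\<sigma>, \<rho>) \<Longrightarrow> fn_subst \<sigma> \<subseteq> fn_pat q \<and> fn_subst \<rho> \<subseteq> fn_pat p"
  unfolding unify_iff
proof (induction rule: unifies.induct)
  case (unifies_comp p1 q1 \<sigma>1 \<rho>1 p2 q2 \<sigma>2 \<rho>2)
  then show ?case using fn_subst_add[of \<sigma>1 \<sigma>2] fn_subst_add[of \<rho>1 \<rho>2] by auto
qed auto

text \<open>A protected name can only be met by the same name, since patterns captured by a binding
  name contain no protected names. In a communication, a name unknown to the partner is thus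
  unprotected in the pattern that carries it.\<close>

lemma unify_pn: "unify p q = Some (\<sigma>, \<rho>) \<Longrightarrow> pn p \<subseteq> fn_pat q \<and> pn q \<subseteq> fn_pat p"
  unfolding unify_iff by (induction rule: unifies.induct) (auto simp: communicable_pn)

lemma unify_sym: "unify p q = Some (\<sigma>, \<rho>) \<Longrightarrow> unify q p = Some (\<rho>, \<sigma>)"
  unfolding unify_iff by (induction rule: unifies.induct) (auto intro: unifies.intros)

lemma is_match_unify: "unify p q = Some (\<sigma>, \<rho>) \<Longrightarrow> is_match p \<sigma> \<and> is_match q \<rho>"
  using unify_dom unify_is_subst by (auto simp: is_match_def)

lemma vn_pn_psub [simp]: "vn (psub (Var \<circ> f) \<beta> p) = f ` vn p" "pn (psub (Var \<circ> f) \<beta> p) = f ` pn p"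
  "vn (psub Var \<beta> p) = vn p" "pn (psub Var \<beta> p) = pn p"
  by (induction p) auto

lemma fn_psub_Var [simp]: "fn_pat (psub Var \<beta> p) = fn_pat p"
  by (simp add: fn_psub)

fun bnd :: "label \<Rightarrow> name set" where
  "bnd Tau = {}"
| "bnd (Out N p) = N \<union> bn p"

text \<open>Two copies suffice for replication, as a transition involves at most two components.\<close>
inductive st :: "proc \<Rightarrow> label \<Rightarrow> cproc \<Rightarrow> bool" where
  st_case: "inj_on \<beta> (bn p) \<Longrightarrow> \<beta> ` bn p \<inter> fn_proc (Case p P) = {} \<Longrightarrow>
     st (Case p P) (Out {} (psub Var \<beta> p)) (csubst (updb Var \<beta> (bn p)) (cls P))"
| st_res: "st (esub (Var(n := Var m)) P) \<mu> X \<Longrightarrow> m \<notin> fn_proc (Res n P) \<Longrightarrow> m \<notin> names_label \<mu> \<Longrightarrow>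
     st (Res n P) \<mu> (cres m X)"
| st_open: "st (esub (Var(n := Var m)) P) (Out N p) X \<Longrightarrow> m \<notin> fn_proc (Res n P) \<Longrightarrow>
     m \<in> vn p \<Longrightarrow> m \<notin> N \<union> pn p \<Longrightarrow> st (Res n P) (Out (insert m N) p) X"
| st_l: "st P \<mu> X \<Longrightarrow> bnd \<mu> \<inter> fn_proc Q = {} \<Longrightarrow> st (Par P Q) \<mu> (cpar X (cls Q))"
| st_r: "st Q \<mu> X \<Longrightarrow> bnd \<mu> \<inter> fn_proc P = {} \<Longrightarrow> st (Par P Q) \<mu> (cpar X (cls P))"
| st_com: "st P (Out M p) X \<Longrightarrow> st Q (Out N q) Y \<Longrightarrow> unify p q = Some (\<sigma>, \<rho>) \<Longrightarrow>
     M \<inter> fn_proc Q = {} \<Longrightarrow> N \<inter> fn_proc P = {} \<Longrightarrow> M \<inter> N = {} \<Longrightarrow>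
     st (Par P Q) Tau (cresS (M \<union> N) (cpar (csubst (tot \<sigma>) X) (csubst (tot \<rho>) Y)))"
| st_rep: "st (Par P P) \<mu> X \<Longrightarrow> st (Rep P) \<mu> (cpar X (cls (Rep P)))"

inductive_cases st_NilE: "st Nil \<mu> X"
inductive_cases st_ParE: "st (Par P Q) \<mu> X"
inductive_cases st_ResE: "st (Res n P) \<mu> X"
inductive_cases st_RepE: "st (Rep P) \<mu> X"
inductive_cases st_CaseE: "st (Case p P) \<mu> X"

text \<open>Variants with the target given by an equation, since targets are classes and rarely
  match a rule syntactically.\<close>

lemma st_intros_eq:
  "st P \<mu> X \<Longrightarrow> bnd \<mu> \<inter> fn_proc Q = {} \<Longrightarrow> Z = cpar X (cls Q) \<Longrightarrow> st (Par P Q) \<mu> Z"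
  "st Q \<mu> X \<Longrightarrow> bnd \<mu> \<inter> fn_proc P = {} \<Longrightarrow> Z = cpar X (cls P) \<Longrightarrow> st (Par P Q) \<mu> Z"
  "st P (Out M p) X \<Longrightarrow> st Q (Out N q) Y \<Longrightarrow> unify p q = Some (\<sigma>, \<rho>) \<Longrightarrow>
     M \<inter> fn_proc Q = {} \<Longrightarrow> N \<inter> fn_proc P = {} \<Longrightarrow> M \<inter> N = {} \<Longrightarrow>
     Z = cresS (M \<union> N) (cpar (csubst (tot \<sigma>) X) (csubst (tot \<rho>) Y)) \<Longrightarrow> st (Par P Q) Tau Z"
  "st (esub (Var(n := Var m)) P) \<mu> X \<Longrightarrow> m \<notin> fn_proc (Res n P) \<Longrightarrow> m \<notin> names_label \<mu> \<Longrightarrow>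
     Z = cres m X \<Longrightarrow> st (Res n P) \<mu> Z"
  "st (Par P P) \<mu> X \<Longrightarrow> Z = cpar X (cls (Rep P)) \<Longrightarrow> st (Rep P) \<mu> Z"
  by (blast intro: st.intros)+

definition fresh_label :: "label \<Rightarrow> proc \<Rightarrow> bool" where
  "fresh_label \<mu> P \<longleftrightarrow> finite (names_label \<mu>) \<and> bnd \<mu> \<inter> fn_proc P = {} \<and> names_label \<mu> \<subseteq> fn_proc P \<union> bnd \<mu>
     \<and> (\<forall>N p. \<mu> = Out N p \<longrightarrow> N \<subseteq> vn p \<and> N \<inter> pn p = {} \<and> wf_pat p)"

lemma fimg_upd_Var: "fimg (Var(n := Var m)) A = (A - {n}) \<union> (if n \<in> A then {m} else {})"
  by (auto simp: fimg_def fun_upd_apply split: if_splits)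

lemma fn_esub_upd: "fn_proc (esub (Var(n := Var m)) P) = (fn_proc P - {n}) \<union> (if n \<in> fn_proc P then {m} else {})"
  by (simp add: fn_esub fimg_upd_Var del: fun_upd_apply)

lemma vn_fn: "vn p \<subseteq> fn_pat p" and pn_fn: "pn p \<subseteq> fn_pat p"
  by (auto simp: fn_pat_def)

lemma fresh_label_OutD:
  assumes "fresh_label (Out N p) P"
  shows "finite N" "N \<subseteq> vn p" "N \<inter> pn p = {}" "wf_pat p" "N \<inter> fn_proc P = {}" "bn p \<inter> fn_proc P = {}"
    "fn_pat p \<subseteq> fn_proc P \<union> N" "N \<inter> bn p = {}"
  using assms vn_fn[of p] by (auto simp: fresh_label_def names_pat_def wf_pat_def)

text \<open>The binder rules pick their names fresh for the source, and \<open>st_l\<close>,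
  \<open>st_r\<close> check bound names against the idle component. In \<open>st_com\<close> the
  unifier brings in only free names of the opposite pattern, and those that were extruded are
  restricted again in the target.\<close>

lemma st_fresh: "st P \<mu> X \<Longrightarrow> wf_proc P \<Longrightarrow> fresh_label \<mu> P \<and> cfn X \<subseteq> fn_proc P \<union> bnd \<mu>"
proof (induction rule: st.induct)
  case (st_case \<beta> p P)
  have "wf_pat (psub Var \<beta> p)" using st_case by (intro wf_pat_psub) auto
  moreover have "fimg (updb Var \<beta> (bn p)) (fn_proc P) \<subseteq> (fn_proc P - bn p) \<union> \<beta> ` bn p"
    by (auto simp: fimg_def updb_def split: if_splits)
  ultimately show ?case using st_case
    by (auto simp: fresh_label_def bn_psub names_pat_def cfn_csubst cfn_cls dest!: vn_fn[THEN subsetD])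
next
  case (st_res n m P \<mu> X)
  then have *: "fresh_label \<mu> (esub (Var(n := Var m)) P)" "cfn X \<subseteq> fn_proc (esub (Var(n := Var m)) P) \<union> bnd \<mu>"
    by (simp_all add: wf_esub del: fun_upd_apply)
  then show ?case using st_res.hyps(2,3) unfolding fresh_label_def fn_esub_upd
    by (auto split: if_splits)
next
  case (st_open n m P N p X)
  then have *: "fresh_label (Out N p) (esub (Var(n := Var m)) P)"
      "cfn X \<subseteq> fn_proc (esub (Var(n := Var m)) P) \<union> bnd (Out N p)"
    by (simp_all add: wf_esub del: fun_upd_apply bnd.simps)
  then show ?case using st_open.hyps(2-4) unfolding fresh_label_def fn_esub_upd
    by (auto split: if_splits simp: names_pat_def)
next
  case (st_com P M p X Q N q Y \<sigma> \<rho>)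
  then have *: "fresh_label (Out M p) P" "cfn X \<subseteq> fn_proc P \<union> bnd (Out M p)"
    "fresh_label (Out N q) Q" "cfn Y \<subseteq> fn_proc Q \<union> bnd (Out N q)" by auto
  note p = fresh_label_OutD[OF *(1)] and q = fresh_label_OutD[OF *(3)]
  note u = unify_dom[OF st_com.hyps(3)] unify_fn_subst[OF st_com.hyps(3)] unify_is_subst[OF st_com.hyps(3)]
  have "fimg (tot \<sigma>) (cfn X) \<subseteq> fn_pat q \<union> (cfn X - bn p)" "fimg (tot \<rho>) (cfn Y) \<subseteq> fn_pat p \<union> (cfn Y - bn q)"
    using fimg_tot[of \<sigma> "cfn X"] fimg_tot[of \<rho> "cfn Y"] u by blast+
  moreover have "cfn X - bn p \<subseteq> fn_proc P \<union> M" "cfn Y - bn q \<subseteq> fn_proc Q \<union> N" using *(2,4) by auto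
  ultimately have "fimg (tot \<sigma>) (cfn X) \<subseteq> fn_proc P \<union> fn_proc Q \<union> M \<union> N"
    "fimg (tot \<rho>) (cfn Y) \<subseteq> fn_proc P \<union> fn_proc Q \<union> M \<union> N" using p(7) q(7) by blast+
  then show ?case using u p(1) q(1)
    by (auto simp: fresh_label_def cfn_csubst csub_tot)
qed (auto simp: fresh_label_def cfn_cls)

lemma norm_eq_fn: "esub Var P = esub Var Q \<Longrightarrow> fn_proc P = fn_proc Q"
  by (metis fn_norm)

lemma norm_Par: "esub Var Q = Par A B \<longleftrightarrow> (\<exists>Q1 Q2. Q = Par Q1 Q2 \<and> esub Var Q1 = A \<and> esub Var Q2 = B)"
  by (cases Q) (auto simp: Let_def)

lemma norm_Rep: "esub Var Q = Rep A \<longleftrightarrow> (\<exists>Q1. Q = Rep Q1 \<and> esub Var Q1 = A)"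
  by (cases Q) (auto simp: Let_def)

text \<open>Equal normal forms compare the bodies only at the canonical name \<open>y\<close>;
  replacing \<open>y\<close> by \<open>m\<close> afterwards gives every other fresh name.\<close>

lemma norm_Res_inv:
  assumes "esub Var (Res n P) = esub Var Q"
  obtains k Q' where "Q = Res k Q'"
    "\<And>m. m \<notin> fn_proc (Res n P) \<Longrightarrow> esub (Var(n := Var m)) P = esub (Var(k := Var m)) Q'"
proof -
  obtain k Q' where Q: "Q = Res k Q'" using assms by (cases Q) (auto simp: Let_def)
  define y where "y = fresh (fn_proc (Res n P))"
  have y: "y \<notin> fn_proc (Res n P)" unfolding y_def by (intro fresh_notin) simp
  have fn: "fn_proc (Res n P) = fn_proc (Res k Q')" using norm_eq_fn[OF assms] Q by simp
  have eq: "esub (Var(n := Var y)) P = esub (Var(k := Var y)) Q'"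
    using assms by (simp only: Q esub.simps Let_def fimg_simps fn y_def proc.inject)
  have "esub (Var(n := Var m)) P = esub (Var(k := Var m)) Q'" if "m \<notin> fn_proc (Res n P)" for m
  proof -
    have "esub (Var(z := Var m)) A = esub (Var(y := Var m)) (esub (Var(z := Var y)) A)"
      if "y \<notin> fn_proc (Res z A)" for z A
      using that by (simp add: esub_esub del: fun_upd_apply) (auto intro!: esub_cong simp: cmp_def fun_upd_apply)
    from this[of n P] this[of k Q'] show ?thesis using y eq unfolding fn by simp
  qed
  then show ?thesis using that Q by blast
qed

lemma norm_Case_inv:
  assumes "esub Var (Case p P) = esub Var Q" "inj_on \<beta> (bn p)" "\<beta> ` bn p \<inter> fn_proc (Case p P) = {}"
  obtains q Q' \<gamma> where "Q = Case q Q'" "inj_on \<gamma> (bn q)" "\<gamma> ` bn q \<inter> fn_proc (Case q Q') = {}"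
    "psub Var \<beta> p = psub Var \<gamma> q" "esub (updb Var \<beta> (bn p)) P = esub (updb Var \<gamma> (bn q)) Q'"
proof -
  obtain q Q' where Q: "Q = Case q Q'" using assms by (cases Q) (auto simp: Let_def)
  have fn: "fn_proc (Case p P) = fn_proc (Case q Q')" using norm_eq_fn[OF assms(1)] Q by simp
  define A where "A = fn_proc (Case p P)"
  define b0 where "b0 = (\<lambda>x. fresh A + idx (bnl p) x)"
  define c0 where "c0 = (\<lambda>x. fresh A + idx (bnl q) x)"
  have A: "finite A" by (simp add: A_def)
  note b0 = fresh_idx_props[OF A b0_def] and c0 = fresh_idx_props[OF A c0_def]
  have eq: "psub Var b0 p = psub Var c0 q" "esub (updb Var b0 (bn p)) P = esub (updb Var c0 (bn q)) Q'"
    using assms(1) unfolding Q esub.simps Let_def fimg_simps fn[symmetric] A_def[symmetric] b0_def[symmetric] c0_def[symmetric]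
    by simp_all
  have bn: "b0 ` bn p = c0 ` bn q" using arg_cong[OF eq(1), of bn] by (simp add: bn_psub)
  \<comment> \<open>The canonical binders of \<open>p\<close> and \<open>q\<close> form the same
    set; \<delta> carries this set to the names chosen by \<beta>, and composing it with the
    canonical choice for \<open>q\<close> yields the required \<gamma>.\<close>
  define \<delta> where "\<delta> = \<beta> \<circ> the_inv_into (bn p) b0"
  define \<gamma> where "\<gamma> = \<delta> \<circ> c0"
  have \<delta>: "\<delta> (b0 x) = \<beta> x" if "x \<in> bn p" for x using that b0 by (simp add: \<delta>_def the_inv_into_f_f)
  have im: "\<gamma> ` bn q = \<beta> ` bn p"
  proof -
    have "\<gamma> ` bn q = \<delta> ` (b0 ` bn p)" by (simp add: \<gamma>_def image_comp bn)
    also have "\<dots> = \<beta> ` bn p" using \<delta> by (auto simp: image_iff)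
    finally show ?thesis .
  qed
  have "inj_on \<delta> (b0 ` bn p)" using assms(2) \<delta> by (auto simp: inj_on_def)
  then have 1: "inj_on \<gamma> (bn q)" unfolding \<gamma>_def using c0(1) bn by (simp add: comp_inj_on)
  have "psub Var \<beta> p = psub Var \<delta> (psub Var b0 p)" using \<delta> by (simp add: psub_psub) (auto intro!: psub_cong)
  also have "\<dots> = psub Var \<delta> (psub Var c0 q)" by (simp add: eq)
  also have "\<dots> = psub Var \<gamma> q" by (simp add: psub_psub \<gamma>_def)
  finally have 2: "psub Var \<beta> p = psub Var \<gamma> q" .
  have *: "esub (updb Var (\<delta> \<circ> b) B) R = esub (updb Var \<delta> (b ` B)) (esub (updb Var b B) R)"
    if "b ` B \<inter> (fn_proc R - B) = {}" for b B R
    unfolding esub_esub[OF csub_updb[OF csub_Var(1)] csub_updb[OF csub_Var(1)]]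
  proof (rule esub_cong)
    fix u assume "u \<in> fn_proc R"
    then have "u \<notin> b ` B" if "u \<notin> B" using that \<open>b ` B \<inter> (fn_proc R - B) = {}\<close> by blast
    then show "updb Var (\<delta> \<circ> b) B u = cmp (updb Var \<delta> (b ` B)) (updb Var b B) u"
      by (auto simp: cmp_def updb_def)
  qed
  have "esub (updb Var \<beta> (bn p)) P = esub (updb Var (\<delta> \<circ> b0) (bn p)) P"
    using \<delta> by (auto intro!: esub_cong simp: updb_def)
  also have "\<dots> = esub (updb Var \<gamma> (bn q)) Q'"
  proof -
    have "b0 ` bn p \<inter> (fn_proc P - bn p) = {}" using b0(2) by (auto simp: A_def)
    moreover have "c0 ` bn q \<inter> (fn_proc Q' - bn q) = {}" using c0(2) unfolding A_def fn by auto
    ultimately show ?thesis using *[of b0 "bn p" P] *[of c0 "bn q" Q'] unfolding \<gamma>_def bn eq(2) by simp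
  qed
  finally have 3: "esub (updb Var \<beta> (bn p)) P = esub (updb Var \<gamma> (bn q)) Q'" .
  have 4: "\<gamma> ` bn q \<inter> fn_proc (Case q Q') = {}" unfolding im fn[symmetric] by (rule assms(3))
  show ?thesis by (rule that[OF Q 1 4 2 3])
qed

lemma cls_norm_eq: "esub Var P = esub Var Q \<Longrightarrow> wf_proc P \<Longrightarrow> wf_proc Q \<Longrightarrow> cls P = cls Q"
  by (metis cls_norm)

text \<open>Since \<beta> and \<open>m\<close> in the binder rules range over all fresh choices, the
  choice made for \<open>P\<close> can be repeated for \<open>Q\<close>. This gives invariance under
  alpha-equivalence with an unchanged label and an unchanged class as target.\<close>

lemma st_norm: "st P \<mu> X \<Longrightarrow> wf_proc P \<Longrightarrow> wf_proc Q \<Longrightarrow> esub Var P = esub Var Q \<Longrightarrow> st Q \<mu> X"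
proof (induction arbitrary: Q rule: st.induct)
  case (st_case \<beta> p P)
  obtain q Q' \<gamma> where *: "Q = Case q Q'" "inj_on \<gamma> (bn q)" "\<gamma> ` bn q \<inter> fn_proc (Case q Q') = {}"
    "psub Var \<beta> p = psub Var \<gamma> q" "esub (updb Var \<beta> (bn p)) P = esub (updb Var \<gamma> (bn q)) Q'"
    using norm_Case_inv[OF st_case.prems(3) st_case.hyps] by blast
  have "csubst (updb Var \<beta> (bn p)) (cls P) = csubst (updb Var \<gamma> (bn q)) (cls Q')"
    using st_case.prems *(1,5) by (simp add: csubst_cls)
  then show ?case using st.st_case[OF *(2,3)] unfolding *(1,4) by simp
next
  case (st_res n m P \<mu> X)
  obtain k Q' where *: "Q = Res k Q'"
    "\<And>m. m \<notin> fn_proc (Res n P) \<Longrightarrow> esub (Var(n := Var m)) P = esub (Var(k := Var m)) Q'"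
    using norm_Res_inv[OF st_res.prems(3)] by blast
  show ?case unfolding *(1)
    using st_res.hyps *(2)[OF st_res.hyps(2)] norm_eq_fn[OF st_res.prems(3), unfolded *(1)]
    by (intro st.st_res) (simp_all only: not_False_eq_True)
next
  case (st_open n m P N p X)
  obtain k Q' where *: "Q = Res k Q'"
    "\<And>m. m \<notin> fn_proc (Res n P) \<Longrightarrow> esub (Var(n := Var m)) P = esub (Var(k := Var m)) Q'"
    using norm_Res_inv[OF st_open.prems(3)] by blast
  show ?case unfolding *(1)
    using st_open.hyps *(2)[OF st_open.hyps(2)] norm_eq_fn[OF st_open.prems(3), unfolded *(1)]
    by (intro st.st_open) (simp_all only: not_False_eq_True)
next
  case (st_l P \<mu> X R)
  obtain Q1 Q2 where *: "Q = Par Q1 Q2" "esub Var Q1 = esub Var P" "esub Var Q2 = esub Var R"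
    using st_l.prems(3) by (metis norm_Par esub.simps(2))
  then show ?case using st_l norm_eq_fn[OF *(3)]
    by (intro st_intros_eq(1)[of Q1 \<mu> X Q2, folded *(1)]) (auto intro!: arg_cong[where f = "cpar X"] cls_norm_eq)
next
  case (st_r P \<mu> X R)
  obtain Q1 Q2 where *: "Q = Par Q1 Q2" "esub Var Q1 = esub Var R" "esub Var Q2 = esub Var P"
    using st_r.prems(3) by (metis norm_Par esub.simps(2))
  then show ?case using st_r norm_eq_fn[OF *(2)]
    by (intro st_intros_eq(2)[of Q2 \<mu> X Q1, folded *(1)]) (auto intro!: arg_cong[where f = "cpar X"] cls_norm_eq)
next
  case (st_com P M p X R N q Y \<sigma> \<rho>)
  obtain Q1 Q2 where *: "Q = Par Q1 Q2" "esub Var Q1 = esub Var P" "esub Var Q2 = esub Var R"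
    using st_com.prems(3) by (metis norm_Par esub.simps(2))
  have "st Q1 (Out M p) X" "st Q2 (Out N q) Y" using * st_com by auto
  then show ?case using st_com.hyps(3-6) norm_eq_fn[OF *(2)] norm_eq_fn[OF *(3)] unfolding *(1)
    by (intro st.st_com) auto
next
  case (st_rep P \<mu> X)
  obtain Q1 where *: "Q = Rep Q1" "esub Var Q1 = esub Var P"
    using st_rep.prems(3) by (metis norm_Rep esub.simps(3))
  have "st (Par Q1 Q1) \<mu> X" using * st_rep by auto
  then show ?case using st_rep.prems * cls_norm_eq[of "Rep P" "Rep Q1"] unfolding *(1)
    by (intro st_intros_eq(5)) auto
qed

lemma st_alpha: "st P \<mu> X \<Longrightarrow> wf_proc P \<Longrightarrow> alpha P Q \<Longrightarrow> st Q \<mu> X"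
  using st_norm alpha_wf alpha_esub csub_Var(1) by blast

section \<open>Equivariance and the choice of bound names\<close>

fun ren_lab :: "(name \<Rightarrow> name) \<Rightarrow> label \<Rightarrow> label" where
  "ren_lab \<pi> Tau = Tau"
| "ren_lab \<pi> (Out N p) = Out (\<pi> ` N) (psub (Var \<circ> \<pi>) \<pi> p)"

text \<open>Conjugation of \<sigma> by \<pi>: the domain and the values are renamed
  together.\<close>

definition ren_sub :: "(name \<Rightarrow> name) \<Rightarrow> subst \<Rightarrow> subst" where
  "ren_sub \<pi> \<sigma> = map_option (psub (Var \<circ> \<pi>) id) \<circ> \<sigma> \<circ> inv \<pi>"

lemma ren_sub_simps:
  assumes "bij \<pi>"
  shows "ren_sub \<pi> Map.empty = Map.empty" "ren_sub \<pi> [x \<mapsto> q] = [\<pi> x \<mapsto> psub (Var \<circ> \<pi>) id q]"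
    "ren_sub \<pi> (\<sigma> ++ \<tau>) = ren_sub \<pi> \<sigma> ++ ren_sub \<pi> \<tau>"
proof -
  have [simp]: "inv \<pi> z = x \<longleftrightarrow> z = \<pi> x" for x z using assms by (metis bij_inv_eq_iff)
  show "ren_sub \<pi> Map.empty = Map.empty" "ren_sub \<pi> [x \<mapsto> q] = [\<pi> x \<mapsto> psub (Var \<circ> \<pi>) id q]"
    "ren_sub \<pi> (\<sigma> ++ \<tau>) = ren_sub \<pi> \<sigma> ++ ren_sub \<pi> \<tau>"
    by (auto simp: ren_sub_def fun_eq_iff map_add_def fun_upd_apply split: option.splits)
qed

lemma communicable_ren: "communicable (psub (Var \<circ> \<pi>) \<beta> q) \<longleftrightarrow> communicable q"
  by (auto simp: communicable_def bn_psub)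

lemma unify_ren:
  assumes "bij \<pi>" "unify p q = Some (\<sigma>, \<rho>)"
  shows "unify (psub (Var \<circ> \<pi>) \<pi> p) (psub (Var \<circ> \<pi>) \<pi> q) = Some (ren_sub \<pi> \<sigma>, ren_sub \<pi> \<rho>)"
  using assms(2) unfolding unify_iff
proof (induction rule: unifies.induct)
  case (unifies_name p x q)
  then show ?case using assms(1) by (auto simp: ren_sub_simps intro: unifies.unifies_name)
next
  case (unifies_left q x)
  then have *: "psub (Var \<circ> \<pi>) \<pi> q = psub (Var \<circ> \<pi>) id q" by (intro psub_communicable_cong) auto
  then show ?case using unifies.unifies_left[of "psub (Var \<circ> \<pi>) id q" "\<pi> x"] assms(1) unifies_left
    by (simp only: ren_sub_simps psub.simps communicable_ren)
next
  case (unifies_right q x)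
  then have *: "psub (Var \<circ> \<pi>) \<pi> q = psub (Var \<circ> \<pi>) id q" by (intro psub_communicable_cong) auto
  then show ?case using unifies.unifies_right[of "psub (Var \<circ> \<pi>) id q" "\<pi> x"] assms(1) unifies_right
    by (simp only: ren_sub_simps psub.simps communicable_ren)
next
  case (unifies_comp p1 q1 \<sigma>1 \<rho>1 p2 q2 \<sigma>2 \<rho>2)
  then show ?case unfolding ren_sub_simps(3)[OF assms(1)] psub.simps by (intro unifies.unifies_comp)
qed

lemma names_ren_lab: "names_label (ren_lab \<pi> \<mu>) = \<pi> ` names_label \<mu>"
  by (cases \<mu>) (auto simp: names_pat_def bn_psub fn_psub)

lemma bnd_ren_lab: "bnd (ren_lab \<pi> \<mu>) = \<pi> ` bnd \<mu>"
  by (cases \<mu>) (auto simp: bn_psub)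

lemma ren_lab_id: "(\<And>x. x \<in> names_label \<mu> \<Longrightarrow> \<pi> x = x) \<Longrightarrow> ren_lab \<pi> \<mu> = \<mu>"
  by (cases \<mu>) (auto simp: names_pat_def image_def intro!: psub_id)

lemma csubst_ren_cres: "inj \<pi> \<Longrightarrow> csubst (Var \<circ> \<pi>) (cres m X) = cres (\<pi> m) (csubst (Var \<circ> \<pi>) X)"
  using csubst_ren_cresS[of "{m}" \<pi> X] by (simp add: cresS_insert del: comp_apply)

lemma cmp_ren_sub: "bij \<pi> \<Longrightarrow> cmp (tot (ren_sub \<pi> \<sigma>)) (Var \<circ> \<pi>) = cmp (Var \<circ> \<pi>) (tot \<sigma>)"
  by (auto simp: fun_eq_iff tot_def ren_sub_def bij_is_inj cmp_def split: option.splits)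

lemma alpha_ren_Res:
  assumes "inj \<pi>" "wf_proc P"
  shows "alpha (esub (Var \<circ> \<pi>) (Res n P)) (Res (\<pi> n) (esub (Var \<circ> \<pi>) P))"
proof -
  have "(Var \<circ> \<pi>)(n := Var (\<pi> n)) = Var \<circ> \<pi>" by (auto simp: fun_eq_iff fun_upd_apply)
  moreover have "\<pi> n \<notin> fimg (Var \<circ> \<pi>) (fn_proc (Res n P))"
    using inj_eq[OF assms(1)] by (auto simp: simp del: comp_apply)
  ultimately show ?thesis using alpha_esub_Res[of "Var \<circ> \<pi>" P "\<pi> n" n] assms by (metis csub_Var(3))
qed

text \<open>\<open>esub (Var \<circ> \<pi>)\<close> replaces binders by canonical ones, so in the
  binder cases the transition is derived for the alpha-variant whose binders are the \<pi>-images
  and then moved by \<open>st_alpha\<close>.\<close>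

lemma st_ren:
  assumes "bij \<pi>"
  shows "st P \<mu> X \<Longrightarrow> wf_proc P \<Longrightarrow> st (esub (Var \<circ> \<pi>) P) (ren_lab \<pi> \<mu>) (csubst (Var \<circ> \<pi>) X)"
proof (induction rule: st.induct)
  have inj: "inj \<pi>" using assms by (rule bij_is_inj)
  note cs = csub_Var(3)[of \<pi>]
  {
    case (st_case \<beta> p P)
    define p' where "p' = psub (Var \<circ> \<pi>) \<pi> p"
    define P' where "P' = esub (Var \<circ> \<pi>) P"
    \<comment> \<open>The conjugate of \<beta>: renaming a binder by \<pi> and then choosing its new
      name equals choosing first and renaming afterwards.\<close>
    define \<beta>' where "\<beta>' = \<pi> \<circ> \<beta> \<circ> inv \<pi>"
    have b: "\<beta>' (\<pi> x) = \<pi> (\<beta> x)" for x using inj by (simp add: \<beta>'_def)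
    have bn: "bn p' = \<pi> ` bn p" by (simp add: p'_def bn_psub)
    have up: "updb (Var \<circ> \<pi>) \<pi> (bn p) = Var \<circ> \<pi>" by (auto simp: fun_eq_iff updb_def)
    have fr: "\<pi> ` bn p \<inter> fimg (Var \<circ> \<pi>) (fn_proc (Case p P)) = {}"
      using fn_Case_wf[of p P] st_case.prems inj unfolding fimg_simps by (simp add: image_Int[symmetric] del: fn_proc.simps)
    have al: "alpha (esub (Var \<circ> \<pi>) (Case p P)) (Case p' P')"
      using alpha_esub_Case[OF cs st_case.prems _ fr] inj up by (simp add: p'_def P'_def inj_on_subset)
    have wf: "wf_proc (Case p' P')" using alpha_wf[OF al] st_case.prems cs wf_esub by blast
    have fn: "fn_proc (Case p' P') = \<pi> ` fn_proc (Case p P)"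
      using alpha_fn[OF al wf_esub[OF cs st_case.prems]] by (simp only: fn_esub[OF cs] fimg_simps)
    have bb: "\<beta>' ` bn p' = \<pi> ` \<beta> ` bn p" unfolding bn image_image b ..
    have "st (Case p' P') (Out {} (psub Var \<beta>' p')) (csubst (updb Var \<beta>' (bn p')) (cls P'))"
    proof (rule st.st_case)
      show "inj_on \<beta>' (bn p')" unfolding bn
        by (rule inj_onI) (use st_case.hyps(1) inj in \<open>auto simp: b inj_eq inj_on_eq_iff\<close>)
      show "\<beta>' ` bn p' \<inter> fn_proc (Case p' P') = {}"
        unfolding bb fn using st_case.hyps(2) inj by (simp add: image_Int[symmetric] del: fn_proc.simps)
    qed
    moreover have "psub Var \<beta>' p' = psub (Var \<circ> \<pi>) \<pi> (psub Var \<beta> p)"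
      unfolding p'_def by (simp add: psub_psub del: comp_apply) (rule psub_cong; simp add: b)
    moreover have "csubst (updb Var \<beta>' (bn p')) (cls P') = csubst (Var \<circ> \<pi>) (csubst (updb Var \<beta> (bn p)) (cls P))"
    proof -
      have "cmp (updb Var \<beta>' (bn p')) (Var \<circ> \<pi>) = cmp (Var \<circ> \<pi>) (updb Var \<beta> (bn p))"
        using b inj by (auto simp: fun_eq_iff cmp_def updb_def bn inj_image_mem_iff)
      moreover have "cls P' = csubst (Var \<circ> \<pi>) (cls P)" using st_case.prems cs by (simp add: P'_def csubst_cls)
      ultimately show ?thesis using csubst_csubst cs by simp
    qed
    ultimately have "st (Case p' P') (ren_lab \<pi> (Out {} (psub Var \<beta> p)))
        (csubst (Var \<circ> \<pi>) (csubst (updb Var \<beta> (bn p)) (cls P)))" by simp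
    then show ?case using st_alpha wf alpha_sym[OF al] by blast
  next
    case (st_res n m P \<mu> X)
    have wf: "wf_proc P" using st_res.prems by simp
    have "cmp (Var(\<pi> n := Var (\<pi> m))) (Var \<circ> \<pi>) = cmp (Var \<circ> \<pi>) (Var(n := Var m))"
      using inj by (auto simp: fun_eq_iff cmp_def fun_upd_apply inj_eq)
    then have e: "esub (Var(\<pi> n := Var (\<pi> m))) (esub (Var \<circ> \<pi>) P) = esub (Var \<circ> \<pi>) (esub (Var(n := Var m)) P)"
      using cs by (simp add: esub_esub)
    note al = alpha_ren_Res[OF inj wf, of n]
    have "st (Res (\<pi> n) (esub (Var \<circ> \<pi>) P)) (ren_lab \<pi> \<mu>) (cres (\<pi> m) (csubst (Var \<circ> \<pi>) X))"
    proof (rule st.st_res)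
      show "st (esub (Var(\<pi> n := Var (\<pi> m))) (esub (Var \<circ> \<pi>) P)) (ren_lab \<pi> \<mu>) (csubst (Var \<circ> \<pi>) X)"
        unfolding e using st_res.IH wf by (simp add: wf_esub del: comp_apply)
      show "\<pi> m \<notin> fn_proc (Res (\<pi> n) (esub (Var \<circ> \<pi>) P))"
        using st_res.hyps inj by (auto simp: fn_esub inj_eq simp del: comp_apply)
      show "\<pi> m \<notin> names_label (ren_lab \<pi> \<mu>)"
        using st_res.hyps inj by (auto simp: names_ren_lab inj_eq)
    qed
    then show ?case unfolding csubst_ren_cres[OF inj]
      by (rule st_alpha[OF _ _ alpha_sym[OF al]]) (use wf wf_esub[OF cs] in simp)
  next
    case (st_open n m P N p X)
    have wf: "wf_proc P" using st_open.prems by simp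
    have "cmp (Var(\<pi> n := Var (\<pi> m))) (Var \<circ> \<pi>) = cmp (Var \<circ> \<pi>) (Var(n := Var m))"
      using inj by (auto simp: fun_eq_iff cmp_def fun_upd_apply inj_eq)
    then have e: "esub (Var(\<pi> n := Var (\<pi> m))) (esub (Var \<circ> \<pi>) P) = esub (Var \<circ> \<pi>) (esub (Var(n := Var m)) P)"
      using cs by (simp add: esub_esub)
    note al = alpha_ren_Res[OF inj wf, of n]
    have "st (Res (\<pi> n) (esub (Var \<circ> \<pi>) P)) (Out (insert (\<pi> m) (\<pi> ` N)) (psub (Var \<circ> \<pi>) \<pi> p)) (csubst (Var \<circ> \<pi>) X)"
    proof (rule st.st_open)
      show "st (esub (Var(\<pi> n := Var (\<pi> m))) (esub (Var \<circ> \<pi>) P)) (Out (\<pi> ` N) (psub (Var \<circ> \<pi>) \<pi> p)) (csubst (Var \<circ> \<pi>) X)"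
        unfolding e using st_open.IH wf by (simp add: wf_esub del: comp_apply)
      show "\<pi> m \<notin> fn_proc (Res (\<pi> n) (esub (Var \<circ> \<pi>) P))"
        using st_open.hyps inj by (auto simp: fn_esub inj_eq simp del: comp_apply)
      show "\<pi> m \<in> vn (psub (Var \<circ> \<pi>) \<pi> p)" using st_open.hyps by simp
      show "\<pi> m \<notin> \<pi> ` N \<union> pn (psub (Var \<circ> \<pi>) \<pi> p)"
        using st_open.hyps inj by (auto simp: inj_eq)
    qed
    then have "st (esub (Var \<circ> \<pi>) (Res n P)) (Out (insert (\<pi> m) (\<pi> ` N)) (psub (Var \<circ> \<pi>) \<pi> p)) (csubst (Var \<circ> \<pi>) X)"
      by (rule st_alpha[OF _ _ alpha_sym[OF al]]) (use wf wf_esub[OF cs] in simp)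
    then show ?case by (simp only: ren_lab.simps image_insert)
  next
    case (st_l P \<mu> X Q)
    then show ?case unfolding esub.simps
      by (intro st_intros_eq(1)) (auto simp: bnd_ren_lab fn_esub image_Int[OF inj, symmetric] csubst_cpar csubst_cls simp del: comp_apply)
  next
    case (st_r P \<mu> X Q)
    then show ?case unfolding esub.simps
      by (intro st_intros_eq(2)) (auto simp: bnd_ren_lab fn_esub image_Int[OF inj, symmetric] csubst_cpar csubst_cls simp del: comp_apply)
  next
    case (st_com P M p X Q N q Y \<sigma> \<rho>)
    then have "fresh_label (Out M p) P" "fresh_label (Out N q) Q" using st_fresh by auto
    then have fin: "finite M" "finite N" using fresh_label_OutD by blast+
    note u = unify_is_subst[OF st_com.hyps(3)]
    note u' = unify_ren[OF assms st_com.hyps(3)]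
    have 1: "csubst (Var \<circ> \<pi>) (csubst (tot \<sigma>) X) = csubst (tot (ren_sub \<pi> \<sigma>)) (csubst (Var \<circ> \<pi>) X)"
      using u unify_is_subst[OF u'] csub_tot cmp_ren_sub[OF assms, of \<sigma>] cs by (simp add: csubst_csubst)
    have 2: "csubst (Var \<circ> \<pi>) (csubst (tot \<rho>) Y) = csubst (tot (ren_sub \<pi> \<rho>)) (csubst (Var \<circ> \<pi>) Y)"
      using u unify_is_subst[OF u'] csub_tot cmp_ren_sub[OF assms, of \<rho>] cs by (simp add: csubst_csubst)
    show ?case unfolding esub.simps ren_lab.simps
    proof (rule st_intros_eq(3)[OF _ _ u'])
      show "st (esub (Var \<circ> \<pi>) P) (Out (\<pi> ` M) (psub (Var \<circ> \<pi>) \<pi> p)) (csubst (Var \<circ> \<pi>) X)"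
        "st (esub (Var \<circ> \<pi>) Q) (Out (\<pi> ` N) (psub (Var \<circ> \<pi>) \<pi> q)) (csubst (Var \<circ> \<pi>) Y)"
        using st_com.IH st_com.prems by (simp_all del: comp_apply)
      show "\<pi> ` M \<inter> fn_proc (esub (Var \<circ> \<pi>) Q) = {}" "\<pi> ` N \<inter> fn_proc (esub (Var \<circ> \<pi>) P) = {}" "\<pi> ` M \<inter> \<pi> ` N = {}"
        using st_com.hyps by (auto simp: fn_esub image_Int[OF inj, symmetric] simp del: comp_apply)
      show "csubst (Var \<circ> \<pi>) (cresS (M \<union> N) (cpar (csubst (tot \<sigma>) X) (csubst (tot \<rho>) Y))) =
        cresS (\<pi> ` M \<union> \<pi> ` N) (cpar (csubst (tot (ren_sub \<pi> \<sigma>)) (csubst (Var \<circ> \<pi>) X))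
           (csubst (tot (ren_sub \<pi> \<rho>)) (csubst (Var \<circ> \<pi>) Y)))"
        using fin by (simp only: csubst_ren_cresS[OF finite_UnI inj] csubst_cpar[OF cs] image_Un 1 2)
    qed
  next
    case (st_rep P \<mu> X)
    have "csubst (Var \<circ> \<pi>) (cls (Rep P)) = cls (Rep (esub (Var \<circ> \<pi>) P))"
      using st_rep.prems csubst_cls[of "Rep P", OF _ cs] by simp
    then show ?case using st_rep unfolding esub.simps
      by (intro st_intros_eq(5)) (auto simp: csubst_cpar simp del: comp_apply)
  }
qed

text \<open>A permutation that fixes the free names of the source moves, within the label, only the
  bound names. This is the means by which extruded names and binders are chosen afresh.\<close>

lemma st_fix:
  assumes "bij \<pi>" "st P \<mu> X" "wf_proc P" "\<And>x. x \<in> fn_proc P \<Longrightarrow> \<pi> x = x"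
  shows "st P (ren_lab \<pi> \<mu>) (csubst (Var \<circ> \<pi>) X)"
proof -
  have "esub (Var \<circ> \<pi>) P = esub Var P" using assms(4) by (intro esub_cong) simp
  then show ?thesis using st_norm[OF st_ren[OF assms(1-3)], of P] assms(3) by (simp add: wf_esub del: comp_apply)
qed

lemma ex_ren:
  assumes "finite A" "finite B" "finite C" "B \<inter> C = {}"
  obtains \<pi> :: "name \<Rightarrow> name" where "bij \<pi>" "\<pi> ` B \<inter> A = {}" "\<And>x. x \<in> C \<Longrightarrow> \<pi> x = x"
proof -
  define k where "k = fresh (A \<union> B \<union> C)"
  have k: "x < k" if "x \<in> A \<union> B \<union> C" for x using that assms fresh_less[of "A \<union> B \<union> C" x] by (simp add: k_def)
  \<comment> \<open>An involution exchanging \<open>B\<close> with its translate by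
    \<open>k\<close>; as \<open>k\<close> exceeds all names involved, the translate avoids
    \<open>A\<close>, \<open>B\<close> and \<open>C\<close>.\<close>
  define \<pi> where "\<pi> x = (if x \<in> B then x + k else if x \<ge> k \<and> x - k \<in> B then x - k else x)" for x
  have "\<pi> (\<pi> x) = x" for x using k[of "x"] k[of "x + k"] k[of "x - k"] by (auto simp: \<pi>_def)
  then have "bij \<pi>" by (intro o_bij[of \<pi> \<pi>]) auto
  moreover have "\<pi> ` B \<inter> A = {}" using k by (fastforce simp: \<pi>_def)
  moreover have "\<pi> x = x" if "x \<in> C" for x using that assms(4) k[of x] by (auto simp: \<pi>_def)
  ultimately show ?thesis using that by blast
qed

text \<open>Moves only the binders of the label: \<pi> fixes the extruded names and the free names,
  so on \<open>p\<close> it acts as \<open>psub Var \<pi>\<close>.\<close>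

lemma st_bn_fresh:
  assumes "st P (Out N p) X" "wf_proc P" "finite A"
  obtains \<pi> where "bij \<pi>" "\<pi> ` bn p \<inter> A = {}" "st P (Out N (psub Var \<pi> p)) (csubst (Var \<circ> \<pi>) X)"
    "\<And>x. x \<in> fn_proc P \<union> N \<Longrightarrow> \<pi> x = x"
proof -
  have "fresh_label (Out N p) P" using st_fresh assms by blast
  note f = fresh_label_OutD[OF this]
  have "bn p \<inter> (fn_proc P \<union> N) = {}" "finite (fn_proc P \<union> N)" using f by auto
  then obtain \<pi> where \<pi>: "bij \<pi>" "\<pi> ` bn p \<inter> A = {}" "\<And>x. x \<in> fn_proc P \<union> N \<Longrightarrow> \<pi> x = x"
    using ex_ren[of A "bn p" "fn_proc P \<union> N"] assms(3) by auto
  have "\<pi> ` N = N" using \<pi>(3) by (auto simp: image_iff)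
  moreover have "psub (Var \<circ> \<pi>) \<pi> p = psub Var \<pi> p" using f(7) \<pi>(3) by (intro psub_cong) auto
  ultimately show ?thesis using that[OF \<pi>(1,2) _ \<pi>(3)] st_fix[OF \<pi>(1) assms(1,2)] \<pi>(3) by simp
qed

lemma unify_bn_ren: "bij \<pi> \<Longrightarrow> unify p q = Some (\<sigma>, \<rho>) \<Longrightarrow> unify (psub Var \<pi> p) q = Some (\<sigma> \<circ> inv \<pi>, \<rho>)"
proof -
  assume \<pi>: "bij \<pi>"
  have [simp]: "Map.empty \<circ> inv \<pi> = Map.empty" by (auto simp: fun_eq_iff)
  show "unify p q = Some (\<sigma>, \<rho>) \<Longrightarrow> unify (psub Var \<pi> p) q = Some (\<sigma> \<circ> inv \<pi>, \<rho>)"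
    unfolding unify_iff
  proof (induction rule: unifies.induct)
    case (unifies_name p x q)
    then show ?case by (auto intro: unifies.unifies_name)
  next
    case (unifies_left q x)
    have "[x \<mapsto> q] \<circ> inv \<pi> = [\<pi> x \<mapsto> q]"
    proof
      fix z
      have "inv \<pi> z = x \<longleftrightarrow> z = \<pi> x" using bij_inv_eq_iff[OF \<pi>, of x z] by auto
      then show "([x \<mapsto> q] \<circ> inv \<pi>) z = [\<pi> x \<mapsto> q] z" by (simp add: fun_upd_apply)
    qed
    then show ?case using unifies.unifies_left[OF unifies_left, of "\<pi> x"] by simp
  next
    case (unifies_right p x)
    then have "psub Var \<pi> p = p" by (intro psub_id) (auto simp: communicable_bn)
    then show ?case using unifies.unifies_right[OF unifies_right, of x] by simp
  next
    case (unifies_comp p1 q1 \<sigma>1 \<rho>1 p2 q2 \<sigma>2 \<rho>2)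
    have "(\<sigma>1 ++ \<sigma>2) \<circ> inv \<pi> = (\<sigma>1 \<circ> inv \<pi>) ++ (\<sigma>2 \<circ> inv \<pi>)"
      by (rule ext) (simp add: map_add_def o_def)
    then show ?case using unifies.unifies_comp[OF unifies_comp.IH] by (simp del: comp_apply)
  qed
qed

lemma is_match_ren: "bij \<pi> \<Longrightarrow> is_match p \<sigma> \<Longrightarrow> is_match (psub Var \<pi> p) (\<sigma> \<circ> inv \<pi>)"
proof -
  assume a: "bij \<pi>" "is_match p \<sigma>"
  have "dom (\<sigma> \<circ> inv \<pi>) = \<pi> ` dom \<sigma>"
  proof (intro set_eqI iffI)
    fix x assume "x \<in> dom (\<sigma> \<circ> inv \<pi>)"
    then have "inv \<pi> x \<in> dom \<sigma>" by (simp add: domIff)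
    moreover have "x = \<pi> (inv \<pi> x)" using a(1) by (simp add: bij_is_surj surj_f_inv_f)
    ultimately show "x \<in> \<pi> ` dom \<sigma>" by blast
  next
    fix x assume "x \<in> \<pi> ` dom \<sigma>"
    then show "x \<in> dom (\<sigma> \<circ> inv \<pi>)" using bij_is_inj[OF a(1)] by (auto simp: dom_def)
  qed
  moreover have "ran (\<sigma> \<circ> inv \<pi>) \<subseteq> ran \<sigma>" by (auto simp: ran_def)
  ultimately show ?thesis using a(2) by (auto simp: is_match_def is_subst_def bn_psub)
qed

text \<open>Renaming the binders in the continuation and reindexing the match by the inverse cancel
  out, so a new choice of binders does not affect the instantiated continuation.\<close>

lemma csubst_bn_ren:
  assumes "bij \<pi>" "is_match p \<sigma>" "\<And>x. x \<in> cfn X - bn p \<Longrightarrow> \<pi> x = x"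
  shows "csubst (tot (\<sigma> \<circ> inv \<pi>)) (csubst (Var \<circ> \<pi>) X) = csubst (tot \<sigma>) X"
proof -
  have c: "csub (tot \<sigma>)" "csub (tot (\<sigma> \<circ> inv \<pi>))"
    using is_match_ren[OF assms(1,2)] assms(2) by (auto simp: is_match_def intro: csub_tot)
  have "csubst (tot (\<sigma> \<circ> inv \<pi>)) (csubst (Var \<circ> \<pi>) X) = csubst (tot (\<sigma> \<circ> inv \<pi>) \<circ> \<pi>) X"
    using c by (simp add: csubst_csubst del: comp_apply)
  also have "\<dots> = csubst (tot \<sigma>) X"
  proof (rule csubst_cong)
    fix x assume x: "x \<in> cfn X"
    have "inv \<pi> (\<pi> x) = x" using assms(1) by (simp add: bij_is_inj)
    then show "(tot (\<sigma> \<circ> inv \<pi>) \<circ> \<pi>) x = tot \<sigma> x"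
      using assms(2) assms(3)[of x] x by (cases "x \<in> bn p") (auto simp: tot_def is_match_def split: option.splits)
  qed (use c in auto)
  finally show ?thesis .
qed

subsection \<open>Invariance under structural congruence\<close>

lemmas cpar_ac = cpar.assoc cpar.commute cpar.left_commute

lemma st_OutD:
  assumes "st P (Out N p) X" "wf_proc P"
  shows "finite N" "N \<subseteq> vn p" "N \<inter> pn p = {}" "wf_pat p" "N \<inter> fn_proc P = {}" "bn p \<inter> fn_proc P = {}"
    "fn_pat p \<subseteq> fn_proc P \<union> N" "N \<inter> bn p = {}" "cfn X \<subseteq> fn_proc P \<union> N \<union> bn p"
  using st_fresh[OF assms] fresh_label_OutD[of N p P] by auto

lemma st_bnd: "st P \<mu> X \<Longrightarrow> wf_proc P \<Longrightarrow> bnd \<mu> \<inter> fn_proc P = {} \<and> finite (bnd \<mu>) \<and> finite (names_label \<mu>)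
    \<and> cfn X \<subseteq> fn_proc P \<union> bnd \<mu>"
  using st_fresh[of P \<mu> X] by (cases \<mu>) (auto simp: fresh_label_def)

text \<open>Two renamings are needed. The binders of the two labels are refreshed separately, which
  leaves the instantiated continuations as they are. Then a single permutation moves the extruded
  names of both labels and with them the unifier, which carries them across; the target does not
  change because its free names are fixed.\<close>

lemma st_com_freshE:
  assumes "st P (Out M p) X" "st Q (Out N q) Y" "unify p q = Some (\<sigma>, \<rho>)"
    "M \<inter> fn_proc Q = {}" "N \<inter> fn_proc P = {}" "M \<inter> N = {}" "wf_proc P" "wf_proc Q" "finite A"
  obtains M' p' X' N' q' Y' \<sigma>' \<rho>' where
    "st P (Out M' p') X'" "st Q (Out N' q') Y'" "unify p' q' = Some (\<sigma>', \<rho>')"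
    "M' \<inter> fn_proc Q = {}" "N' \<inter> fn_proc P = {}" "M' \<inter> N' = {}"
    "(M' \<union> N' \<union> bn p' \<union> bn q') \<inter> A = {}"
    "cresS (M' \<union> N') (cpar (csubst (tot \<sigma>') X') (csubst (tot \<rho>') Y')) =
     cresS (M \<union> N) (cpar (csubst (tot \<sigma>) X) (csubst (tot \<rho>) Y))"
proof -
  note p = st_OutD[OF assms(1,7)] and q = st_OutD[OF assms(2,8)]
  define B where "B = A \<union> fn_proc P \<union> fn_proc Q \<union> M \<union> N"
  have B: "finite B" using p(1) q(1) assms(9) by (simp add: B_def)
  obtain \<pi> where \<pi>: "bij \<pi>" "\<pi> ` bn p \<inter> B = {}" "st P (Out M (psub Var \<pi> p)) (csubst (Var \<circ> \<pi>) X)"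
    "\<And>x. x \<in> fn_proc P \<union> M \<Longrightarrow> \<pi> x = x" using st_bn_fresh[OF assms(1,7) B] by blast
  obtain \<phi> where \<phi>: "bij \<phi>" "\<phi> ` bn q \<inter> B = {}" "st Q (Out N (psub Var \<phi> q)) (csubst (Var \<circ> \<phi>) Y)"
    "\<And>x. x \<in> fn_proc Q \<union> N \<Longrightarrow> \<phi> x = x" using st_bn_fresh[OF assms(2,8) B] by blast
  define p1 where "p1 = psub Var \<pi> p"
  define q1 where "q1 = psub Var \<phi> q"
  define \<sigma>1 where "\<sigma>1 = \<sigma> \<circ> inv \<pi>"
  define \<rho>1 where "\<rho>1 = \<rho> \<circ> inv \<phi>"
  define X1 where "X1 = csubst (Var \<circ> \<pi>) X"
  define Y1 where "Y1 = csubst (Var \<circ> \<phi>) Y"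
  have u1: "unify p1 q1 = Some (\<sigma>1, \<rho>1)"
    using unify_sym[OF unify_bn_ren[OF \<phi>(1) unify_sym[OF unify_bn_ren[OF \<pi>(1) assms(3)]]]]
    by (simp add: p1_def q1_def \<sigma>1_def \<rho>1_def)
  have m: "is_match p \<sigma>" "is_match q \<rho>" using is_match_unify[OF assms(3)] by auto
  have XY: "csubst (tot \<sigma>1) X1 = csubst (tot \<sigma>) X" "csubst (tot \<rho>1) Y1 = csubst (tot \<rho>) Y"
    unfolding \<sigma>1_def X1_def \<rho>1_def Y1_def using p(9) q(9) \<pi>(4) \<phi>(4)
    by (auto intro!: csubst_bn_ren[OF \<pi>(1) m(1)] csubst_bn_ren[OF \<phi>(1) m(2)] simp del: comp_apply)
  have st1: "st P (Out M p1) X1" "st Q (Out N q1) Y1" using \<pi>(3) \<phi>(3) by (simp_all only: p1_def q1_def X1_def Y1_def)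
  have bn1: "bn p1 \<inter> B = {}" "bn q1 \<inter> B = {}" using \<pi>(2) \<phi>(2) by (auto simp: p1_def q1_def bn_psub)
  \<comment> \<open>The second permutation has to fix the refreshed binders as well.\<close>
  define C where "C = fn_proc P \<union> fn_proc Q \<union> bn p1 \<union> bn q1"
  have "(M \<union> N) \<inter> C = {}" using bn1 assms(4,5) p(5) q(5) by (auto simp: C_def B_def)
  moreover have "finite C" by (simp add: C_def)
  ultimately obtain \<psi> where \<psi>: "bij \<psi>" "\<psi> ` (M \<union> N) \<inter> A = {}" "\<And>x. x \<in> C \<Longrightarrow> \<psi> x = x"
    using ex_ren[OF assms(9) finite_UnI[OF p(1) q(1)]] by metis
  note u2 = unify_ren[OF \<psi>(1) u1]
  have inj: "inj \<psi>" using \<psi>(1) by (rule bij_is_inj)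
  show ?thesis
  proof (rule that[OF _ _ u2])
    show "st P (Out (\<psi> ` M) (psub (Var \<circ> \<psi>) \<psi> p1)) (csubst (Var \<circ> \<psi>) X1)"
      using st_fix[OF \<psi>(1) st1(1) assms(7)] \<psi>(3) by (simp add: C_def del: comp_apply)
    show "st Q (Out (\<psi> ` N) (psub (Var \<circ> \<psi>) \<psi> q1)) (csubst (Var \<circ> \<psi>) Y1)"
      using st_fix[OF \<psi>(1) st1(2) assms(8)] \<psi>(3) by (simp add: C_def del: comp_apply)
    have "\<psi> ` M \<inter> \<psi> ` fn_proc Q = {}" "\<psi> ` N \<inter> \<psi> ` fn_proc P = {}" "\<psi> ` M \<inter> \<psi> ` N = {}"
      using assms(4-6) by (simp_all add: image_Int[OF inj, symmetric])
    moreover have im: "\<psi> ` D = D" if "D \<subseteq> C" for D using \<psi>(3) that by (force simp: image_iff)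
    moreover have "\<psi> ` fn_proc P = fn_proc P" "\<psi> ` fn_proc Q = fn_proc Q" by (intro im; auto simp: C_def)+
    ultimately show "\<psi> ` M \<inter> fn_proc Q = {}" "\<psi> ` N \<inter> fn_proc P = {}" "\<psi> ` M \<inter> \<psi> ` N = {}"
      by (simp_all only:)
    have "\<psi> ` bn p1 = bn p1" "\<psi> ` bn q1 = bn q1" by (intro im; simp add: C_def subset_eq)+
    then show "(\<psi> ` M \<union> \<psi> ` N \<union> bn (psub (Var \<circ> \<psi>) \<psi> p1) \<union> bn (psub (Var \<circ> \<psi>) \<psi> q1)) \<inter> A = {}"
      using \<psi>(2) bn1 by (auto simp: bn_psub B_def)
    define Z where "Z = cresS (M \<union> N) (cpar (csubst (tot \<sigma>1) X1) (csubst (tot \<rho>1) Y1))"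
    have "st (Par P Q) Tau Z" unfolding Z_def by (rule st.st_com[OF st1 u1 assms(4-6)])
    then have "cfn Z \<subseteq> fn_proc P \<union> fn_proc Q" using st_bnd assms(7,8) by fastforce
    then have "csubst (Var \<circ> \<psi>) Z = Z" using \<psi>(3) by (intro csubst_id) (auto simp: C_def)
    moreover have "csubst (Var \<circ> \<psi>) Z = cresS (\<psi> ` M \<union> \<psi> ` N)
        (cpar (csubst (tot (ren_sub \<psi> \<sigma>1)) (csubst (Var \<circ> \<psi>) X1)) (csubst (tot (ren_sub \<psi> \<rho>1)) (csubst (Var \<circ> \<psi>) Y1)))"
    proof -
      have c: "csub (tot \<sigma>1)" "csub (tot \<rho>1)" "csub (tot (ren_sub \<psi> \<sigma>1))" "csub (tot (ren_sub \<psi> \<rho>1))"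
        using unify_is_subst[OF u1] unify_is_subst[OF u2] csub_tot by auto
      show ?thesis unfolding Z_def csubst_ren_cresS[OF finite_UnI[OF p(1) q(1)] inj] csubst_cpar[OF csub_Var(3)]
          csubst_csubst[OF c(1) csub_Var(3)] csubst_csubst[OF c(2) csub_Var(3)]
          csubst_csubst[OF csub_Var(3) c(3)] csubst_csubst[OF csub_Var(3) c(4)] cmp_ren_sub[OF \<psi>(1)] image_Un ..
    qed
    ultimately show "cresS (\<psi> ` M \<union> \<psi> ` N)
        (cpar (csubst (tot (ren_sub \<psi> \<sigma>1)) (csubst (Var \<circ> \<psi>) X1)) (csubst (tot (ren_sub \<psi> \<rho>1)) (csubst (Var \<circ> \<psi>) Y1)))
      = cresS (M \<union> N) (cpar (csubst (tot \<sigma>) X) (csubst (tot \<rho>) Y))" unfolding Z_def XY by simp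
  qed
qed

text \<open>Joint form of \<open>st_res\<close> and \<open>st_open\<close> after the restriction has
  been opened with the name \<open>m\<close>.\<close>

definition resstep :: "name \<Rightarrow> label \<Rightarrow> cproc \<Rightarrow> label \<Rightarrow> cproc \<Rightarrow> bool" where
  "resstep m \<mu> X \<mu>' X' \<longleftrightarrow> (\<mu>' = \<mu> \<and> m \<notin> names_label \<mu> \<and> X' = cres m X)
     \<or> (\<exists>N p. \<mu> = Out N p \<and> \<mu>' = Out (insert m N) p \<and> m \<in> vn p \<and> m \<notin> N \<union> pn p \<and> X' = X)"

lemma st_Res_iff: "st (Res n P) \<mu>' X' \<longleftrightarrow>
    (\<exists>m \<mu> X. m \<notin> fn_proc (Res n P) \<and> st (esub (Var(n := Var m)) P) \<mu> X \<and> resstep m \<mu> X \<mu>' X')"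
proof
  assume "st (Res n P) \<mu>' X'"
  then show "\<exists>m \<mu> X. m \<notin> fn_proc (Res n P) \<and> st (esub (Var(n := Var m)) P) \<mu> X \<and> resstep m \<mu> X \<mu>' X'"
    unfolding resstep_def by (rule st_ResE) (simp_all, blast+)
next
  assume "\<exists>m \<mu> X. m \<notin> fn_proc (Res n P) \<and> st (esub (Var(n := Var m)) P) \<mu> X \<and> resstep m \<mu> X \<mu>' X'"
  then obtain m \<mu> X where *: "m \<notin> fn_proc (Res n P)" "st (esub (Var(n := Var m)) P) \<mu> X" "resstep m \<mu> X \<mu>' X'"
    by blast
  then show "st (Res n P) \<mu>' X'" unfolding resstep_def
    by (elim disjE) (auto intro: st_res st_open simp del: fn_proc.simps)
qed

lemma st_Par_cases [consumes 1, case_names l r com]: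
  assumes "st (Par P Q) \<mu> Z"
  obtains X where "st P \<mu> X" "bnd \<mu> \<inter> fn_proc Q = {}" "Z = cpar X (cls Q)"
  | X where "st Q \<mu> X" "bnd \<mu> \<inter> fn_proc P = {}" "Z = cpar X (cls P)"
  | M p X N q Y \<sigma> \<rho> where "\<mu> = Tau" "Z = cresS (M \<union> N) (cpar (csubst (tot \<sigma>) X) (csubst (tot \<rho>) Y))"
      "st P (Out M p) X" "st Q (Out N q) Y" "unify p q = Some (\<sigma>, \<rho>)"
      "M \<inter> fn_proc Q = {}" "N \<inter> fn_proc P = {}" "M \<inter> N = {}"
  using assms by (rule st_ParE)

text \<open>Substitution and opening of the restriction are merged into one substitution, so that
  nested restrictions can be opened one after the other without meeting canonical names.\<close>

lemma st_esub_Res: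
  assumes "csub \<theta>"
  shows "st (esub \<theta> (Res n P)) \<mu>' X' \<longleftrightarrow>
    (\<exists>m \<mu> X. m \<notin> fimg \<theta> (fn_proc (Res n P)) \<and> st (esub (\<theta>(n := Var m)) P) \<mu> X \<and> resstep m \<mu> X \<mu>' X')"
proof -
  define y where "y = fresh (fimg \<theta> (fn_proc (Res n P)))"
  have y: "y \<notin> fimg \<theta> (fn_proc (Res n P))" unfolding y_def by (intro fresh_notin) simp
  have e: "esub \<theta> (Res n P) = Res y (esub (\<theta>(n := Var y)) P)" by (simp only: esub.simps Let_def y_def)
  have f: "esub (Var(y := Var m)) (esub (\<theta>(n := Var y)) P) = esub (\<theta>(n := Var m)) P" for m
    unfolding esub_esub[OF csub_upd[OF assms] csub_upd[OF csub_Var(1)]]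
  proof (rule esub_cong)
    fix x assume x: "x \<in> fn_proc P"
    show "cmp (Var(y := Var m)) (\<theta>(n := Var y)) x = (\<theta>(n := Var m)) x"
    proof (cases "x = n")
      case False
      then have "y \<notin> fn_pat (\<theta> x)" using x y by (auto simp: fimg_def)
      then show ?thesis using False by (auto simp: cmp_def fun_upd_apply intro!: psub_id)
    qed (simp add: cmp_def fun_upd_apply)
  qed
  have g: "fn_proc (Res y (esub (\<theta>(n := Var y)) P)) = fimg \<theta> (fn_proc (Res n P))"
    using fn_esub[OF assms, of "Res n P"] by (simp only: e)
  show ?thesis unfolding e st_Res_iff f g ..
qed

lemma resstep_OutE [consumes 1, case_names non opn]:
  assumes "resstep m \<mu> X (Out N p) X'"
  obtains "\<mu> = Out N p" "m \<notin> N \<union> names_pat p" "X' = cres m X"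
  | M where "\<mu> = Out M p" "N = insert m M" "m \<in> vn p" "m \<notin> M \<union> pn p" "X' = X"
  using assms unfolding resstep_def by fastforce

lemma resstep_bnd: "resstep m \<mu> X \<mu>' X' \<Longrightarrow> bnd \<mu> \<subseteq> bnd \<mu>' \<and> bnd \<mu>' \<subseteq> insert m (bnd \<mu>)
    \<and> (m \<in> bnd \<mu>' \<or> m \<notin> names_label \<mu>')"
  by (auto simp: resstep_def)

lemma resstep_cpar: "resstep m \<mu> X \<mu>' X' \<Longrightarrow> m \<notin> cfn Z \<Longrightarrow> resstep m \<mu> (cpar X Z) \<mu>' (cpar X' Z)"
  by (auto simp: resstep_def cres_cpar)

lemma bnd_names: "bnd \<mu> \<subseteq> names_label \<mu>"
  by (cases \<mu>) (auto simp: names_pat_def)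

text \<open>A restricted name that is not extruded does not show in the label and is bound in the
  target, so it can be swapped for any fresh \<open>k\<close>. An extruded \<open>m\<close> is
  visible in the label and cannot be changed, hence the disjunction.\<close>

lemma st_esub_Res_freshE:
  assumes "st (esub \<theta> (Res n P)) \<mu>' X'" "csub \<theta>" "wf_proc P" "finite A"
  obtains m \<mu> X where "m \<notin> fimg \<theta> (fn_proc (Res n P))" "st (esub (\<theta>(n := Var m)) P) \<mu> X" "resstep m \<mu> X \<mu>' X'"
    "m \<in> bnd \<mu>' \<or> m \<notin> A"
proof -
  obtain m \<mu> X where *: "m \<notin> fimg \<theta> (fn_proc (Res n P))" "st (esub (\<theta>(n := Var m)) P) \<mu> X" "resstep m \<mu> X \<mu>' X'"
    using assms st_esub_Res by blast
  show ?thesis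
  proof (cases "m \<in> bnd \<mu>'")
    case True then show ?thesis using that * by blast
  next
    case False
    then have r: "\<mu>' = \<mu>" "m \<notin> names_label \<mu>" "X' = cres m X" using *(3) by (auto simp: resstep_def)
    have wf: "wf_proc (esub (\<theta>(n := Var m)) P)" using assms by (intro wf_esub csub_upd)
    define B where "B = A \<union> fimg \<theta> (fn_proc (Res n P)) \<union> names_label \<mu> \<union> cfn X \<union> {m}"
    have "finite B" using st_bnd[OF *(2) wf] assms(4) by (simp add: B_def)
    then obtain k where k: "k \<notin> B" using ex_fresh by blast
    let ?\<pi> = "swap_name m k"
    have "st (esub (Var \<circ> ?\<pi>) (esub (\<theta>(n := Var m)) P)) (ren_lab ?\<pi> \<mu>) (csubst (Var \<circ> ?\<pi>) X)"
      by (rule st_ren[OF bij_swap_name *(2) wf])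
    moreover have "ren_lab ?\<pi> \<mu> = \<mu>" using r(2) k by (intro ren_lab_id) (auto simp: swap_name_def B_def)
    moreover have "esub (Var \<circ> ?\<pi>) (esub (\<theta>(n := Var m)) P) = esub (\<theta>(n := Var k)) P"
      unfolding esub_esub[OF csub_upd[OF assms(2)] csub_Var(3)]
    proof (rule esub_cong)
      fix x assume x: "x \<in> fn_proc P"
      show "cmp (Var \<circ> ?\<pi>) (\<theta>(n := Var m)) x = (\<theta>(n := Var k)) x"
      proof (cases "x = n")
        case False
        then have "m \<notin> fn_pat (\<theta> x)" "k \<notin> fn_pat (\<theta> x)" using x *(1) k by (auto simp: fimg_def B_def)
        then have "psub (Var \<circ> ?\<pi>) id (\<theta> x) = \<theta> x" by (intro psub_id) (auto simp: swap_name_def)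
        then show ?thesis using False by (simp add: cmp_def fun_upd_apply)
      qed (simp add: cmp_def fun_upd_apply swap_name_def)
    qed
    ultimately have "st (esub (\<theta>(n := Var k)) P) \<mu> (csubst (Var \<circ> ?\<pi>) X)" by (simp only:)
    moreover have "cres k (csubst (Var \<circ> ?\<pi>) X) = cres m X"
    proof -
      have "csubst (Var \<circ> ?\<pi>) (cres m X) = cres m X"
        using k by (intro csubst_id) (auto simp: swap_name_def B_def)
      then show ?thesis using csubst_ren_cres[OF swap_name_inj, of m k m X] by (simp add: swap_name_def)
    qed
    ultimately show ?thesis using that[of k \<mu> "csubst (Var \<circ> ?\<pi>) X"] k r by (auto simp: resstep_def B_def)
  qed
qed

lemma st_Res_freshE:
  assumes "st (Res n P) \<mu>' X'" "wf_proc P" "finite A"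
  obtains m \<mu> X where "m \<notin> fn_proc (Res n P)" "st (esub (Var(n := Var m)) P) \<mu> X" "resstep m \<mu> X \<mu>' X'"
    "m \<in> bnd \<mu>' \<or> m \<notin> A"
proof -
  have "st (esub Var (Res n P)) \<mu>' X'" by (rule st_norm[OF assms(1)]) (use assms in \<open>auto intro: wf_esub simp del: esub.simps\<close>)
  from st_esub_Res_freshE[OF this csub_Var(1) assms(2,3)] show ?thesis using that by (metis fimg_simps(4))
qed

lemma resstep_commute:
  "resstep b \<mu>1 X1 \<mu>2 X2 \<Longrightarrow> resstep a \<mu>2 X2 \<mu>3 X3 \<Longrightarrow> a \<noteq> b \<Longrightarrow>
    \<exists>\<mu> X. resstep a \<mu>1 X1 \<mu> X \<and> resstep b \<mu> X \<mu>3 X3"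
proof -
  assume *: "resstep b \<mu>1 X1 \<mu>2 X2" "resstep a \<mu>2 X2 \<mu>3 X3" "a \<noteq> b"
  consider "\<mu>2 = \<mu>1" "b \<notin> names_label \<mu>1" "X2 = cres b X1" "\<mu>3 = \<mu>2" "a \<notin> names_label \<mu>2" "X3 = cres a X2"
    | N p where "\<mu>2 = \<mu>1" "b \<notin> names_label \<mu>1" "X2 = cres b X1"
      "\<mu>2 = Out N p" "\<mu>3 = Out (insert a N) p" "a \<in> vn p" "a \<notin> N \<union> pn p" "X3 = X2"
    | N p where "\<mu>1 = Out N p" "\<mu>2 = Out (insert b N) p" "b \<in> vn p" "b \<notin> N \<union> pn p" "X2 = X1"
      "\<mu>3 = \<mu>2" "a \<notin> names_label \<mu>2" "X3 = cres a X2"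
    | N p where "\<mu>1 = Out N p" "\<mu>2 = Out (insert b N) p" "b \<in> vn p" "b \<notin> N \<union> pn p" "X2 = X1"
      "\<mu>3 = Out (insert a (insert b N)) p" "a \<in> vn p" "a \<notin> insert b N \<union> pn p" "X3 = X2"
    using * unfolding resstep_def by auto
  then show ?thesis
  proof cases
    case 1
    then show ?thesis by (intro exI[of _ \<mu>1] exI[of _ "cres a X1"]) (auto simp: resstep_def cres_comm)
  next
    case (2 N p)
    then show ?thesis using *(3) by (intro exI[of _ "Out (insert a N) p"] exI[of _ X1]) (auto simp: resstep_def)
  next
    case (3 N p)
    then show ?thesis using *(3) by (intro exI[of _ "Out N p"] exI[of _ "cres a X1"]) (auto simp: resstep_def)
  next
    case (4 N p)
    then show ?thesis using *(3) by (intro exI[of _ "Out (insert a N) p"] exI[of _ X1]) (auto simp: resstep_def)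
  qed
qed

section \<open>Structural congruence, axiom by axiom\<close>

definition stle :: "proc \<Rightarrow> proc \<Rightarrow> bool" where
  "stle P Q \<longleftrightarrow> (\<forall>\<mu> X. st P \<mu> X \<longrightarrow> st Q \<mu> X)"

lemma stle_res_comm:
  assumes "wf_proc P"
  shows "stle (Res n (Res m P)) (Res m (Res n P))"
proof (cases "n = m")
  case False
  show ?thesis unfolding stle_def
  proof (intro allI impI)
    fix \<mu>3 X3 assume "st (Res n (Res m P)) \<mu>3 X3"
    then obtain a \<mu>2 X2 where a: "a \<notin> fn_proc (Res n (Res m P))" "st (esub (Var(n := Var a)) (Res m P)) \<mu>2 X2"
      "resstep a \<mu>2 X2 \<mu>3 X3" using st_Res_iff by blast
    have fr: "fresh_label \<mu>2 (esub (Var(n := Var a)) (Res m P))"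
      using st_fresh[OF a(2)] assms by (simp add: wf_esub del: esub.simps)
    obtain b \<mu>1 X1 where b: "b \<notin> fimg (Var(n := Var a)) (fn_proc (Res m P))"
      "st (esub (Var(n := Var a, m := Var b)) P) \<mu>1 X1" "resstep b \<mu>1 X1 \<mu>2 X2" "b \<in> bnd \<mu>2 \<or> b \<notin> {a}"
      using st_esub_Res_freshE[OF a(2) csub_upd[OF csub_Var(1)] assms, of "{a}"] by auto
    \<comment> \<open>\<open>resstep\<close> either keeps \<open>a\<close> out of the label or finds
      it among the variable names of a well-formed pattern and outside the extruded ones, so
      \<open>a\<close> is not bound in the label. By the freshness of \<open>b\<close> the two
      opened names then differ.\<close>
    have "a \<notin> bnd \<mu>2"
      using a(3) bnd_names[of \<mu>2] fr vn_fn unfolding resstep_def fresh_label_def wf_pat_def by fastforce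
    then have ab: "a \<noteq> b" using b(4) by auto
    obtain \<mu> X where r: "resstep a \<mu>1 X1 \<mu> X" "resstep b \<mu> X \<mu>3 X3"
      using resstep_commute[OF b(3) a(3) ab] by blast
    have eq: "Var(n := Var a, m := Var b) = Var(m := Var b, n := Var a)" using False by (rule fun_upd_twist)
    have "a \<notin> fimg (Var(m := Var b)) (fn_proc (Res n P))"
      using a(1) ab by (auto simp: fimg_upd_Var split: if_splits)
    then have "st (esub (Var(m := Var b)) (Res n P)) \<mu> X"
      using b(2) r(1) unfolding eq st_esub_Res[OF csub_upd[OF csub_Var(1)]] by blast
    moreover have "b \<notin> fn_proc (Res m (Res n P))"
      using b(1) by (auto simp: fimg_upd_Var)
    ultimately show "st (Res m (Res n P)) \<mu>3 X3" using r(2) st_Res_iff by blast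
  qed
qed (simp add: stle_def)

lemma stle_Par_comm: "stle (Par P Q) (Par Q P)"
  unfolding stle_def
proof (intro allI impI)
  fix \<mu> X assume "st (Par P Q) \<mu> X"
  then show "st (Par Q P) \<mu> X"
  proof (cases rule: st_Par_cases)
    case (com M p X' N q Y \<sigma> \<rho>)
    show ?thesis unfolding com(1,2)
      by (rule st_intros_eq(3)[OF com(4,3) unify_sym[OF com(5)]]) (use com in \<open>auto simp: Un_commute cpar.commute\<close>)
  qed (auto intro: st_l st_r)
qed

lemma stle_trans [trans]: "stle P Q \<Longrightarrow> stle Q R \<Longrightarrow> stle P R"
  by (simp add: stle_def)

lemma stle_Par:
  assumes "stle P P'" "stle Q Q'" "fn_proc P = fn_proc P'" "fn_proc Q = fn_proc Q'" "cls P = cls P'" "cls Q = cls Q'"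
  shows "stle (Par P Q) (Par P' Q')"
  unfolding stle_def
proof (intro allI impI)
  fix \<mu> X assume "st (Par P Q) \<mu> X"
  then show "st (Par P' Q') \<mu> X"
  proof (cases rule: st_Par_cases)
    case (com M p X' N q Y \<sigma> \<rho>)
    show ?thesis unfolding com(1,2)
      by (rule st.st_com[OF _ _ com(5)]) (use com assms in \<open>auto simp: stle_def\<close>)
  qed (use assms in \<open>auto simp: stle_def intro: st_l st_r\<close>)
qed

lemma stle_Par_nil: "wf_proc P \<Longrightarrow> stle (Par P Nil) P" "wf_proc P \<Longrightarrow> stle P (Par P Nil)"
  unfolding stle_def by (auto elim!: st_ParE elim: st_NilE simp: cls_Nil intro: st_intros_eq(1))

text \<open>For an idle component: the binders of a label are fresh for it, so a match leaves it
  alone.\<close>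

lemma csubst_tot_cls: "is_subst \<sigma> \<Longrightarrow> wf_proc P \<Longrightarrow> dom \<sigma> \<inter> fn_proc P = {} \<Longrightarrow> csubst (tot \<sigma>) (cls P) = cls P"
  by (rule csubst_id[OF csub_tot]) (auto simp: cfn_cls intro!: tot_notin)

text \<open>In a communication of two components the third is idle. The communication is first given
  bound names fresh for the idle process, so that this process can pass through the matching
  substitution and the restriction.\<close>

lemma stle_Par_assoc:
  assumes wf: "wf_proc P" "wf_proc Q" "wf_proc R"
  shows "stle (Par P (Par Q R)) (Par (Par P Q) R)"
  unfolding stle_def
proof (intro allI impI)
  fix \<mu> Z assume "st (Par P (Par Q R)) \<mu> Z"
  then show "st (Par (Par P Q) R) \<mu> Z"
  proof (cases rule: st_Par_cases)
    case (l X)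
    then show ?thesis using wf
      by (auto simp: cls_Par cpar.assoc intro!: st_intros_eq(1)[OF st_l])
  next
    case (r X)
    show ?thesis using r(1)
    proof (cases rule: st_Par_cases)
      case a: (l Y)
      then show ?thesis using r wf
        by (auto simp: cls_Par cpar_ac intro!: st_intros_eq(1)[OF st_r])
    next
      case b: (r Y)
      then show ?thesis using r wf
        by (auto simp: cls_Par cpar_ac intro!: st_intros_eq(2))
    next
      case c: (com M p X' N q Y \<sigma> \<rho>)
      obtain M p X' N q Y \<sigma> \<rho> where d: "st Q (Out M p) X'" "st R (Out N q) Y" "unify p q = Some (\<sigma>, \<rho>)"
        "M \<inter> fn_proc R = {}" "N \<inter> fn_proc Q = {}" "M \<inter> N = {}" "(M \<union> N \<union> bn p \<union> bn q) \<inter> fn_proc P = {}"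
        "X = cresS (M \<union> N) (cpar (csubst (tot \<sigma>) X') (csubst (tot \<rho>) Y))"
        using st_com_freshE[OF c(3-8) wf(2,3) finite_fn_proc[of P]] c(2) by metis
      have f: "finite M" "finite N" using st_OutD(1)[OF d(1)] st_OutD(1)[OF d(2)] wf by auto
      have u: "is_subst \<sigma>" "dom \<sigma> = bn p" using unify_is_subst[OF d(3)] unify_dom[OF d(3)] by auto
      have "st (Par P Q) (Out M p) (cpar X' (cls P))" using d by (intro st_r) auto
      then show ?thesis unfolding c(1)
      proof (rule st_intros_eq(3)[OF _ d(2,3)])
        have "csubst (tot \<sigma>) (cls P) = cls P" using u d wf by (intro csubst_tot_cls) auto
        then show "Z = cresS (M \<union> N) (cpar (csubst (tot \<sigma>) (cpar X' (cls P))) (csubst (tot \<rho>) Y))"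
          unfolding r(3) d(8) csubst_cpar[OF csub_tot[OF u(1)]] using f d(7) wf
          by (subst cresS_cpar) (auto simp: cfn_cls cpar_ac)
      qed (use d in auto)
    qed
  next
    case (com M0 p0 X0 N0 q0 Y0 \<sigma>0 \<rho>0)
    have wf': "wf_proc (Par Q R)" using wf by simp
    have fin: "finite (fn_proc P \<union> fn_proc Q \<union> fn_proc R)" by simp
    obtain M p X N q Y \<sigma> \<rho> where d: "st P (Out M p) X" "st (Par Q R) (Out N q) Y" "unify p q = Some (\<sigma>, \<rho>)"
        "M \<inter> fn_proc (Par Q R) = {}" "N \<inter> fn_proc P = {}" "M \<inter> N = {}"
        "(M \<union> N \<union> bn p \<union> bn q) \<inter> (fn_proc P \<union> fn_proc Q \<union> fn_proc R) = {}"
        "Z = cresS (M \<union> N) (cpar (csubst (tot \<sigma>) X) (csubst (tot \<rho>) Y))"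
      using st_com_freshE[OF com(3-8) wf(1) wf' fin] com(2) by metis
    have f: "finite M" "finite N" using st_OutD(1)[OF d(1)] st_OutD(1)[OF d(2)] wf by auto
    have u: "is_subst \<sigma>" "dom \<sigma> = bn p" "is_subst \<rho>" "dom \<rho> = bn q"
      using unify_is_subst[OF d(3)] unify_dom[OF d(3)] by auto
    show ?thesis using d(2)
    proof (cases rule: st_Par_cases)
      case a: (l Y1)
      have e: "csubst (tot \<rho>) (cls R) = cls R" using u d wf by (intro csubst_tot_cls) auto
      have "st (Par P Q) Tau (cresS (M \<union> N) (cpar (csubst (tot \<sigma>) X) (csubst (tot \<rho>) Y1)))"
        using d a by (intro st_com) auto
      then show ?thesis unfolding com(1)
      proof (rule st_intros_eq(1))
        show "Z = cpar (cresS (M \<union> N) (cpar (csubst (tot \<sigma>) X) (csubst (tot \<rho>) Y1))) (cls R)"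
          unfolding d(8) a(3) csubst_cpar[OF csub_tot[OF u(3)]] e using f d(7) wf
          by (subst cresS_cpar) (auto simp: cfn_cls cpar_ac)
      qed simp
    next
      case b: (r Y1)
      have e: "csubst (tot \<rho>) (cls Q) = cls Q" "csubst (tot \<sigma>) (cls Q) = cls Q"
        using u d wf by (auto intro!: csubst_tot_cls)
      have "st (Par P Q) (Out M p) (cpar X (cls Q))" using d by (intro st_l) auto
      then show ?thesis unfolding com(1)
      proof (rule st_intros_eq(3)[OF _ b(1) d(3)])
        show "Z = cresS (M \<union> N) (cpar (csubst (tot \<sigma>) (cpar X (cls Q))) (csubst (tot \<rho>) Y1))"
          unfolding d(8) b(3) csubst_cpar[OF csub_tot[OF u(3)]] csubst_cpar[OF csub_tot[OF u(1)]] e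
          by (simp add: cpar_ac)
      qed (use d b in auto)
    next
      case c: com
      then show ?thesis by simp
    qed
  qed
qed

lemma st_RepI: "st P \<mu> X \<Longrightarrow> wf_proc P \<Longrightarrow> st (Rep P) \<mu> (cpar X (cls (Rep P)))"
  by (rule st_intros_eq(5)[OF st_l]) (auto simp: st_bnd cpar.assoc cls_Rep)

text \<open>A visible action is due to one copy, and the other copy is absorbed by the
  replication.\<close>

lemma st_Rep_OutD:
  assumes "st (Rep P) (Out N p) Z" "wf_proc P"
  obtains X where "st P (Out N p) X" "Z = cpar X (cls (Rep P))"
proof -
  obtain X where X: "st (Par P P) (Out N p) X" "Z = cpar X (cls (Rep P))" using assms(1) by (rule st_RepE)
  from X(1) show ?thesis
  proof (cases rule: st_Par_cases)
    case (l Y)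
    then show ?thesis using that X(2) assms(2) by (simp add: cpar.assoc cls_Rep)
  next
    case (r Y)
    then show ?thesis using that X(2) assms(2) by (simp add: cpar.assoc cls_Rep)
  qed simp
qed

lemma com_cpar_cls:
  assumes "st P (Out M p) X" "st Q (Out N q) Y" "unify p q = Some (\<sigma>, \<rho>)" "wf_proc P" "wf_proc Q" "wf_proc R"
    "bn q \<inter> fn_proc R = {}" "M \<inter> fn_proc R = {}" "N \<inter> fn_proc R = {}"
  shows "cresS (M \<union> N) (cpar (csubst (tot \<sigma>) X) (csubst (tot \<rho>) (cpar Y (cls R))))
    = cpar (cresS (M \<union> N) (cpar (csubst (tot \<sigma>) X) (csubst (tot \<rho>) Y))) (cls R)"
proof -
  have u: "is_subst \<sigma>" "dom \<sigma> = bn p" "is_subst \<rho>" "dom \<rho> = bn q"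
    using unify_is_subst[OF assms(3)] unify_dom[OF assms(3)] by auto
  have f: "finite (M \<union> N)" using st_OutD(1)[OF assms(1,4)] st_OutD(1)[OF assms(2,5)] by simp
  have e: "csubst (tot \<rho>) (cls R) = cls R" using u assms by (intro csubst_tot_cls) auto
  show ?thesis unfolding csubst_cpar[OF csub_tot[OF u(3)]] e using f assms(6-9)
    by (subst cresS_cpar) (auto simp: cfn_cls cpar_ac)
qed

lemma stle_Rep_unfold:
  assumes wf: "wf_proc P"
  shows "stle (Rep P) (Par P (Rep P))"
  unfolding stle_def
proof (intro allI impI)
  fix \<mu> Z assume "st (Rep P) \<mu> Z"
  then obtain X where X: "st (Par P P) \<mu> X" "Z = cpar X (cls (Rep P))" by (rule st_RepE)
  from X(1) show "st (Par P (Rep P)) \<mu> Z"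
  proof (cases rule: st_Par_cases)
    case (l Y)
    then show ?thesis using X(2) wf by (intro st_intros_eq(1)[OF l(1)]) (auto simp: cpar.assoc cls_Rep)
  next
    case (r Y)
    then show ?thesis using X(2) wf by (intro st_intros_eq(1)[OF r(1)]) (auto simp: cpar.assoc cls_Rep)
  next
    case (com M p X' N q Y \<sigma> \<rho>)
    note q = st_OutD[OF com(4) wf]
    show ?thesis unfolding com(1)
    \<comment> \<open>One partner stays as the exposed copy, the other moves inside the remaining
      \<open>Rep P\<close>.\<close>
    proof (rule st_intros_eq(3)[OF com(3) st_RepI[OF com(4) wf] com(5)])
      show "Z = cresS (M \<union> N) (cpar (csubst (tot \<sigma>) X') (csubst (tot \<rho>) (cpar Y (cls (Rep P)))))"
        unfolding X(2) com(2) using com q wf by (intro com_cpar_cls[symmetric]) auto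
    qed (use com in auto)
  qed
qed

lemma stle_Rep_fold:
  assumes wf: "wf_proc P"
  shows "stle (Par P (Rep P)) (Rep P)"
  unfolding stle_def
proof (intro allI impI)
  fix \<mu> Z assume "st (Par P (Rep P)) \<mu> Z"
  then show "st (Rep P) \<mu> Z"
  proof (cases rule: st_Par_cases)
    case (l X)
    then show ?thesis using wf by (simp add: st_RepI)
  next
    case (r X)
    obtain X' where X': "X = cpar X' (cls (Rep P))" using r(1) by (rule st_RepE)
    \<comment> \<open>The exposed copy was idle and is absorbed, so the target is already that of
      \<open>Rep P\<close>.\<close>
    have "Z = cpar X' (cpar (cls P) (cls (Rep P)))" using r(3) X' by (simp add: cpar_ac)
    then have "Z = X" using X' cls_Rep[OF wf] by simp
    then show ?thesis using r(1) by simp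
  next
    case (com M p X N q Y \<sigma> \<rho>)
    obtain Y1 where Y1: "st P (Out N q) Y1" "Y = cpar Y1 (cls (Rep P))" using st_Rep_OutD[OF com(4) wf] .
    note q = st_OutD[OF Y1(1) wf]
    have "st (Par P P) Tau (cresS (M \<union> N) (cpar (csubst (tot \<sigma>) X) (csubst (tot \<rho>) Y1)))"
      using com Y1 by (intro st_com) auto
    then show ?thesis unfolding com(1)
    proof (rule st_intros_eq(5))
      show "Z = cpar (cresS (M \<union> N) (cpar (csubst (tot \<sigma>) X) (csubst (tot \<rho>) Y1))) (cls (Rep P))"
        unfolding com(2) Y1(2) using com Y1 q wf by (intro com_cpar_cls) auto
    qed
  qed
qed

lemma cls_Res_rename:
  assumes "wf_proc Q" "m \<notin> fn_proc (Res n Q)"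
  shows "cls (Res n Q) = cres m (cls (esub (Var(n := Var m)) Q))"
  using csubst_cres[of Var m n "cls Q"] assms by (simp add: cls_Res cfn_cls csubst_cls)

lemma esub_Var_upd_fresh: "n \<notin> fn_proc P \<Longrightarrow> esub (Var(n := Var m)) P = esub Var P"
  by (rule esub_cong) (auto simp: fun_upd_apply)

lemma csubst_tot_cres:
  assumes "is_subst \<sigma>" "m \<notin> dom \<sigma>" "m \<notin> fn_subst \<sigma>"
  shows "csubst (tot \<sigma>) (cres m X) = cres m (csubst (tot \<sigma>) X)"
proof (rule csubst_cres_fresh[OF csub_tot[OF assms(1)]])
  show "m \<notin> fimg (tot \<sigma>) (cfn X - {m})" using fimg_tot[of \<sigma> "cfn X - {m}"] assms by auto
qed (use assms in simp)

text \<open>The restricted \<open>m\<close> occurs neither in the patterns nor in the other partner,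
  so it passes through \<rho> and out of the communication.\<close>

lemma com_cres:
  assumes "st P (Out M p) X" "wf_proc P" "finite N" "unify p q = Some (\<sigma>, \<rho>)"
    "m \<notin> fn_proc P \<union> M \<union> bn p" "m \<notin> names_pat q"
  shows "cresS (M \<union> N) (cpar (csubst (tot \<sigma>) X) (csubst (tot \<rho>) (cres m Y)))
    = cres m (cresS (M \<union> N) (cpar (csubst (tot \<sigma>) X) (csubst (tot \<rho>) Y)))"
proof -
  note p = st_OutD[OF assms(1,2)]
  have u: "is_subst \<sigma>" "dom \<sigma> = bn p" "is_subst \<rho>" "dom \<rho> = bn q" "fn_subst \<sigma> \<subseteq> fn_pat q" "fn_subst \<rho> \<subseteq> fn_pat p"
    using unify_is_subst[OF assms(4)] unify_dom[OF assms(4)] unify_fn_subst[OF assms(4)] by auto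
  have e: "csubst (tot \<rho>) (cres m Y) = cres m (csubst (tot \<rho>) Y)"
    using u assms p(7) by (intro csubst_tot_cres) (auto simp: names_pat_def)
  have "m \<notin> cfn (csubst (tot \<sigma>) X)"
    using fimg_tot[of \<sigma> "cfn X"] u assms p(9) by (auto simp: cfn_csubst csub_tot names_pat_def)
  then show ?thesis unfolding e using p(1) assms(3) by (simp add: cpar_cres cres_cresS)
qed

text \<open>The delicate case is a communication that extrudes \<open>n\<close>. On the left the
  name is opened in the label of \<open>Res n Q\<close> and closed again by \<open>st_com\<close>;
  on the right the partners communicate inside the scope and \<open>st_res\<close> restricts the
  target. \<open>cresS_insert\<close> identifies the two targets.\<close>

lemma stle_scope:
  assumes wf: "wf_proc P" "wf_proc Q" and n: "n \<notin> fn_proc P"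
  shows "stle (Par P (Res n Q)) (Res n (Par P Q))"
  unfolding stle_def
proof (intro allI impI)
  fix \<mu> Z assume "st (Par P (Res n Q)) \<mu> Z"
  define Qm where "Qm m = esub (Var(n := Var m)) Q" for m
  have e: "esub (Var(n := Var m)) (Par P Q) = Par (esub Var P) (Qm m)" for m
    using esub_Var_upd_fresh[OF n] by (simp add: Qm_def)
  have fn: "fn_proc (Qm m) \<subseteq> insert m (fn_proc Q - {n})" for m
    by (auto simp: Qm_def fn_esub_upd split: if_splits)
  have wfQ: "wf_proc (Qm m)" for m using wf by (simp add: Qm_def wf_esub)
  have stP: "st P \<mu> X \<Longrightarrow> st (esub Var P) \<mu> X" for \<mu> X by (rule st_norm) (auto simp: wf wf_esub)
  from \<open>st (Par P (Res n Q)) \<mu> Z\<close> show "st (Res n (Par P Q)) \<mu> Z"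
  proof (cases rule: st_Par_cases)
    case (l X)
    \<comment> \<open>\<open>Q\<close> does not move here, so the name for \<open>n\<close> can be
      chosen clear of label and target.\<close>
    obtain m where "m \<notin> fn_proc P \<union> fn_proc Q \<union> names_label \<mu> \<union> cfn X"
      using ex_fresh[of "fn_proc P \<union> fn_proc Q \<union> names_label \<mu> \<union> cfn X"] st_bnd[OF l(1) wf(1)] by auto
    then have m: "m \<notin> fn_proc P" "m \<notin> fn_proc Q" "m \<notin> names_label \<mu>" "m \<notin> cfn X" by auto
    have "st (Par (esub Var P) (Qm m)) \<mu> (cpar X (cls (Qm m)))"
      using stP[OF l(1)] l(2) fn[of m] m bnd_names[of \<mu>] by (intro st_l) auto
    then show ?thesis
    proof (intro st_intros_eq(4)[of n m "Par P Q", unfolded e])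
      show "Z = cres m (cpar X (cls (Qm m)))"
        using cls_Res_rename[OF wf(2), of m n] m l(3) by (simp add: Qm_def cpar_cres)
    qed (use m in auto)
  next
    case (r X)
    obtain m \<mu>' X' where m: "m \<notin> fn_proc (Res n Q)" "st (Qm m) \<mu>' X'" "resstep m \<mu>' X' \<mu> X" "m \<in> bnd \<mu> \<or> m \<notin> fn_proc P"
      using st_Res_freshE[OF r(1) wf(2) finite_fn_proc[of P]] unfolding Qm_def by metis
    have mP: "m \<notin> fn_proc P" using m(4) r(2) by auto
    have "st (Par (esub Var P) (Qm m)) \<mu>' (cpar X' (cls (esub Var P)))"
      using m(2) resstep_bnd[OF m(3)] r(2) by (intro st_r) auto
    moreover have "resstep m \<mu>' (cpar X' (cls (esub Var P))) \<mu> Z"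
      unfolding r(3) cls_norm[OF wf(1)] using resstep_cpar[OF m(3)] mP wf by (simp add: cfn_cls)
    moreover have "m \<notin> fn_proc (Res n (Par P Q))" using m(1) mP by auto
    ultimately show ?thesis unfolding st_Res_iff e by blast
  next
    case (com M p X N' q X' \<sigma> \<rho>)
    note p = st_OutD[OF com(3) wf(1)]
    have "finite (fn_proc P \<union> M \<union> bn p)" using p(1) by simp
    then obtain m \<mu>' Y where m: "m \<notin> fn_proc (Res n Q)" "st (Qm m) \<mu>' Y" "resstep m \<mu>' Y (Out N' q) X'"
        "m \<in> N' \<union> bn q \<or> m \<notin> fn_proc P \<union> M \<union> bn p"
      using st_Res_freshE[OF com(4) wf(2)] unfolding Qm_def by (metis bnd.simps(2))
    have wfR: "wf_proc (Res n Q)" using wf by simp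
    note q' = st_OutD[OF com(4) wfR]
    from m(3) show ?thesis
    proof (cases rule: resstep_OutE)
      case non
      have mA: "m \<notin> fn_proc P \<union> M \<union> bn p" using m(4) non(2) by (auto simp: names_pat_def)
      have "st (Par (esub Var P) (Qm m)) Tau (cresS (M \<union> N') (cpar (csubst (tot \<sigma>) X) (csubst (tot \<rho>) Y)))"
        using stP[OF com(3)] m(2) non com fn[of m] mA by (intro st_com[OF _ _ com(5)]) auto
      then show ?thesis unfolding com(1)
      proof (intro st_intros_eq(4)[of n m "Par P Q", unfolded e])
        show "Z = cres m (cresS (M \<union> N') (cpar (csubst (tot \<sigma>) X) (csubst (tot \<rho>) Y)))"
          unfolding com(2) non(3) using non(2) q'(1) mA by (intro com_cres[OF com(3) wf(1) _ com(5)]) auto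
      qed (use m mA in auto)
    next
      case (opn N)
      have mA: "m \<notin> fn_proc P" "m \<notin> M" using com(7,8) opn(2) by auto
      have "finite N" using q'(1) opn(2) by simp
      have "st (Par (esub Var P) (Qm m)) Tau (cresS (M \<union> N) (cpar (csubst (tot \<sigma>) X) (csubst (tot \<rho>) Y)))"
        using stP[OF com(3)] m(2) opn com fn[of m] mA by (intro st_com[OF _ _ com(5)]) auto
      then show ?thesis unfolding com(1)
      proof (intro st_intros_eq(4)[of n m "Par P Q", unfolded e])
        show "Z = cres m (cresS (M \<union> N) (cpar (csubst (tot \<sigma>) X) (csubst (tot \<rho>) Y)))"
          unfolding com(2) opn(2,5) using \<open>finite N\<close> p(1) by (simp add: cresS_insert)
      qed (use m mA in auto)
    qed
  qed
qed

text \<open>In a communication inside the scope the opened name \<open>m\<close> is unknown to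
  \<open>P\<close>. If the label of \<open>Q\<close> mentions it, it is unprotected by
  \<open>unify_pn\<close> and gets extruded by \<open>Res n Q\<close>; otherwise the restriction
  stays around the continuation of \<open>Q\<close>.\<close>

lemma stle_scope_conv:
  assumes wf: "wf_proc P" "wf_proc Q" and n: "n \<notin> fn_proc P"
  shows "stle (Res n (Par P Q)) (Par P (Res n Q))"
  unfolding stle_def
proof (intro allI impI)
  fix \<mu> Z assume "st (Res n (Par P Q)) \<mu> Z"
  then obtain m \<mu>' Z' where m: "m \<notin> fn_proc (Res n (Par P Q))" "st (esub (Var(n := Var m)) (Par P Q)) \<mu>' Z'"
    "resstep m \<mu>' Z' \<mu> Z" unfolding st_Res_iff by blast
  define Qm where "Qm = esub (Var(n := Var m)) Q"
  have e: "esub (Var(n := Var m)) (Par P Q) = Par (esub Var P) Qm"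
    using esub_Var_upd_fresh[OF n] by (simp add: Qm_def)
  have fn: "fn_proc (Qm) \<subseteq> insert m (fn_proc Q - {n})" "fn_proc Q - {n} \<subseteq> fn_proc Qm"
    by (auto simp: Qm_def fn_esub_upd split: if_splits)
  have wfQ: "wf_proc Qm" using wf by (simp add: Qm_def wf_esub)
  have stP: "st (esub Var P) \<mu> X \<Longrightarrow> st P \<mu> X" for \<mu> X by (erule st_norm) (auto simp: wf wf_esub)
  have mP: "m \<notin> fn_proc P" and mQ: "m \<notin> fn_proc (Res n Q)" using m(1) n by auto
  have "st (Par (esub Var P) Qm) \<mu>' Z'" using m(2) unfolding e .
  then show "st (Par P (Res n Q)) \<mu> Z"
  proof (cases rule: st_Par_cases)
    case (l X)
    note X = stP[OF l(1)]
    note b = st_bnd[OF X wf(1)]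
    \<comment> \<open>\<open>P\<close> cannot extrude \<open>m\<close>, which is not free in it, so
      the restriction acts by \<open>st_res\<close>.\<close>
    have "\<mu> = \<mu>' \<and> m \<notin> names_label \<mu>' \<and> Z = cres m Z'"
    proof -
      have "m \<notin> vn p" if "\<mu>' = Out N p" "m \<notin> N" for N p
        using st_OutD(7)[OF X[unfolded that(1)] wf(1)] vn_fn[of p] that mP by auto
      then show ?thesis using m(3) unfolding resstep_def by blast
    qed
    then have *: "\<mu> = \<mu>'" "m \<notin> names_label \<mu>'" "Z = cres m Z'" by auto
    have "m \<notin> cfn X" using b mP *(2) bnd_names[of \<mu>'] by auto
    then have "Z = cpar X (cls (Res n Q))"
      unfolding *(3) l(3) cls_Res_rename[OF wf(2) mQ] by (simp add: Qm_def cpar_cres)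
    then show ?thesis using X l(2) fn *(1) by (intro st_intros_eq(1)) auto
  next
    case (r X)
    have e2: "cls (esub Var P) = cls P" by (rule cls_norm[OF wf(1)])
    have "\<exists>X'. resstep m \<mu>' X \<mu> X' \<and> Z = cpar X' (cls P)"
      using m(3) mP wf unfolding resstep_def r(3) e2 by (auto simp: cres_cpar cfn_cls)
    then obtain X' where X': "resstep m \<mu>' X \<mu> X'" "Z = cpar X' (cls P)" by blast
    have "st (Res n Q) \<mu> X'" using r(1) X'(1) mQ unfolding st_Res_iff Qm_def by blast
    moreover have "bnd \<mu> \<inter> fn_proc P = {}" using r(2) mP resstep_bnd[OF X'(1)] by auto
    ultimately show ?thesis using X'(2) by (intro st_intros_eq(2)) auto
  next
    case (com M0 p0 X0 N0 q0 Y0 \<sigma>0 \<rho>0)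
    have *: "\<mu> = Tau" "Z = cres m Z'" using m(3) com(1) by (auto simp: resstep_def)
    have fin: "finite {m}" by simp
    obtain M p X N q Y \<sigma> \<rho> where d: "st (esub Var P) (Out M p) X" "st Qm (Out N q) Y" "unify p q = Some (\<sigma>, \<rho>)"
        "M \<inter> fn_proc Qm = {}" "N \<inter> fn_proc (esub Var P) = {}" "M \<inter> N = {}" "(M \<union> N \<union> bn p \<union> bn q) \<inter> {m} = {}"
        "Z' = cresS (M \<union> N) (cpar (csubst (tot \<sigma>) X) (csubst (tot \<rho>) Y))"
      using st_com_freshE[OF com(3-8) wf_esub[OF csub_Var(1) wf(1)] wfQ fin] com(2) by metis
    note X = stP[OF d(1)]
    note p = st_OutD[OF X wf(1)] and q = st_OutD[OF d(2) wfQ]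
    have mp: "m \<notin> fn_pat p" using p(7) mP d(7) by auto
    show ?thesis
    proof (cases "m \<in> fn_pat q")
      case False
      then have "st (Res n Q) (Out N q) (cres m Y)"
        using d(2,7) mQ by (intro st_res[of n m Q, folded Qm_def]) (auto simp: names_pat_def)
      then show ?thesis unfolding *(1)
      proof (rule st_intros_eq(3)[OF X _ d(3)])
        show "Z = cresS (M \<union> N) (cpar (csubst (tot \<sigma>) X) (csubst (tot \<rho>) (cres m Y)))"
          unfolding *(2) d(8) using False d(7) mP q(1)
          by (intro com_cres[symmetric, OF X wf(1) _ d(3)]) (auto simp: names_pat_def)
      qed (use d fn in auto)
    next
      case True
      have "m \<in> vn q" "m \<notin> pn q" using True unify_pn[OF d(3)] mp by (auto simp: fn_pat_def)
      then have "st (Res n Q) (Out (insert m N) q) Y"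
        using d(2,7) mQ by (intro st_open[of n m Q, folded Qm_def]) auto
      then show ?thesis unfolding *(1)
      proof (rule st_intros_eq(3)[OF X _ d(3)])
        show "Z = cresS (M \<union> insert m N) (cpar (csubst (tot \<sigma>) X) (csubst (tot \<rho>) Y))"
          unfolding *(2) d(8) using p(1) q(1) by (simp add: cresS_insert)
      qed (use d fn mP in auto)
    qed
  qed
qed

lemma ren_lab_swap_swap: "ren_lab (swap_name a b) (ren_lab (swap_name a b) \<mu>) = \<mu>"
  by (cases \<mu>) (auto simp: psub_psub image_image intro!: psub_id)

lemma stle_swap:
  assumes "stle P Q" "wf_proc P" "wf_proc Q"
  shows "stle (esub (Var \<circ> swap_name a b) P) (esub (Var \<circ> swap_name a b) Q)"
  unfolding stle_def
proof (intro allI impI)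
  let ?\<pi> = "swap_name a b"
  fix \<mu> X assume s: "st (esub (Var \<circ> ?\<pi>) P) \<mu> X"
  have inv: "cmp (Var \<circ> ?\<pi>) (Var \<circ> ?\<pi>) = Var" by (auto simp: fun_eq_iff cmp_def)
  have "st (esub (Var \<circ> ?\<pi>) (esub (Var \<circ> ?\<pi>) P)) (ren_lab ?\<pi> \<mu>) (csubst (Var \<circ> ?\<pi>) X)"
    by (rule st_ren[OF bij_swap_name s wf_esub[OF csub_Var(3) assms(2)]])
  then have "st (esub Var P) (ren_lab ?\<pi> \<mu>) (csubst (Var \<circ> ?\<pi>) X)"
    unfolding esub_esub[OF csub_Var(3) csub_Var(3)] inv .
  then have "st P (ren_lab ?\<pi> \<mu>) (csubst (Var \<circ> ?\<pi>) X)"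
    by (rule st_norm) (use assms in \<open>auto simp: wf_esub\<close>)
  then have "st Q (ren_lab ?\<pi> \<mu>) (csubst (Var \<circ> ?\<pi>) X)" using assms(1) by (simp add: stle_def)
  from st_ren[OF bij_swap_name this assms(3), of a b] show "st (esub (Var \<circ> ?\<pi>) Q) \<mu> X"
    unfolding csubst_csubst[OF csub_Var(3) csub_Var(3)] inv ren_lab_swap_swap csubst_Var .
qed

text \<open>On the free names, opening \<open>n\<close> as a fresh \<open>m\<close> is a swap, and
  inclusion of transitions is transported along swaps by equivariance.\<close>

lemma stle_Res:
  assumes "stle P Q" "wf_proc P" "wf_proc Q" "fn_proc P = fn_proc Q"
  shows "stle (Res n P) (Res n Q)"
  unfolding stle_def
proof (intro allI impI)
  fix \<mu> Z assume "st (Res n P) \<mu> Z"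
  then obtain m \<mu>' X where m: "m \<notin> fn_proc (Res n P)" "st (esub (Var(n := Var m)) P) \<mu>' X" "resstep m \<mu>' X \<mu> Z"
    unfolding st_Res_iff by blast
  have e: "esub (Var(n := Var m)) R = esub (Var \<circ> swap_name n m) R" if "m \<notin> fn_proc (Res n R)" for R
    using that by (intro esub_cong) (auto simp: fun_upd_apply swap_name_def)
  have m': "m \<notin> fn_proc (Res n Q)" using m(1) assms(4) by simp
  have "st (esub (Var(n := Var m)) Q) \<mu>' X"
    using m(2) stle_swap[OF assms(1-3), of n m] unfolding e[OF m(1)] e[OF m'] stle_def by blast
  then show "st (Res n Q) \<mu> Z" using m' m(3) unfolding st_Res_iff by blast
qed

lemma stle_Case:
  assumes "fn_proc P = fn_proc Q" "cls P = cls Q"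
  shows "stle (Case p P) (Case p Q)"
  unfolding stle_def
proof (intro allI impI)
  fix \<mu> X assume "st (Case p P) \<mu> X"
  then show "st (Case p Q) \<mu> X"
    by (rule st_CaseE) (use assms st_case[of _ p Q] in auto)
qed

lemma stle_Rep: "stle P Q \<Longrightarrow> fn_proc P = fn_proc Q \<Longrightarrow> cls P = cls Q \<Longrightarrow> cls (Rep P) = cls (Rep Q) \<Longrightarrow> stle (Rep P) (Rep Q)"
  using stle_Par[of P Q P Q] unfolding stle_def by (auto elim!: st_RepE intro!: st.st_rep)

lemma scong_stle: "scong P Q \<Longrightarrow> wf_proc P \<Longrightarrow> stle P Q \<and> stle Q P"
proof (induction rule: scong.induct)
  case (sc_alpha P Q)
  then show ?case using st_alpha alpha_sym alpha_wf unfolding stle_def by metis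
next
  case (sc_sym P Q)
  then show ?case using scong_wf by blast
next
  case (sc_trans P Q R)
  then show ?case using scong_wf stle_trans by metis
next
  case (sc_par P P' Q Q')
  have w: "wf_proc P" "wf_proc P'" "wf_proc Q" "wf_proc Q'" using sc_par scong_wf by auto
  show ?case using sc_par scong_fn[OF sc_par.hyps(1)] scong_fn[OF sc_par.hyps(2)] w by (auto intro!: stle_Par simp: cls_eq sc_sym)
next
  case (sc_rep P P')
  have w: "wf_proc P" "wf_proc P'" using sc_rep scong_wf by auto
  show ?case using sc_rep scong_fn[OF sc_rep.hyps(1)] w by (auto intro!: stle_Rep simp: cls_eq sc_sym scong.sc_rep)
next
  case (sc_res P P' x)
  have w: "wf_proc P" "wf_proc P'" using sc_res scong_wf by auto
  show ?case using sc_res scong_fn[OF sc_res.hyps(1)] w by (auto intro!: stle_Res)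
next
  case (sc_case P P' p)
  have w: "wf_proc P" "wf_proc P'" using sc_case scong_wf by auto
  show ?case using sc_case scong_fn[OF sc_case.hyps(1)] w by (auto intro!: stle_Case simp: cls_eq sc_sym)
next
  case (sc_par_nil P)
  then show ?case using stle_Par_nil by simp
next
  case (sc_par_comm P Q)
  then show ?case using stle_Par_comm by simp
next
  case (sc_par_assoc P Q R)
  then have w: "wf_proc P" "wf_proc Q" "wf_proc R" by auto
  have c: "cls (Par A B) = cls (Par B A)" if "wf_proc A" "wf_proc B" for A B using that by (simp add: cls_Par cpar.commute)
  have refl: "stle A A" for A by (simp add: stle_def)
  \<comment> \<open>The converse of associativity is the proved direction conjugated with
    commutativity.\<close>
  have "stle (Par (Par P Q) R) (Par R (Par P Q))" by (rule stle_Par_comm)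
  also have "stle \<dots> (Par R (Par Q P))" using w c by (intro stle_Par refl stle_Par_comm) auto
  also have "stle \<dots> (Par (Par R Q) P)" by (intro stle_Par_assoc w)
  also have "stle \<dots> (Par P (Par R Q))" by (rule stle_Par_comm)
  also have "stle \<dots> (Par P (Par Q R))" using w c by (intro stle_Par refl stle_Par_comm) auto
  finally show ?case using stle_Par_assoc[OF w] by blast
next
  case (sc_res_nil n)
  have "\<not> st (Res n Nil) \<mu> X" "\<not> st Nil \<mu> X" for \<mu> X by (auto elim!: st_ResE st_NilE)
  then show ?case by (simp add: stle_def)
next
  case (sc_res_comm n m P)
  then show ?case using stle_res_comm by simp
next
  case (sc_rep_unfold P)
  then show ?case using stle_Rep_unfold stle_Rep_fold by simp
next
  case (sc_scope n P Q)
  then show ?case using stle_scope stle_scope_conv by simp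
qed (simp add: stle_def)

lemma st_scong: "st P \<mu> X \<Longrightarrow> scong P Q \<Longrightarrow> wf_proc P \<Longrightarrow> st Q \<mu> X"
  using scong_stle by (auto simp: stle_def)

subsection \<open>Correspondence with labelled transitions, reductions and barbs\<close>

lemma st_esub_norm: "wf_proc P \<Longrightarrow> st (esub Var P) \<mu> X \<longleftrightarrow> st P \<mu> X"
  by (auto elim: st_norm simp: wf_esub)

lemma st_Res_same: "st P \<mu> X \<Longrightarrow> wf_proc P \<Longrightarrow> n \<notin> names_label \<mu> \<Longrightarrow> st (Res n P) \<mu> (cres n X)"
  by (rule st_res[of n n]) (simp_all add: fun_upd_idem st_esub_norm)

lemma st_open_same: "st P (Out N p) X \<Longrightarrow> wf_proc P \<Longrightarrow> n \<in> vn p \<Longrightarrow> n \<notin> N \<union> pn p \<Longrightarrow>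
    st (Res n P) (Out (insert n N) p) X"
  by (rule st_open[of n n]) (simp_all add: fun_upd_idem st_esub_norm)

lemma st_Case_same:
  assumes "wf_proc (Case p P)"
  shows "st (Case p P) (Out {} p) (cls P)"
proof -
  have "updb Var id (bn p) = Var" by (auto simp: fun_eq_iff updb_def)
  then show ?thesis using st_case[of id p P] fn_Case_wf[of p P] assms by simp
qed

lemma cls_subst: "is_subst \<sigma> \<Longrightarrow> wf_proc P \<Longrightarrow> cls (subst \<sigma> P) = csubst (tot \<sigma>) (cls P)"
  using cls_alpha[OF alpha_subst] wf_subst by (simp add: csubst_cls csub_tot)

lemma lts_st: "lts P \<mu> P' \<Longrightarrow> wf_proc P \<Longrightarrow> wf_proc P' \<and> st P \<mu> (cls P')"
proof (induction rule: lts.induct)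
  case (tr_case p P)
  then show ?case using st_Case_same by simp
next
  case (tr_resnon P \<mu> P' n)
  then show ?case by (simp add: cls_Res st_Res_same)
next
  case (tr_open P N p P' m)
  then show ?case by (simp add: st_open_same)
next
  case (tr_unify P M p P' Q N q Q' \<sigma> \<rho>)
  then have w: "wf_proc P'" "wf_proc Q'" and s: "st P (Out M p) (cls P')" "st Q (Out N q) (cls Q')" by auto
  note u = unify_is_subst[OF tr_unify.hyps(3)]
  have f: "finite (M \<union> N)" using st_OutD(1)[OF s(1)] st_OutD(1)[OF s(2)] tr_unify.prems by simp
  have w': "wf_proc (Par (subst \<sigma> P') (subst \<rho> Q'))" using w u by (simp add: wf_subst)
  show ?case using cls_resS[OF f w'] w u wf_subst
    by (auto simp: cls_Par cls_subst intro!: st_intros_eq(3)[OF s tr_unify.hyps(3-6)])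
next
  case (tr_rep P \<mu> P')
  then have "st (Par (Rep P) P) \<mu> (cls P')" by simp
  \<comment> \<open>The premise of \<open>tr_rep\<close> exposes one copy; folding it back removes
    the difference from \<open>st_rep\<close>.\<close>
  then show ?case using tr_rep stle_Par_comm[of "Rep P" P] stle_Rep_fold[of P] by (simp add: stle_def)
next
  case (tr_alpha P P0 \<mu> P1 P')
  then show ?case using alpha_wf cls_alpha st_alpha alpha_sym by metis
next
  case (tr_parint_l P P' Q)
  then show ?case by (auto simp: cls_Par intro: st_l)
next
  case (tr_parint_r P P' Q)
  then show ?case by (auto simp: cls_Par intro: st_intros_eq(2) cpar.commute)
next
  case (tr_parext_l P N p P' Q)
  then show ?case by (simp add: cls_Par st_l)
next
  case (tr_parext_r P N p P' Q)
  then show ?case by (auto simp: cls_Par cpar.commute[of "cls Q"] intro!: st_r)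
qed

lemma st_Case_cases [consumes 1]:
  assumes "st (Case p P) \<mu> X"
  obtains \<beta> where "\<mu> = Out {} (psub Var \<beta> p)" "X = csubst (updb Var \<beta> (bn p)) (cls P)"
    "inj_on \<beta> (bn p)" "\<beta> ` bn p \<inter> fn_proc (Case p P) = {}"
  using assms by (rule st_CaseE) auto

lemma size_esub [simp]: "size (esub \<theta> P) = size P"
  by (induction P arbitrary: \<theta>) (auto simp: Let_def)

lemma alpha_Res_rename:
  "wf_proc P \<Longrightarrow> m \<notin> fn_proc (Res n P) \<Longrightarrow> alpha (Res n P) (Res m (esub (Var(n := Var m)) P))"
  using alpha_trans[OF alpha_norm[of "Res n P"] alpha_esub_Res[of Var P m n]] by simp

lemma alpha_Case_rename:
  "wf_proc (Case p P) \<Longrightarrow> inj_on \<beta> (bn p) \<Longrightarrow> \<beta> ` bn p \<inter> fn_proc (Case p P) = {} \<Longrightarrow>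
    alpha (Case p P) (Case (psub Var \<beta> p) (esub (updb Var \<beta> (bn p)) P))"
  using alpha_trans[OF alpha_norm[of "Case p P"] alpha_esub_Case[of Var p P \<beta>]] by (simp del: esub.simps fn_proc.simps wf_proc.simps)

text \<open>Induction on size, as an opened body is not a subterm. \<open>tr_alpha\<close> is
  applied only at a prefix or a restriction, to reach the names that \<open>st\<close> has
  chosen.\<close>

lemma st_lts: "st P \<mu> X \<Longrightarrow> wf_proc P \<Longrightarrow> \<exists>P'. lts P \<mu> P' \<and> wf_proc P' \<and> X = cls P'"
proof -
  have "\<exists>P'. lts P \<mu> P' \<and> X = cls P'" if "st P \<mu> X" "wf_proc P" for P \<mu> X
    using that
  proof (induction "size P" arbitrary: P \<mu> X rule: less_induct)
    case less
    have par: "\<exists>P'. lts (Par R Q) \<mu> P' \<and> Z = cls P'" if "lts Q \<mu> Q'" "bnd \<mu> \<inter> fn_proc R = {}"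
       "wf_proc R" "wf_proc Q" "Z = cpar (cls Q') (cls R)" for R Q Q' \<mu> Z
      using that lts_st[OF that(1)]
      by (intro exI[of _ "Par R Q'"], cases \<mu>) (auto simp: cls_Par cpar.commute intro: tr_parint_r tr_parext_r)
    show ?case
    proof (cases P)
      case Nil
      then show ?thesis using less.prems by (auto elim: st_NilE)
    next
      case (Par P1 P2)
      then have w: "wf_proc P1" "wf_proc P2" using less.prems by auto
      from less.prems(1)[unfolded Par] show ?thesis
      proof (cases rule: st_Par_cases)
        case (l X1)
        obtain P1' where P1': "lts P1 \<mu> P1'" "X1 = cls P1'" using less.hyps[OF _ l(1) w(1)] Par by auto
        show ?thesis
          using P1' l lts_st[OF P1'(1) w(1)] w unfolding Par
          by (intro exI[of _ "Par P1' P2"], cases \<mu>) (auto simp: cls_Par intro: tr_parint_l tr_parext_l)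
      next
        case (r X2)
        obtain P2' where P2': "lts P2 \<mu> P2'" "X2 = cls P2'" using less.hyps[OF _ r(1) w(2)] Par by auto
        then show ?thesis using par r w unfolding Par by blast
      next
        case (com M p X1 N q X2 \<sigma> \<rho>)
        obtain P1' where P1': "lts P1 (Out M p) P1'" "X1 = cls P1'" using less.hyps[OF _ com(3) w(1)] Par by auto
        obtain P2' where P2': "lts P2 (Out N q) P2'" "X2 = cls P2'" using less.hyps[OF _ com(4) w(2)] Par by auto
        have l: "lts (Par P1 P2) Tau (resS (M \<union> N) (Par (subst \<sigma> P1') (subst \<rho> P2')))"
          by (rule tr_unify[OF P1'(1) P2'(1) com(5-8)])
        have w': "wf_proc P1'" "wf_proc P2'" using lts_st P1' P2' w by blast+
        note u = unify_is_subst[OF com(5)]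
        have "finite (M \<union> N)" using st_OutD(1)[OF com(3)] st_OutD(1)[OF com(4)] w by simp
        then have "X = cls (resS (M \<union> N) (Par (subst \<sigma> P1') (subst \<rho> P2')))"
          using cls_resS[of "M \<union> N" "Par (subst \<sigma> P1') (subst \<rho> P2')"] w' u com(2) P1' P2'
          by (simp add: wf_subst cls_Par cls_subst)
        then show ?thesis using l com(1) Par by blast
      qed
    next
      case (Res n Q)
      then have w: "wf_proc Q" using less.prems by auto
      obtain m \<mu>' Y where m: "m \<notin> fn_proc (Res n Q)" "st (esub (Var(n := Var m)) Q) \<mu>' Y" "resstep m \<mu>' Y \<mu> X"
        using less.prems(1) unfolding Res st_Res_iff by blast
      have wf: "wf_proc (esub (Var(n := Var m)) Q)" using w by (simp add: wf_esub)
      obtain Q' where Q': "lts (esub (Var(n := Var m)) Q) \<mu>' Q'" "Y = cls Q'"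
        using less.hyps[OF _ m(2) wf] Res by auto
      have w': "wf_proc Q'" using lts_st Q' wf by blast
      note al = alpha_Res_rename[OF w m(1)]
      from m(3)[unfolded resstep_def] show ?thesis
      proof (elim disjE exE conjE)
        assume *: "\<mu> = \<mu>'" "m \<notin> names_label \<mu>'" "X = cres m Y"
        then show ?thesis unfolding Res
          using tr_alpha[OF al tr_resnon[OF Q'(1)] alpha_refl] w' Q'(2) by (auto simp: cls_Res)
      next
        fix N p assume *: "\<mu>' = Out N p" "\<mu> = Out (insert m N) p" "m \<in> vn p" "m \<notin> N \<union> pn p" "X = Y"
        have "m \<notin> bn p" using st_OutD(4)[OF m(2)[unfolded *(1)] wf] *(3) vn_fn by (auto simp: wf_pat_def)
        then show ?thesis unfolding Res
          using tr_alpha[OF al tr_open[OF Q'(1)[unfolded *(1)]] alpha_refl] * Q'(2) by blast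
      qed
    next
      case (Case p Q)
      from less.prems(1)[unfolded Case] show ?thesis
      proof (rule st_Case_cases)
        fix \<beta> assume *: "\<mu> = Out {} (psub Var \<beta> p)" "X = csubst (updb Var \<beta> (bn p)) (cls Q)"
          "inj_on \<beta> (bn p)" "\<beta> ` bn p \<inter> fn_proc (Case p Q) = {}"
        show ?thesis unfolding Case *(1)
          using tr_alpha[OF alpha_Case_rename[OF _ *(3,4)] tr_case alpha_refl] *(2) less.prems(2) Case
          by (auto simp: csubst_cls simp del: fn_proc.simps)
      qed
    next
      case (Rep Q)
      then have w: "wf_proc Q" using less.prems by auto
      have rep: "\<exists>P'. lts (Rep Q) \<mu> P' \<and> Z = cls P'" if a: "st Q \<mu> X" "Z = cpar X (cls (Rep Q))" for \<mu> X Z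
      proof -
        obtain Q' where Q': "lts Q \<mu> Q'" "X = cls Q'" using less.hyps[OF _ a(1) w] Rep by auto
        then show ?thesis using par[OF Q'(1), of "Rep Q" Z] w a st_bnd[OF a(1) w] by (auto intro: tr_rep)
      qed
      obtain Y where Y: "st (Par Q Q) \<mu> Y" "X = cpar Y (cls (Rep Q))"
        using less.prems(1)[unfolded Rep] by (rule st_RepE)
      from Y(1) show ?thesis
      proof (cases rule: st_Par_cases)
        case (l X1)
        then show ?thesis using rep[OF l(1)] Y(2) w Rep by (simp add: cpar.assoc cls_Rep)
      next
        case (r X1)
        then show ?thesis using rep[OF r(1)] Y(2) w Rep by (simp add: cpar.assoc cls_Rep)
      next
        case (com M p X1 N q X2 \<sigma> \<rho>)
        \<comment> \<open>For two communicating copies \<open>tr_rep\<close> is used twice: one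
          partner is unfolded inside the \<open>Rep Q\<close> of \<open>Par (Rep Q) Q\<close>, the
          other is the exposed \<open>Q\<close>.\<close>
        obtain P1 where P1: "lts (Rep Q) (Out M p) P1" "cpar X1 (cls (Rep Q)) = cls P1" using rep[OF com(3) refl] by blast
        obtain P2 where P2: "lts Q (Out N q) P2" "X2 = cls P2" using less.hyps[OF _ com(4) w] Rep by auto
        have l: "lts (Par (Rep Q) Q) Tau (resS (M \<union> N) (Par (subst \<sigma> P1) (subst \<rho> P2)))"
          by (rule tr_unify[OF P1(1) P2(1) com(5)]) (use com in auto)
        have w': "wf_proc P1" "wf_proc P2" using lts_st[OF P1(1)] lts_st[OF P2(1)] w by auto
        note u = unify_is_subst[OF com(5)]
        have "finite (M \<union> N)" using st_OutD(1)[OF com(3)] st_OutD(1)[OF com(4)] w by simp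
        then have "cls (resS (M \<union> N) (Par (subst \<sigma> P1) (subst \<rho> P2)))
           = cresS (M \<union> N) (cpar (csubst (tot \<sigma>) (cpar X1 (cls (Rep Q)))) (csubst (tot \<rho>) X2))"
          using cls_resS[of "M \<union> N" "Par (subst \<sigma> P1) (subst \<rho> P2)"] w' u P1 P2
          by (simp add: wf_subst cls_Par cls_subst)
        \<comment> \<open>The partners are exchanged because \<open>com_cpar_cls\<close> expects the
          idle process next to the second one.\<close>
        also have "\<dots> = cresS (N \<union> M) (cpar (csubst (tot \<rho>) X2) (csubst (tot \<sigma>) (cpar X1 (cls (Rep Q)))))"
          by (simp add: cpar.commute Un_commute)
        also have "\<dots> = cpar (cresS (N \<union> M) (cpar (csubst (tot \<rho>) X2) (csubst (tot \<sigma>) X1))) (cls (Rep Q))"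
          using com w st_OutD(6)[OF com(3) w] by (intro com_cpar_cls[OF com(4,3) unify_sym[OF com(5)]]) auto
        also have "\<dots> = X" unfolding Y(2) com(2) by (simp add: cpar.commute Un_commute)
        finally show ?thesis using tr_rep[OF l] com(1) Rep by auto
      qed
    qed
  qed
  then show "st P \<mu> X \<Longrightarrow> wf_proc P \<Longrightarrow> \<exists>P'. lts P \<mu> P' \<and> wf_proc P' \<and> X = cls P'"
    using lts_st by blast
qed

section \<open>Silent transitions are reductions\<close>

lemma cls_unify_subst: "unify p q = Some (\<sigma>, \<rho>) \<Longrightarrow> wf_proc P \<Longrightarrow> wf_proc Q \<Longrightarrow>
   cls (Par (subst \<sigma> P) (subst \<rho> Q)) = cpar (csubst (tot \<sigma>) (cls P)) (csubst (tot \<rho>) (cls Q))"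
  using unify_is_subst[of p q \<sigma> \<rho>] by (simp add: cls_Par wf_subst cls_subst)

lemma red_st: "red P Q \<Longrightarrow> wf_proc P \<Longrightarrow> wf_proc Q \<and> st P Tau (cls Q)"
proof (induction rule: red.induct)
  case (red_comm p q \<sigma> \<rho> P Q)
  then have "st (Par (Case p P) (Case q Q)) Tau (cresS ({} \<union> {}) (cpar (csubst (tot \<sigma>) (cls P)) (csubst (tot \<rho>) (cls Q))))"
    by (intro st_com[OF st_Case_same st_Case_same red_comm.hyps]) auto
  then show ?case using red_comm unify_is_subst[OF red_comm.hyps] by (simp add: cls_unify_subst wf_subst)
next
  case (red_par P P' Q)
  then show ?case by (auto simp: cls_Par intro: st_l)
next
  case (red_res P P' n)
  then show ?case by (simp add: cls_Res st_Res_same)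
next
  case (red_struct P P0 Q0 Q)
  then have w: "wf_proc P0" "wf_proc Q0" "wf_proc Q" using scong_wf by blast+
  then have "cls Q0 = cls Q" using red_struct by (simp add: cls_eq)
  then show ?case using red_struct w st_scong sc_sym by metis
qed

text \<open>Shape of a process \<open>Z\<close> behind a visible transition to \<open>X\<close>:
  \<open>N\<close> are the restrictions that the label extrudes, \<open>K\<close> those that it does
  not mention. The former are gone from the target, the latter remain.\<close>

definition decomp :: "name set \<Rightarrow> pat \<Rightarrow> cproc \<Rightarrow> name set \<Rightarrow> proc \<Rightarrow> proc \<Rightarrow> cproc \<Rightarrow> bool" where
  "decomp N p X K P1 P2 Z \<longleftrightarrow> finite K \<and> K \<inter> names_pat p = {} \<and> wf_proc (Case p P1) \<and> wf_proc P2 \<and> bn p \<inter> fn_proc P2 = {}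
    \<and> Z = cresS N (cresS K (cls (Par (Case p P1) P2))) \<and> X = cresS K (cls (Par P1 P2))"

lemma decomp_par:
  assumes "decomp N p X K P1 P2 Z" "finite N" "(N \<union> K \<union> bn p) \<inter> fn_proc R = {}" "wf_proc R"
  shows "decomp N p (cpar X (cls R)) K P1 (Par P2 R) (cpar Z (cls R))"
  using assms unfolding decomp_def by (auto simp: cls_Par cresS_cpar cfn_cls Int_Un_distrib Int_Un_distrib2 cpar.assoc)

text \<open>The set \<open>A\<close> is arbitrary so that in the inductive step \<open>K\<close> can
  be kept off the parallel component over which its scope is extended.\<close>

lemma st_Out_decomp:
  assumes "st P (Out N p) X" "wf_proc P" "finite A"
  shows "\<exists>K P1 P2. K \<inter> A = {} \<and> decomp N p X K P1 P2 (cls P)"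
  using assms
proof (induction "size P" arbitrary: P N X A rule: less_induct)
  case less
  show ?case
  proof (cases P)
    case Nil
    then show ?thesis using less.prems by (auto elim: st_NilE)
  next
    case (Par P1 P2)
    then have w: "wf_proc P1" "wf_proc P2" using less.prems by auto
    from less.prems(1)[unfolded Par] show ?thesis
    proof (cases rule: st_Par_cases)
      case (l Y)
      have "\<exists>K Q1 Q2. K \<inter> (A \<union> fn_proc P2) = {} \<and> decomp N p Y K Q1 Q2 (cls P1)"
        using less.hyps[OF _ l(1) w(1)] Par less.prems(3) by auto
      then obtain K Q1 Q2 where K: "K \<inter> (A \<union> fn_proc P2) = {}" "decomp N p Y K Q1 Q2 (cls P1)" by blast
      then have "decomp N p X K Q1 (Par Q2 P2) (cls P)"
        using decomp_par[OF K(2) st_OutD(1)[OF l(1) w(1)], of P2] l w Par by (auto simp: cls_Par)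
      then show ?thesis using K(1) by blast
    next
      case (r Y)
      have "\<exists>K Q1 Q2. K \<inter> (A \<union> fn_proc P1) = {} \<and> decomp N p Y K Q1 Q2 (cls P2)"
        using less.hyps[OF _ r(1) w(2)] Par less.prems(3) by auto
      then obtain K Q1 Q2 where K: "K \<inter> (A \<union> fn_proc P1) = {}" "decomp N p Y K Q1 Q2 (cls P2)" by blast
      then have "decomp N p X K Q1 (Par Q2 P1) (cls P)"
        using decomp_par[OF K(2) st_OutD(1)[OF r(1) w(2)], of P1] r w Par by (auto simp: cls_Par cpar.commute)
      then show ?thesis using K(1) by blast
    qed simp
  next
    case (Res n Q)
    then have w: "wf_proc Q" using less.prems by auto
    obtain m \<mu>' Y where m: "m \<notin> fn_proc (Res n Q)" "st (esub (Var(n := Var m)) Q) \<mu>' Y" "resstep m \<mu>' Y (Out N p) X"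
      "m \<in> bnd (Out N p) \<or> m \<notin> A"
      using st_Res_freshE[OF less.prems(1)[unfolded Res] w less.prems(3)] by blast
    have wf: "wf_proc (esub (Var(n := Var m)) Q)" using w by (simp add: wf_esub)
    have c: "cls P = cres m (cls (esub (Var(n := Var m)) Q))" unfolding Res by (rule cls_Res_rename[OF w m(1)])
    have wP: "wf_proc P" by (rule less.prems(2))
    have finN: "finite N" using st_OutD(1)[OF less.prems(1,2)] .
    from m(3) show ?thesis
    proof (cases rule: resstep_OutE)
      case non
      obtain K Q1 Q2 where K: "K \<inter> A = {}" "decomp N p Y K Q1 Q2 (cls (esub (Var(n := Var m)) Q))"
        using less.hyps[OF _ m(2)[unfolded non(1)] wf less.prems(3)] Res by auto
      have "m \<notin> A" using m(4) non(2) by (auto simp: names_pat_def)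
      moreover have "decomp N p X (insert m K) Q1 Q2 (cls P)"
        using K(2) non(2,3) finN unfolding c decomp_def by (simp add: cresS_insert cres_cresS)
      ultimately show ?thesis using K(1) by (intro exI[of _ "insert m K"]) auto
    next
      case (opn M)
      obtain K Q1 Q2 where K: "K \<inter> A = {}" "decomp M p Y K Q1 Q2 (cls (esub (Var(n := Var m)) Q))"
        using less.hyps[OF _ m(2)[unfolded opn(1)] wf less.prems(3)] Res by auto
      have "decomp N p X K Q1 Q2 (cls P)"
        using K(2) opn finN unfolding c decomp_def by (simp add: cresS_insert)
      then show ?thesis using K(1) by blast
    qed
  next
    case (Case q Q)
    from less.prems(1)[unfolded Case] show ?thesis
    proof (rule st_Case_cases)
      fix \<beta> assume *: "Out N p = Out {} (psub Var \<beta> q)" "X = csubst (updb Var \<beta> (bn q)) (cls Q)"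
        "inj_on \<beta> (bn q)" "\<beta> ` bn q \<inter> fn_proc (Case q Q) = {}"
      have w: "wf_proc (Case q Q)" using less.prems Case by simp
      note al = alpha_Case_rename[OF w *(3,4)]
      have "decomp N p X {} (esub (updb Var \<beta> (bn q)) Q) Nil (cls P)"
        using * w wf_Case_rename[of Var q Q \<beta>] cls_alpha[OF al w] unfolding decomp_def Case
        by (auto simp: cls_Par cls_Nil csubst_cls wf_esub simp del: fn_proc.simps(2-))
      then show ?thesis by blast
    qed
  next
    case (Rep Q)
    then have w: "wf_proc Q" using less.prems by auto
    obtain Y where Y: "st Q (Out N p) Y" "X = cpar Y (cls (Rep Q))"
      using st_Rep_OutD[OF less.prems(1)[unfolded Rep] w] .
    have "\<exists>K Q1 Q2. K \<inter> (A \<union> fn_proc Q) = {} \<and> decomp N p Y K Q1 Q2 (cls Q)"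
      using less.hyps[OF _ Y(1) w] Rep less.prems(3) by auto
    then obtain K Q1 Q2 where K: "K \<inter> (A \<union> fn_proc Q) = {}" "decomp N p Y K Q1 Q2 (cls Q)" by blast
    note q = st_OutD[OF Y(1) w]
    have "decomp N p X K Q1 (Par Q2 (Rep Q)) (cpar (cls Q) (cls (Rep Q)))"
      unfolding Y(2) using K q w by (intro decomp_par) auto
    then show ?thesis using K(1) Rep cls_Rep[OF w] by auto
  qed
qed

lemma red_resS: "red P Q \<Longrightarrow> red (resS N P) (resS N Q)"
proof -
  have "red P Q \<Longrightarrow> red (resl xs P) (resl xs Q)" for xs
    by (induction xs) (auto simp: resl_def intro: red_res)
  then show "red P Q \<Longrightarrow> red (resS N P) (resS N Q)" by (simp add: resS_def)
qed

text \<open>Both partners are put into the shape \<open>decomp\<close> and all restrictions are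
  pulled to the front, so that the two prefixes stand side by side for \<open>red_comm\<close>.
  \<open>K\<close> is chosen off \<open>Q\<close> and \<open>N\<close>, then \<open>L\<close> off
  \<open>P\<close>, \<open>M\<close> and \<open>K\<close>, as the extension of scopes requires. The
  matching substitutions leave the residual components and the restricted names alone, so the target
  classes agree.\<close>

lemma st_com_red:
  assumes "st P (Out M p) X" "st Q (Out N q) Y" "unify p q = Some (\<sigma>, \<rho>)"
    "M \<inter> fn_proc Q = {}" "N \<inter> fn_proc P = {}" "M \<inter> N = {}" "wf_proc P" "wf_proc Q"
  shows "\<exists>W. red (Par P Q) W \<and> wf_proc W \<and> cls W = cresS (M \<union> N) (cpar (csubst (tot \<sigma>) X) (csubst (tot \<rho>) Y))"
proof -
  note p = st_OutD[OF assms(1,7)] and q = st_OutD[OF assms(2,8)]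
  note u = unify_is_subst[OF assms(3)] unify_dom[OF assms(3)] unify_fn_subst[OF assms(3)]
  have "finite (fn_proc Q \<union> N)" using q(1) by simp
  from st_Out_decomp[OF assms(1,7) this] obtain K P1 P2 where
    K: "K \<inter> (fn_proc Q \<union> N) = {}" "decomp M p X K P1 P2 (cls P)"
    by (elim exE conjE)
  have finK: "finite K" using K(2) by (simp add: decomp_def)
  then have "finite (fn_proc P \<union> M \<union> K)" using p(1) by simp
  from st_Out_decomp[OF assms(2,8) this] obtain L Q1 Q2 where
    L: "L \<inter> (fn_proc P \<union> M \<union> K) = {}" "decomp N q Y L Q1 Q2 (cls Q)"
    by (elim exE conjE)
  note K' = K(2)[unfolded decomp_def] and L' = L(2)[unfolded decomp_def]
  have finL: "finite L" using L' by simp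
  have w: "wf_proc P1" "wf_proc P2" "wf_proc Q1" "wf_proc Q2" "wf_pat p" "wf_pat q" using K' L' by auto
  define CP where "CP = cls (Par (Case p P1) P2)"
  define CQ where "CQ = cls (Par (Case q Q1) Q2)"
  have cP: "cls P = cresS M (cresS K CP)" "cls Q = cresS N (cresS L CQ)" using K' L' by (auto simp: CP_def CQ_def)
  have "cfn (cls P) = cfn CP - K - M" using cP p(1) finK by simp
  then have fCP: "cfn CP \<subseteq> fn_proc P \<union> M \<union> K" using assms(7) by (auto simp: cfn_cls)
  define A where "A = M \<union> K \<union> (N \<union> L)"
  have finA: "finite A" using p(1) q(1) finK finL by (simp add: A_def)
  have A: "cresS A Z = cresS M (cresS K (cresS N (cresS L Z)))" for Z
    using p(1) q(1) finK finL by (simp add: A_def cresS_Un)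
  define W where "W = Par (Par (Case p P1) (Case q Q1)) (Par P2 Q2)"
  define W' where "W' = Par (Par (subst \<sigma> P1) (subst \<rho> Q1)) (Par P2 Q2)"
  have wW: "wf_proc W" "wf_proc W'" using w u by (auto simp: W_def W'_def wf_subst)
  have "cls (Par P Q) = cpar (cls P) (cls Q)" using assms by (simp add: cls_Par)
  also have "\<dots> = cresS M (cresS K (cpar CP (cls Q)))"
    unfolding cP(1) using p(1) finK assms(4,8) K(1) by (simp add: cresS_cpar cfn_cls Int_Un_distrib)
  also have "\<dots> = cresS M (cresS K (cresS N (cresS L (cpar CP CQ))))"
  proof -
    have "N \<inter> cfn CP = {}" "L \<inter> cfn CP = {}" using fCP K(1) L(1) assms(5,6) by auto
    then show ?thesis unfolding cP(2) using q(1) finL by (simp add: cpar_cresS)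
  qed
  also have "\<dots> = cls (resS A W)"
    using cls_resS[OF finA wW(1)] w unfolding A by (simp add: W_def CP_def CQ_def cls_Par cpar_ac)
  finally have sc: "scong (Par P Q) (resS A W)"
    using cls_eq[of "Par P Q" "resS A W"] cls_resS[OF finA wW(1)] assms by simp
  have "red (resS A W) (resS A W')"
    unfolding W_def W'_def by (intro red_resS red_par red_comm assms(3))
  then have "red (Par P Q) (resS A W')" using sc red_struct sc_refl by blast
  moreover have "cls (resS A W') = cresS (M \<union> N) (cpar (csubst (tot \<sigma>) X) (csubst (tot \<rho>) Y))"
  proof -
    define A1 where "A1 = csubst (tot \<sigma>) (cls (Par P1 P2))"
    define A2 where "A2 = csubst (tot \<rho>) (cls (Par Q1 Q2))"
    have X: "X = cresS K (cls (Par P1 P2))" and Y: "Y = cresS L (cls (Par Q1 Q2))" using K' L' by auto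
    have fX: "cfn (cls (Par P1 P2)) \<subseteq> fn_proc P \<union> M \<union> bn p \<union> K" using p(9) finK unfolding X by auto
    have fY: "cfn (cls (Par Q1 Q2)) \<subseteq> fn_proc Q \<union> N \<union> bn q \<union> L" using q(9) finL unfolding Y by auto
    have 1: "csubst (tot \<sigma>) X = cresS K A1" unfolding X A1_def
    proof (rule csubst_cresS[OF finK csub_tot])
      show "K \<inter> fimg (tot \<sigma>) (cfn (cls (Par P1 P2)) - K) = {}"
        using fimg_tot[of \<sigma> "cfn (cls (Par P1 P2)) - K"] u q(7) K(1) by blast
      show "tot \<sigma> x = Var x" if "x \<in> K" for x
        using that K' u by (intro tot_notin) (auto simp: names_pat_def)
    qed (use u in simp)
    have 2: "csubst (tot \<rho>) Y = cresS L A2" unfolding Y A2_def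
    proof (rule csubst_cresS[OF finL csub_tot])
      show "L \<inter> fimg (tot \<rho>) (cfn (cls (Par Q1 Q2)) - L) = {}"
        using fimg_tot[of \<rho> "cfn (cls (Par Q1 Q2)) - L"] u p(7) L(1) by blast
      show "tot \<rho> x = Var x" if "x \<in> L" for x
        using that L' u by (intro tot_notin) (auto simp: names_pat_def)
    qed (use u in simp)
    have "cfn A1 \<subseteq> fn_pat q \<union> fn_proc P \<union> M \<union> K"
      using fimg_tot[of \<sigma> "cfn (cls (Par P1 P2))"] fX u by (auto simp: A1_def cfn_csubst csub_tot)
    then have LA: "L \<inter> cfn A1 = {}" using L(1) L' by (auto simp: names_pat_def)
    have "cfn A2 - L \<subseteq> fn_pat p \<union> fn_proc Q \<union> N"
      using fimg_tot[of \<rho> "cfn (cls (Par Q1 Q2))"] fY u by (auto simp: A2_def cfn_csubst csub_tot)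
    then have KA: "K \<inter> cfn (cresS L A2) = {}" using K(1) K' finL by (auto simp: names_pat_def)
    have 3: "cpar (cresS K A1) (cresS L A2) = cresS K (cresS L (cpar A1 A2))"
      using KA LA finK finL by (simp add: cresS_cpar cpar_cresS)
    have 4: "cls W' = cpar A1 A2"
    proof -
      have "csubst (tot \<sigma>) (cls P2) = cls P2" "csubst (tot \<rho>) (cls Q2) = cls Q2"
        using u w K' L' by (auto intro!: csubst_tot_cls)
      then show ?thesis using w u by (simp add: A1_def A2_def W'_def cls_Par wf_subst cls_subst csubst_cpar csub_tot cpar_ac)
    qed
    have "A = (M \<union> N) \<union> (K \<union> L)" by (auto simp: A_def)
    then show ?thesis using cls_resS[OF finA wW(2)] p(1) q(1) finK finL unfolding 1 2 3 4
      by (simp add: cresS_Un)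
  qed
  ultimately show ?thesis using cls_resS[OF finA wW(2)] by blast
qed

lemma st_red:
  assumes "st P Tau X" "wf_proc P"
  shows "\<exists>P'. red P P' \<and> wf_proc P' \<and> X = cls P'"
  using assms
proof (induction "size P" arbitrary: P X rule: less_induct)
  case less
  show ?case
  proof (cases P)
    case Nil
    then show ?thesis using less.prems by (auto elim: st_NilE)
  next
    case (Par P1 P2)
    then have w: "wf_proc P1" "wf_proc P2" using less.prems by auto
    from less.prems(1)[unfolded Par] show ?thesis
    proof (cases rule: st_Par_cases)
      case (l Y)
      obtain P' where "red P1 P'" "wf_proc P'" "Y = cls P'" using less.hyps[OF _ l(1) w(1)] Par by auto
      then show ?thesis using l(3) w Par by (intro exI[of _ "Par P' P2"]) (auto simp: cls_Par red_par)
    next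
      case (r Y)
      obtain P' where P': "red P2 P'" "wf_proc P'" "Y = cls P'" using less.hyps[OF _ r(1) w(2)] Par by auto
      have "red (Par P1 P2) (Par P' P1)" using red_struct[OF sc_par_comm red_par[OF P'(1)] sc_refl] .
      then show ?thesis using r(3) w P' Par by (intro exI[of _ "Par P' P1"]) (auto simp: cls_Par)
    next
      case (com M p X N q Y \<sigma> \<rho>)
      then show ?thesis using st_com_red[OF com(3-8) w] Par by auto
    qed
  next
    case (Res n Q)
    then have w: "wf_proc Q" using less.prems by auto
    obtain m \<mu>' Y where m: "m \<notin> fn_proc (Res n Q)" "st (esub (Var(n := Var m)) Q) \<mu>' Y" "resstep m \<mu>' Y Tau X"
      using less.prems(1) unfolding Res st_Res_iff by blast
    have *: "\<mu>' = Tau" "X = cres m Y" using m(3) by (auto simp: resstep_def)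
    have wf: "wf_proc (esub (Var(n := Var m)) Q)" using w by (simp add: wf_esub)
    obtain Q' where Q': "red (esub (Var(n := Var m)) Q) Q'" "wf_proc Q'" "Y = cls Q'"
      using less.hyps[OF _ m(2)[unfolded *(1)] wf] Res by auto
    have "red P (Res m Q')" unfolding Res
      by (rule red_struct[OF sc_alpha[OF alpha_Res_rename[OF w m(1)]] red_res[OF Q'(1)] sc_refl])
    then show ?thesis using Q' *(2) by (intro exI[of _ "Res m Q'"]) (auto simp: cls_Res)
  next
    case (Case p Q)
    then show ?thesis using less.prems by (auto elim: st_CaseE)
  next
    case (Rep Q)
    then have w: "wf_proc Q" using less.prems by auto
    have rep: "\<exists>P'. red (Rep Q) P' \<and> wf_proc P' \<and> Z = cls P'" if a: "st Q Tau X" "Z = cpar X (cls (Rep Q))" for X Z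
    proof -
      obtain Q' where Q': "red Q Q'" "wf_proc Q'" "X = cls Q'" using less.hyps[OF _ a(1) w] Rep by auto
      have "red (Rep Q) (Par Q' (Rep Q))" by (rule red_struct[OF sc_rep_unfold red_par[OF Q'(1)] sc_refl])
      then show ?thesis using a(2) Q' w by (intro exI[of _ "Par Q' (Rep Q)"]) (auto simp: cls_Par)
    qed
    obtain Y where Y: "st (Par Q Q) Tau Y" "X = cpar Y (cls (Rep Q))"
      using less.prems(1)[unfolded Rep] by (rule st_RepE)
    from Y(1) show ?thesis
    proof (cases rule: st_Par_cases)
      case (l X1)
      then show ?thesis using rep[OF l(1)] Y(2) w Rep by (simp add: cpar.assoc cls_Rep)
    next
      case (r X1)
      then show ?thesis using rep[OF r(1)] Y(2) w Rep by (simp add: cpar.assoc cls_Rep)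
    next
      case (com M p X1 N q X2 \<sigma> \<rho>)
      obtain W where W: "red (Par Q Q) W" "wf_proc W" "cls W = Y" using st_com_red[OF com(3-8) w w] com(2) by auto
      \<comment> \<open>Two copies are unfolded at once, since both partners of the communication
        come from the replication.\<close>
      have "cls (Rep Q) = cls (Par (Par Q Q) (Rep Q))" using w by (simp add: cls_Par cpar.assoc cls_Rep)
      then have "scong (Rep Q) (Par (Par Q Q) (Rep Q))" using w by (simp add: cls_eq)
      then have "red (Rep Q) (Par W (Rep Q))" by (rule red_struct[OF _ red_par[OF W(1)] sc_refl])
      then show ?thesis using W Y(2) w Rep by (intro exI[of _ "Par W (Rep Q)"]) (auto simp: cls_Par)
    qed
  qed
qed

section \<open>Barbs are visible transitions\<close>

lemma st_resl:
  assumes "st W (Out N p) X" "wf_proc W" "pn p \<inter> set ns = {}"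
  shows "\<exists>N' p' X'. st (resl ns W) (Out N' p') X' \<and> fn_pat p' - N' = fn_pat p - N - set ns \<and> pn p' = pn p \<and> wf_proc (resl ns W)"
  using assms(3)
proof (induction ns)
  case Nil
  then show ?case using assms by (auto simp: resl_def)
next
  case (Cons n ns)
  then obtain N' p' X' where *: "st (resl ns W) (Out N' p') X'" "fn_pat p' - N' = fn_pat p - N - set ns"
    "pn p' = pn p" "wf_proc (resl ns W)" by auto
  have e: "resl (n # ns) W = Res n (resl ns W)" by (simp add: resl_def)
  have n: "n \<notin> pn p'" using Cons.prems *(3) by auto
  note d = st_OutD[OF *(1,4)]
  \<comment> \<open>An already extruded \<open>n\<close> is not free, so its restriction is vacuous;
    an unprotected \<open>n\<close> is extruded; an \<open>n\<close> outside the free names of the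
    pattern is restricted in place once the binders have been moved off it. Protected occurrences
    are excluded by the condition on barbs.\<close>
  consider "n \<in> N'" | "n \<notin> N'" "n \<in> vn p'" | "n \<notin> N'" "n \<notin> fn_pat p'" using n by (auto simp: fn_pat_def)
  then show ?case
  proof cases
    case 1
    then have "n \<notin> fn_proc (resl ns W)" using d(5) by auto
    then have "st (Res n (resl ns W)) (Out N' p') X'"
      using st_scong[OF *(1) sc_sym[OF scong_Res_fresh] *(4)] by blast
    moreover have "fn_pat p' - N' = fn_pat p - N - set (n # ns)" using *(2) 1 by auto
    ultimately show ?thesis using * unfolding e by auto
  next
    case 2
    then have "st (Res n (resl ns W)) (Out (insert n N') p') X'" using n * by (intro st_open_same) auto
    moreover have "fn_pat p' - insert n N' = fn_pat p - N - set (n # ns)" using *(2) by auto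
    ultimately show ?thesis using *(3,4) unfolding e
      by (intro exI[of _ "insert n N'"] exI[of _ p'] exI[of _ X']) auto
  next
    case 3
    obtain \<pi> where \<pi>: "\<pi> ` bn p' \<inter> {n} = {}" "st (resl ns W) (Out N' (psub Var \<pi> p')) (csubst (Var \<circ> \<pi>) X')"
      using st_bn_fresh[OF *(1,4) finite.insertI[OF finite.emptyI]] by metis
    have "st (Res n (resl ns W)) (Out N' (psub Var \<pi> p')) (cres n (csubst (Var \<circ> \<pi>) X'))"
      using \<pi> 3 *(4) by (intro st_Res_same) (auto simp: names_pat_def bn_psub)
    moreover have "fn_pat p' - N' = fn_pat p - N - set (n # ns)" using *(2) 3 by auto
    ultimately show ?thesis using *(3,4) unfolding e
      by (intro exI[of _ N'] exI[of _ "psub Var \<pi> p'"] exI[of _ "cres n (csubst (Var \<circ> \<pi>) X')"]) auto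
  qed
qed

lemma barb_iff:
  assumes "wf_proc P"
  shows "barb P M \<longleftrightarrow> (\<exists>N p X. st P (Out N p) X \<and> M = fn_pat p - N)"
proof
  assume "barb P M"
  then obtain ns p P' P'' where *: "scong P (resl ns (Par (Case p P') P''))" "pn p \<inter> set ns = {}" "M = fn_pat p - set ns"
    unfolding barb_def by blast
  have wf: "wf_proc (resl ns (Par (Case p P') P''))" using *(1) assms scong_wf by blast
  moreover have "wf_proc (resl ns R) \<longleftrightarrow> wf_proc R" for R by (induction ns) (auto simp: resl_def)
  ultimately have w: "wf_proc (Case p P')" "wf_proc P''" by auto
  \<comment> \<open>Binders of \<open>p\<close> may occur free in \<open>P''\<close>, and
    \<open>st_l\<close> applies only after they have been renamed.\<close>
  obtain \<pi> where \<pi>: "bij \<pi>" "\<pi> ` bn p \<inter> fn_proc P'' = {}"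
    "st (Case p P') (Out {} (psub Var \<pi> p)) (csubst (Var \<circ> \<pi>) (cls P'))"
    "\<And>x. x \<in> fn_proc (Case p P') \<union> {} \<Longrightarrow> \<pi> x = x"
    by (rule st_bn_fresh[OF st_Case_same[OF w(1)] w(1) finite_fn_proc[of P'']]) (rule that)
  have "st (Par (Case p P') P'') (Out {} (psub Var \<pi> p)) (cpar (csubst (Var \<circ> \<pi>) (cls P')) (cls P''))"
    using \<pi>(2,3) by (intro st_l) (auto simp: bn_psub)
  from st_resl[OF this, of ns] obtain N' p' X' where
    "st (resl ns (Par (Case p P') P'')) (Out N' p') X'" "fn_pat p' - N' = fn_pat p - set ns"
    using * w by auto
  then show "\<exists>N p X. st P (Out N p) X \<and> M = fn_pat p - N"
    using st_scong[OF _ sc_sym[OF *(1)] wf] *(3) by blast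
next
  assume "\<exists>N p X. st P (Out N p) X \<and> M = fn_pat p - N"
  then obtain N p X where *: "st P (Out N p) X" "M = fn_pat p - N" by blast
  note d = st_OutD[OF *(1) assms]
  from st_Out_decomp[OF *(1) assms finite.emptyI] obtain K P1 P2 where K: "decomp N p X K P1 P2 (cls P)"
    by (elim exE conjE)
  note K' = K[unfolded decomp_def]
  have fin: "finite (N \<union> K)" using d(1) K' by simp
  have w: "wf_proc (Par (Case p P1) P2)" using K' by simp
  have "cls P = cls (resS (N \<union> K) (Par (Case p P1) P2))" "wf_proc (resS (N \<union> K) (Par (Case p P1) P2))"
    using cls_resS[OF fin w] K' d(1) by (auto simp: cresS_Un)
  then have "scong P (resS (N \<union> K) (Par (Case p P1) P2))" using assms by (simp add: cls_eq)
  moreover have "pn p \<inter> (N \<union> K) = {}" "M = fn_pat p - (N \<union> K)"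
    using K' d(3) *(2) pn_fn[of p] by (auto simp: names_pat_def)
  ultimately show "barb P M" unfolding barb_def resS_def using fin by (metis set_sorted_list_of_set)
qed

subsection \<open>The congruence closure of a bisimulation\<close>

text \<open>The answering pattern may drop protection from some names but never adds any. Hence
  barbs are kept, and a name that can be extruded with \<open>p\<close> can also be extruded with
  \<open>q\<close>.\<close>

lemma compat_names: "compat p \<sigma> q \<rho> \<Longrightarrow>
    fn_pat q = fn_pat p \<and> vn p \<subseteq> vn q \<and> pn q \<subseteq> pn p \<and> dom \<sigma> = bn p \<and> dom \<rho> = bn q"
proof (induction rule: compat.induct)
  case (cp_bind p \<sigma> y)
  then show ?case by (auto simp: fn_pat_def)
qed auto

lemma fn_hsubst: "fn_pat (hsubst \<sigma> p) \<subseteq> fn_pat p \<union> fn_subst \<sigma>"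
  by (induction p) (auto simp: fn_subst_def ran_def split: option.splits)

lemma wf_pat_Comp: "wf_pat (Comp p q) \<Longrightarrow> wf_pat p \<and> wf_pat q \<and> bn p \<inter> bn q = {}"
  by (auto simp: wf_pat_def bn_def)

lemma fn_subst_add_disjoint: "dom \<sigma> \<inter> dom \<tau> = {} \<Longrightarrow> fn_subst (\<sigma> ++ \<tau>) = fn_subst \<sigma> \<union> fn_subst \<tau>"
  by (simp add: fn_subst_def ran_map_add)

text \<open>Well-formedness makes the two parts of \<sigma> disjoint, so no value of the first part
  is hidden by the second and the inclusions for the parts can be joined. A restricted name absent
  from the values of \<sigma> is then absent from those of \<rho>.\<close>

lemma compat_fn_subst: "compat p \<sigma> q \<rho> \<Longrightarrow> wf_pat p \<Longrightarrow> fn_subst \<rho> \<subseteq> fn_subst \<sigma>"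
proof (induction rule: compat.induct)
  case (cp_bind p \<sigma> y)
  then show ?case using fn_hsubst[of \<sigma> p] by simp
next
  case (cp_comp p1 \<sigma>1 q1 \<rho>1 p2 \<sigma>2 q2 \<rho>2)
  have "dom \<sigma>1 \<inter> dom \<sigma>2 = {}"
    using compat_names[OF cp_comp.hyps(1)] compat_names[OF cp_comp.hyps(2)] wf_pat_Comp[OF cp_comp.prems] by simp
  then show ?case using cp_comp wf_pat_Comp[OF cp_comp.prems] fn_subst_add[of \<rho>1 \<rho>2]
    by (auto simp: fn_subst_add_disjoint)
qed auto

lemma hsubst_cong: "(\<And>x. x \<in> bn p \<Longrightarrow> \<sigma> x = \<tau> x) \<Longrightarrow> hsubst \<sigma> p = hsubst \<tau> p"
  by (induction p) auto

lemma bn_fn_nonempty: "bn p \<union> fn_pat p \<noteq> {}"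
  by (induction p) auto

text \<open>A pattern without free names has binding names at all its leaves, so every leaf captures
  the corresponding part of \<open>r\<close>, and \<open>hsubst \<sigma> p\<close> puts the parts
  together again.\<close>

lemma unifies_closed: "unifies p r \<sigma> \<theta> \<Longrightarrow> fn_pat p = {} \<Longrightarrow> wf_pat p \<Longrightarrow>
    communicable r \<and> \<theta> = Map.empty \<and> hsubst \<sigma> p = r"
proof (induction rule: unifies.induct)
  case (unifies_right p x)
  then show ?case using bn_fn_nonempty[of p] communicable_bn[of p] by simp
next
  case (unifies_comp p1 q1 \<sigma>1 \<rho>1 p2 q2 \<sigma>2 \<rho>2)
  note w = wf_pat_Comp[OF unifies_comp.prems(2)]
  have d: "dom \<sigma>1 = bn p1" "dom \<sigma>2 = bn p2" using unifies_comp.hyps unify_dom unify_iff by blast+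
  have "hsubst (\<sigma>1 ++ \<sigma>2) p1 = hsubst \<sigma>1 p1"
    by (rule hsubst_cong) (use d w in \<open>blast intro: map_add_dom_app_simps(3)\<close>)
  moreover have "hsubst (\<sigma>1 ++ \<sigma>2) p2 = hsubst \<sigma>2 p2"
    by (rule hsubst_cong) (use d w in \<open>auto simp: map_add_dom_app_simps\<close>)
  ultimately show ?case using unifies_comp w by auto
qed (auto simp: fun_upd_apply)

lemma compat_communicable: "compat p \<sigma> q \<rho> \<Longrightarrow> communicable p \<Longrightarrow> q = p \<and> \<sigma> = Map.empty \<and> \<rho> = Map.empty"
proof (induction rule: compat.induct)
  case (cp_bind p \<sigma> y)
  then show ?case using bn_fn_nonempty[of p] communicable_bn[of p] by simp
qed auto

lemma map_add_inj:
  assumes "\<sigma>1 ++ \<sigma>2 = \<tau>1 ++ \<tau>2" "dom \<sigma>1 = dom \<tau>1" "dom \<sigma>2 = dom \<tau>2" "dom \<sigma>1 \<inter> dom \<sigma>2 = {}"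
  shows "\<sigma>1 = \<tau>1" "\<sigma>2 = \<tau>2"
proof -
  have e: "(\<sigma>1 ++ \<sigma>2) x = (\<tau>1 ++ \<tau>2) x" for x using assms(1) by simp
  show "\<sigma>2 = \<tau>2"
  proof
    fix x show "\<sigma>2 x = \<tau>2 x"
    proof (cases "x \<in> dom \<sigma>2")
      case True
      then show ?thesis using e[of x] assms(3) by (simp add: map_add_dom_app_simps)
    next
      case False
      then show ?thesis using assms(3) by (metis domIff)
    qed
  qed
  show "\<sigma>1 = \<tau>1"
  proof
    fix x show "\<sigma>1 x = \<tau>1 x"
    proof (cases "x \<in> dom \<sigma>1")
      case True
      then have "x \<notin> dom \<sigma>2" using assms(4) by blast
      then show ?thesis using e[of x] assms(3) by (simp add: map_add_dom_app_simps)
    next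
      case False
      then show ?thesis using assms(2) by (metis domIff)
    qed
  qed
qed

inductive_cases unifies_ProtE: "unifies (Prot n) r \<sigma> \<theta>"
inductive_cases unifies_CompE: "unifies (Comp p1 p2) r \<sigma> \<theta>"

text \<open>In the binding case \<open>Bind y\<close> captures in one piece what \<open>p\<close>
  captured in parts. In the compound case \<open>r\<close> may be a binding name that captures
  \<open>p\<close> as a whole; then \<open>p\<close> is communicable and compatibility leaves it
  unchanged. Since \<theta> is the same for \<open>q\<close>, the partner does not notice that the
  pattern has been replaced.\<close>

lemma compat_unifies: "compat p \<sigma> q \<rho> \<Longrightarrow> unifies p r \<sigma> \<theta> \<Longrightarrow> wf_pat p \<Longrightarrow> unifies q r \<rho> \<theta>"
proof (induction arbitrary: r \<theta> rule: compat.induct)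
  case (cp_bind p \<sigma> y)
  have *: "communicable r" "\<theta> = Map.empty" "hsubst \<sigma> p = r"
    using unifies_closed[OF cp_bind.prems(1) cp_bind.hyps(1) cp_bind.prems(2)] by auto
  show ?case unfolding *(2,3) by (rule unifies_left[OF *(1)])
next
  case (cp_prot_var n)
  from cp_prot_var.prems(1) show ?case by (rule unifies_ProtE) (auto intro: unifies_name)
next
  case (cp_comp p1 \<sigma>1 q1 \<rho>1 p2 \<sigma>2 q2 \<rho>2)
  note w = wf_pat_Comp[OF cp_comp.prems(2)]
  note d = compat_names[OF cp_comp.hyps(1)] compat_names[OF cp_comp.hyps(2)]
  have "(\<exists>r1 r2 \<sigma>1' \<sigma>2' \<theta>1 \<theta>2. r = Comp r1 r2 \<and> \<sigma>1 ++ \<sigma>2 = \<sigma>1' ++ \<sigma>2' \<and> \<theta> = \<theta>1 ++ \<theta>2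
      \<and> unifies p1 r1 \<sigma>1' \<theta>1 \<and> unifies p2 r2 \<sigma>2' \<theta>2)
    \<or> (\<exists>x. r = Bind x \<and> communicable (Comp p1 p2) \<and> \<theta> = [x \<mapsto> Comp p1 p2])"
    using cp_comp.prems(1) by (rule unifies_CompE) auto
  then show ?case
  proof (elim disjE exE conjE)
    fix r1 r2 \<sigma>1' \<sigma>2' \<theta>1 \<theta>2
    assume *: "r = Comp r1 r2" "\<sigma>1 ++ \<sigma>2 = \<sigma>1' ++ \<sigma>2'" "\<theta> = \<theta>1 ++ \<theta>2" "unifies p1 r1 \<sigma>1' \<theta>1" "unifies p2 r2 \<sigma>2' \<theta>2"
    have d': "dom \<sigma>1' = bn p1" "dom \<sigma>2' = bn p2" using *(4,5) unify_dom unify_iff by blast+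
    \<comment> \<open>Compatibility and unification each come with a splitting of the same map;
      equal and disjoint domains force the parts to coincide.\<close>
    have "\<sigma>1 = \<sigma>1'" "\<sigma>2 = \<sigma>2'" using map_add_inj[OF *(2)] d d' w by auto
    then show ?thesis unfolding *(1,3) using * cp_comp.IH w by (intro unifies_comp) auto
  next
    fix x assume *: "r = Bind x" "communicable (Comp p1 p2)" "\<theta> = [x \<mapsto> Comp p1 p2]"
    have "q1 = p1" "\<rho>1 = Map.empty" "q2 = p2" "\<rho>2 = Map.empty"
      using compat_communicable[OF cp_comp.hyps(1)] compat_communicable[OF cp_comp.hyps(2)] *(2) by auto
    then show ?thesis using unifies_right[OF *(2), of x] *(1,3) by simp
  qed
qed auto

lemma compat_unify: "compat p \<sigma> q \<rho> \<Longrightarrow> unify p r = Some (\<sigma>, \<theta>) \<Longrightarrow> wf_pat p \<Longrightarrow> unify q r = Some (\<rho>, \<theta>)"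
  unfolding unify_iff by (rule compat_unifies)

text \<open>This lets a prefix answer with its own pattern and match. For a compound the match is
  split by restriction to the binders of the two halves.\<close>

lemma compat_refl: "wf_pat p \<Longrightarrow> dom \<sigma> = bn p \<Longrightarrow> compat p \<sigma> p \<sigma>"
proof (induction p arbitrary: \<sigma>)
  case (Bind x)
  then have "x \<in> dom \<sigma>" by simp
  then obtain r where r: "\<sigma> x = Some r" by blast
  have "\<sigma> z = None" if "z \<noteq> x" for z using Bind.prems(2) that by (metis bn_simps(1) domIff singletonD)
  then have "[x \<mapsto> hsubst \<sigma> (Bind x)] = \<sigma>" using r by (auto simp: fun_eq_iff fun_upd_apply)
  then show ?case using cp_bind[of "Bind x" \<sigma> x] Bind by simp
next
  case (Comp p q)
  note w = wf_pat_Comp[OF Comp.prems(1)]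
  have "(\<sigma> |` bn p) ++ (\<sigma> |` bn q) = \<sigma>"
  proof
    fix x show "((\<sigma> |` bn p) ++ (\<sigma> |` bn q)) x = \<sigma> x"
    proof (cases "x \<in> bn p \<union> bn q")
      case False
      then have "x \<notin> dom \<sigma>" using Comp.prems(2) by simp
      then show ?thesis using False by (auto simp: map_add_def restrict_map_def domIff)
    qed (auto simp: map_add_def restrict_map_def split: option.splits)
  qed
  moreover have "dom (\<sigma> |` bn p) = bn p" "dom (\<sigma> |` bn q) = bn q" using Comp.prems(2) by auto
  ultimately show ?case using cp_comp Comp.IH w by metis
qed (auto intro: cp_var cp_prot)

lemma compat_ren:
  assumes "bij \<pi>"
  shows "compat p \<sigma> q \<rho> \<Longrightarrow> compat p \<sigma> (psub Var \<pi> q) (\<rho> \<circ> inv \<pi>)"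
proof (induction rule: compat.induct)
  have e: "Map.empty \<circ> inv \<pi> = Map.empty" by (auto simp: fun_eq_iff)
  {
    case (cp_bind p \<sigma> y)
    have "[y \<mapsto> hsubst \<sigma> p] \<circ> inv \<pi> = [\<pi> y \<mapsto> hsubst \<sigma> p]"
    proof
      fix z
      have "inv \<pi> z = y \<longleftrightarrow> z = \<pi> y" using bij_inv_eq_iff[OF assms, of y z] by auto
      then show "([y \<mapsto> hsubst \<sigma> p] \<circ> inv \<pi>) z = [\<pi> y \<mapsto> hsubst \<sigma> p] z" by (simp add: fun_upd_apply)
    qed
    then show ?case using compat.cp_bind[OF cp_bind] by (simp del: comp_apply)
  next
    case (cp_var n)
    then show ?case unfolding e by (simp add: compat.cp_var)
  next
    case (cp_prot n)
    then show ?case unfolding e by (simp add: compat.cp_prot)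
  next
    case (cp_prot_var n)
    then show ?case unfolding e by (simp add: compat.cp_prot_var)
  next
    case (cp_comp p1 \<sigma>1 q1 \<rho>1 p2 \<sigma>2 q2 \<rho>2)
    have "(\<rho>1 ++ \<rho>2) \<circ> inv \<pi> = (\<rho>1 \<circ> inv \<pi>) ++ (\<rho>2 \<circ> inv \<pi>)"
      by (rule ext) (simp add: map_add_def o_def)
    then show ?case using compat.cp_comp[OF cp_comp.IH] by (simp del: comp_apply)
  }
qed

lemma ex_fresh_binders:
  fixes A :: "name set"
  assumes "finite A"
  obtains \<beta> where "inj_on \<beta> (bn p)" "\<beta> ` bn p \<inter> A = {}"
proof -
  define \<beta> where "\<beta> = (\<lambda>x. fresh A + idx (bnl p) x)"
  show ?thesis by (rule that[OF fresh_idx_props[OF assms \<beta>_def]])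
qed

text \<open>Simulation is established on classes; \<open>cl_scong\<close> makes the closure
  independent of representatives, which \<open>CL_D\<close> exploits.\<close>

inductive cl :: "(proc \<times> proc) set \<Rightarrow> proc \<Rightarrow> proc \<Rightarrow> bool" for S where
  cl_base: "(P, Q) \<in> S \<Longrightarrow> cl S P Q"
| cl_nil: "cl S Nil Nil"
| cl_par: "cl S P1 Q1 \<Longrightarrow> cl S P2 Q2 \<Longrightarrow> cl S (Par P1 P2) (Par Q1 Q2)"
| cl_rep: "cl S P Q \<Longrightarrow> cl S (Rep P) (Rep Q)"
| cl_res: "cl S P Q \<Longrightarrow> cl S (Res n P) (Res n Q)"
| cl_case: "wf_pat p \<Longrightarrow> cl S P Q \<Longrightarrow> cl S (Case p P) (Case p Q)"
| cl_scong: "cl S P Q \<Longrightarrow> scong P P' \<Longrightarrow> scong Q Q' \<Longrightarrow> cl S P' Q'"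

lemma cl_refl: "wf_proc P \<Longrightarrow> cl S P P"
  by (induction P) (auto intro: cl_nil cl_par cl_rep cl_res cl_case)

lemma cl_sym: "sym S \<Longrightarrow> cl S P Q \<Longrightarrow> cl S Q P"
  by (rotate_tac, induction rule: cl.induct) (auto intro: cl.intros dest: symD)

locale bisim =
  fixes S :: "(proc \<times> proc) set"
  assumes S_wf: "S \<subseteq> {(P, Q). wf_proc P \<and> wf_proc Q}"
    and S_bisim: "bisimulation S"
    and S_subst: "subst_closed S"
begin

lemma cl_wf: "cl S P Q \<Longrightarrow> wf_proc P \<and> wf_proc Q"
  by (induction rule: cl.induct) (use S_wf scong_wf in auto)

lemma S_esub:
  assumes "(P, Q) \<in> S" "csub \<theta>"
  obtains P' Q' where "(P', Q') \<in> S" "scong P' (esub \<theta> P)" "scong Q' (esub \<theta> Q)"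
proof -
  have w: "wf_proc P" "wf_proc Q" using S_wf assms(1) by auto
  \<comment> \<open>\<theta> is cut down to the free names, because \<open>S\<close> is closed only
    under substitutions with finite domain.\<close>
  define \<sigma> where "\<sigma> x = (if x \<in> fn_proc P \<union> fn_proc Q then Some (\<theta> x) else None)" for x
  have "dom \<sigma> = fn_proc P \<union> fn_proc Q" by (auto simp: \<sigma>_def dom_def)
  then have sub: "is_subst \<sigma>" using assms(2) by (auto simp: is_subst_def ran_def \<sigma>_def csubD split: if_splits)
  have e: "esub (tot \<sigma>) R = esub \<theta> R" if "fn_proc R \<subseteq> fn_proc P \<union> fn_proc Q" for R
    using that by (intro esub_cong) (auto simp: tot_def \<sigma>_def)
  have "(subst \<sigma> P, subst \<sigma> Q) \<in> S" using S_subst sub assms(1) by (auto simp: subst_closed_def)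
  moreover have "scong (subst \<sigma> P) (esub \<theta> P)" "scong (subst \<sigma> Q) (esub \<theta> Q)"
    using alpha_subst[OF sub w(1)] alpha_subst[OF sub w(2)] e[of P] e[of Q] by (auto intro: sc_alpha)
  ultimately show ?thesis using that by blast
qed

text \<open>Related processes may have different free names, so the canonical binders of the two
  sides need not coincide; both are renamed to a common fresh choice before the closure rule for the
  binder is applied.\<close>

lemma cl_esub: "cl S P Q \<Longrightarrow> csub \<theta> \<Longrightarrow> cl S (esub \<theta> P) (esub \<theta> Q)"
proof (induction arbitrary: \<theta> rule: cl.induct)
  case (cl_base P Q)
  obtain P' Q' where "(P', Q') \<in> S" "scong P' (esub \<theta> P)" "scong Q' (esub \<theta> Q)" using S_esub[OF cl_base] .
  then show ?case using cl_scong cl.cl_base by blast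
next
  case (cl_res P Q n)
  have w: "wf_proc P" "wf_proc Q" using cl_wf cl_res by auto
  obtain m where "m \<notin> fimg \<theta> (fn_proc (Res n P)) \<union> fimg \<theta> (fn_proc (Res n Q))"
    using ex_fresh[of "fimg \<theta> (fn_proc (Res n P)) \<union> fimg \<theta> (fn_proc (Res n Q))"] by auto
  then have m: "m \<notin> fimg \<theta> (fn_proc (Res n P))" "m \<notin> fimg \<theta> (fn_proc (Res n Q))" by auto
  have "cl S (Res m (esub (\<theta>(n := Var m)) P)) (Res m (esub (\<theta>(n := Var m)) Q))"
    using cl_res.IH[OF csub_upd[OF cl_res.prems]] by (rule cl.cl_res)
  then show ?case
    using scong_esub_Res[OF cl_res.prems w(1) m(1)] scong_esub_Res[OF cl_res.prems w(2) m(2)] cl_scong sc_sym by blast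
next
  case (cl_case p P Q)
  have w: "wf_proc (Case p P)" "wf_proc (Case p Q)" using cl_wf cl_case by auto
  obtain \<beta> where b: "inj_on \<beta> (bn p)"
    and b': "\<beta> ` bn p \<inter> fimg \<theta> (fn_proc (Case p P)) = {}" "\<beta> ` bn p \<inter> fimg \<theta> (fn_proc (Case p Q)) = {}"
    using ex_fresh_binders[of "fimg \<theta> (fn_proc (Case p P)) \<union> fimg \<theta> (fn_proc (Case p Q))" p]
    by (metis Int_Un_distrib Un_empty finite_UnI finite_fimg finite_fn_proc)
  have "wf_pat (psub \<theta> \<beta> p)" using wf_Case_rename[OF cl_case.prems w(1) b b'(1)] by simp
  then have "cl S (Case (psub \<theta> \<beta> p) (esub (updb \<theta> \<beta> (bn p)) P)) (Case (psub \<theta> \<beta> p) (esub (updb \<theta> \<beta> (bn p)) Q))"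
    using cl_case.IH[OF csub_updb[OF cl_case.prems]] by (rule cl.cl_case)
  moreover have "scong (Case (psub \<theta> \<beta> p) (esub (updb \<theta> \<beta> (bn p)) P)) (esub \<theta> (Case p P))"
    by (rule sc_sym[OF sc_alpha[OF alpha_esub_Case[OF cl_case.prems w(1) b b'(1)]]])
  moreover have "scong (Case (psub \<theta> \<beta> p) (esub (updb \<theta> \<beta> (bn p)) Q)) (esub \<theta> (Case p Q))"
    by (rule sc_sym[OF sc_alpha[OF alpha_esub_Case[OF cl_case.prems w(2) b b'(2)]]])
  ultimately show ?case by (rule cl_scong)
next
  case (cl_scong P Q P' Q')
  then show ?case using scong_esub cl_wf cl.cl_scong by metis
qed (auto intro: cl.intros)

definition CL :: "cproc \<Rightarrow> cproc \<Rightarrow> bool" where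
  "CL X Y \<longleftrightarrow> (\<exists>P Q. X = cls P \<and> Y = cls Q \<and> cl S P Q)"

lemma CL_cls: "cl S P Q \<Longrightarrow> CL (cls P) (cls Q)"
  by (auto simp: CL_def)

lemma CL_D: "CL (cls P) (cls Q) \<Longrightarrow> wf_proc P \<Longrightarrow> wf_proc Q \<Longrightarrow> cl S P Q"
  unfolding CL_def using cl_wf cls_eq cl_scong sc_sym by metis

lemma CL_cpar: "CL X Y \<Longrightarrow> CL X' Y' \<Longrightarrow> CL (cpar X X') (cpar Y Y')"
  unfolding CL_def using cl_wf cls_Par cl_par by metis

lemma CL_cres: "CL X Y \<Longrightarrow> CL (cres n X) (cres n Y)"
  unfolding CL_def using cl_wf cls_Res cl_res by metis

lemma CL_cresS: "finite N \<Longrightarrow> CL X Y \<Longrightarrow> CL (cresS N X) (cresS N Y)"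
  by (induction N rule: finite_induct) (auto simp: cresS_insert CL_cres)

lemma CL_csubst: "CL X Y \<Longrightarrow> csub \<theta> \<Longrightarrow> CL (csubst \<theta> X) (csubst \<theta> Y)"
  unfolding CL_def using cl_wf csubst_cls cl_esub by metis

text \<open>One direction of the game is enough, because \<open>cl S\<close> is symmetric whenever
  \<open>S\<close> is.\<close>

definition sim :: "proc \<Rightarrow> proc \<Rightarrow> bool" where
  "sim P Q \<longleftrightarrow> (\<forall>X. st P Tau X \<longrightarrow> (\<exists>Y. st Q Tau Y \<and> CL X Y)) \<and>
    (\<forall>N p X \<sigma>. st P (Out N p) X \<longrightarrow> (bn p \<union> N) \<inter> fn_proc Q = {} \<longrightarrow> is_match p \<sigma> \<longrightarrow> fn_subst \<sigma> \<inter> N = {} \<longrightarrow>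
      (\<exists>q \<rho> Y. is_match q \<rho> \<and> compat p \<sigma> q \<rho> \<and> st Q (Out N q) Y \<and> CL (csubst (tot \<sigma>) X) (csubst (tot \<rho>) Y)))"

lemma simI:
  assumes "\<And>X. st P Tau X \<Longrightarrow> \<exists>Y. st Q Tau Y \<and> CL X Y"
    and "\<And>N p X \<sigma>. st P (Out N p) X \<Longrightarrow> (bn p \<union> N) \<inter> fn_proc Q = {} \<Longrightarrow> is_match p \<sigma> \<Longrightarrow> fn_subst \<sigma> \<inter> N = {} \<Longrightarrow>
      \<exists>q \<rho> Y. is_match q \<rho> \<and> compat p \<sigma> q \<rho> \<and> st Q (Out N q) Y \<and> CL (csubst (tot \<sigma>) X) (csubst (tot \<rho>) Y)"
  shows "sim P Q"
  unfolding sim_def by (intro conjI allI impI assms)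

lemma sim_TauE:
  assumes "sim P Q" "st P Tau X"
  obtains Y where "st Q Tau Y" "CL X Y"
  using assms unfolding sim_def by blast

text \<open>The game says nothing about the binders of the answer. They are moved off a given finite
  set here, which changes neither compatibility nor the instantiated continuation.\<close>

lemma sim_OutE:
  assumes "sim P Q" "wf_proc Q" "st P (Out N p) X" "(bn p \<union> N) \<inter> fn_proc Q = {}" "is_match p \<sigma>" "fn_subst \<sigma> \<inter> N = {}" "finite A"
  obtains q \<rho> Y where "is_match q \<rho>" "compat p \<sigma> q \<rho>" "st Q (Out N q) Y" "CL (csubst (tot \<sigma>) X) (csubst (tot \<rho>) Y)"
    "bn q \<inter> A = {}"
proof -
  obtain q \<rho> Y where *: "is_match q \<rho>" "compat p \<sigma> q \<rho>" "st Q (Out N q) Y" "CL (csubst (tot \<sigma>) X) (csubst (tot \<rho>) Y)"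
    using assms(1,3-6) unfolding sim_def by blast
  obtain \<pi> where \<pi>: "bij \<pi>" "\<pi> ` bn q \<inter> A = {}" "st Q (Out N (psub Var \<pi> q)) (csubst (Var \<circ> \<pi>) Y)"
    "\<And>x. x \<in> fn_proc Q \<union> N \<Longrightarrow> \<pi> x = x"
    by (rule st_bn_fresh[OF *(3) assms(2,7)]) (rule that)
  have "csubst (tot (\<rho> \<circ> inv \<pi>)) (csubst (Var \<circ> \<pi>) Y) = csubst (tot \<rho>) Y"
    using st_OutD(9)[OF *(3) assms(2)] \<pi>(4) by (intro csubst_bn_ren[OF \<pi>(1) *(1)]) auto
  then show ?thesis
    using that[OF is_match_ren[OF \<pi>(1) *(1)] compat_ren[OF \<pi>(1) *(2)] \<pi>(3)] *(4) \<pi>(2) by (simp add: bn_psub)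
qed

lemma sim_base:
  assumes "(P, Q) \<in> S"
  shows "sim P Q"
proof (rule simI)
  have w: "wf_proc P" "wf_proc Q" using S_wf assms by auto
  {
    fix X assume "st P Tau X"
    then obtain P' where P': "lts P Tau P'" "X = cls P'" using st_lts w by blast
    have "case Tau of Tau \<Rightarrow> \<exists>Q'. lts Q Tau Q' \<and> (P', Q') \<in> S | Out N p \<Rightarrow> True"
      using S_bisim assms P'(1) unfolding bisimulation_def by fastforce
    then obtain Q' where "lts Q Tau Q'" "(P', Q') \<in> S" by auto
    then show "\<exists>Y. st Q Tau Y \<and> CL X Y" using lts_st w P'(2) CL_cls cl_base by metis
  next
    fix N p X \<sigma>
    assume a: "st P (Out N p) X" "(bn p \<union> N) \<inter> fn_proc Q = {}" "is_match p \<sigma>" "fn_subst \<sigma> \<inter> N = {}"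
    then obtain P' where P': "lts P (Out N p) P'" "X = cls P'" "wf_proc P'" using st_lts w by blast
    have "\<forall>P Q P' \<mu>. (P, Q) \<in> S \<and> lts P \<mu> P' \<longrightarrow>
        (case \<mu> of
           Tau \<Rightarrow> (\<exists>Q'. lts Q Tau Q' \<and> (P', Q') \<in> S)
         | Out N p \<Rightarrow> ((bn p \<union> N) \<inter> fn_proc Q = {} \<longrightarrow>
              (\<forall>\<sigma>. is_match p \<sigma> \<and> fn_subst \<sigma> \<inter> N = {} \<longrightarrow>
                 (\<exists>q \<rho> Q'. is_match q \<rho> \<and> compat p \<sigma> q \<rho> \<and> lts Q (Out N q) Q'
                    \<and> (subst \<sigma> P', subst \<rho> Q') \<in> S))))" using S_bisim by (simp add: bisimulation_def)
    from this[rule_format, OF conjI[OF assms P'(1)]] a(2-4)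
    obtain q \<rho> Q' where q: "is_match q \<rho>" "compat p \<sigma> q \<rho>" "lts Q (Out N q) Q'" "(subst \<sigma> P', subst \<rho> Q') \<in> S"
      by auto
    have s: "st Q (Out N q) (cls Q')" "wf_proc Q'" using lts_st[OF q(3) w(2)] by auto
    have "CL (cls (subst \<sigma> P')) (cls (subst \<rho> Q'))" using q(4) by (intro CL_cls cl_base)
    then have "CL (csubst (tot \<sigma>) X) (csubst (tot \<rho>) (cls Q'))"
      using cls_subst[of \<sigma> P'] cls_subst[of \<rho> Q'] P' s a(3) q(1) by (simp add: is_match_def)
    then show "\<exists>q \<rho> Y. is_match q \<rho> \<and> compat p \<sigma> q \<rho> \<and> st Q (Out N q) Y \<and> CL (csubst (tot \<sigma>) X) (csubst (tot \<rho>) Y)"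
      using q s by blast
  }
qed

lemma sim_scong:
  assumes "sim P Q" "scong P P'" "scong Q Q'" "wf_proc P" "wf_proc Q"
  shows "sim P' Q'"
proof (rule simI)
  have w: "wf_proc P'" using assms(2,4) scong_wf by blast
  have s: "st P' \<mu> X \<Longrightarrow> st P \<mu> X" for \<mu> X using st_scong[OF _ sc_sym[OF assms(2)] w] .
  {
    fix X assume "st P' Tau X"
    then show "\<exists>Y. st Q' Tau Y \<and> CL X Y" using s assms(1) st_scong[OF _ assms(3,5)] unfolding sim_def by blast
  next
    fix N p X \<sigma>
    assume a: "st P' (Out N p) X" "(bn p \<union> N) \<inter> fn_proc Q' = {}" "is_match p \<sigma>" "fn_subst \<sigma> \<inter> N = {}"
    have "(bn p \<union> N) \<inter> fn_proc Q = {}" using a(2) scong_fn[OF assms(3,5)] by simp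
    then obtain q \<rho> Y where "is_match q \<rho>" "compat p \<sigma> q \<rho>" "st Q (Out N q) Y" "CL (csubst (tot \<sigma>) X) (csubst (tot \<rho>) Y)"
      by (rule sim_OutE[OF assms(1,5) s[OF a(1)] _ a(3,4) finite.emptyI]) (rule that)
    then show "\<exists>q \<rho> Y. is_match q \<rho> \<and> compat p \<sigma> q \<rho> \<and> st Q' (Out N q) Y \<and> CL (csubst (tot \<sigma>) X) (csubst (tot \<rho>) Y)"
      using st_scong[OF _ assms(3,5)] by blast
  }
qed

lemma csubst_match_cpar:
  assumes "is_match p \<sigma>" "bn p \<inter> fn_proc R = {}" "wf_proc R"
  shows "csubst (tot \<sigma>) (cpar X (cls R)) = cpar (csubst (tot \<sigma>) X) (cls R)"
  using assms by (simp add: is_match_def csubst_cpar csub_tot csubst_tot_cls)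

text \<open>With the binders of the answer off \<open>R'\<close>, both matches leave the idle
  components alone, and closure under parallel composition applies.\<close>

lemma sim_Out_par:
  assumes "sim P Q" "st P (Out N p) X" "(bn p \<union> N) \<inter> fn_proc Q = {}" "is_match p \<sigma>" "fn_subst \<sigma> \<inter> N = {}"
    "wf_proc Q" "(N \<union> bn p) \<inter> fn_proc R = {}" "cl S R R'"
  obtains q \<rho> Y where "is_match q \<rho>" "compat p \<sigma> q \<rho>" "st Q (Out N q) Y" "bn q \<inter> fn_proc R' = {}"
    "CL (csubst (tot \<sigma>) (cpar X (cls R))) (csubst (tot \<rho>) (cpar Y (cls R')))"
proof -
  have w: "wf_proc R" "wf_proc R'" using cl_wf assms(8) by auto
  obtain q \<rho> Y where *: "is_match q \<rho>" "compat p \<sigma> q \<rho>" "st Q (Out N q) Y" "CL (csubst (tot \<sigma>) X) (csubst (tot \<rho>) Y)"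
    "bn q \<inter> fn_proc R' = {}"
    by (rule sim_OutE[OF assms(1,6,2-5) finite_fn_proc[of R']]) (rule that)
  have "CL (csubst (tot \<sigma>) (cpar X (cls R))) (csubst (tot \<rho>) (cpar Y (cls R')))"
    using csubst_match_cpar[OF assms(4) _ w(1), of X] csubst_match_cpar[OF *(1,5) w(2), of Y] assms(7)
      CL_cpar[OF *(4) CL_cls[OF assms(8)]] by (simp add: Int_Un_distrib2)
  then show ?thesis using that * by blast
qed

lemma sim_par:
  assumes "sim P1 Q1" "sim P2 Q2" "cl S P1 Q1" "cl S P2 Q2"
  shows "sim (Par P1 P2) (Par Q1 Q2)"
proof (rule simI)
  have w: "wf_proc P1" "wf_proc Q1" "wf_proc P2" "wf_proc Q2" using assms cl_wf by auto
  {
    fix X assume "st (Par P1 P2) Tau X"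
    then show "\<exists>Y. st (Par Q1 Q2) Tau Y \<and> CL X Y"
    proof (cases rule: st_Par_cases)
      case (l X')
      obtain Y where "st Q1 Tau Y" "CL X' Y" using sim_TauE[OF assms(1) l(1)] .
      then show ?thesis using l(3) CL_cpar CL_cls[OF assms(4)] st_l[of Q1 Tau Y Q2] by auto
    next
      case (r X')
      obtain Y where "st Q2 Tau Y" "CL X' Y" using sim_TauE[OF assms(2) r(1)] .
      then show ?thesis using r(3) CL_cpar CL_cls[OF assms(3)] st_r[of Q2 Tau Y Q1] by auto
    next
      case (com M0 p0 X0 N0 q0 Y0 \<sigma>0 \<rho>0)
      \<comment> \<open>The bound names of the communication are chosen off \<open>Q1\<close> and
        \<open>Q2\<close>, as both games require.\<close>
      have fin: "finite (fn_proc Q1 \<union> fn_proc Q2)" by simp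
      obtain M p X' N q Y' \<sigma> \<rho> where d: "st P1 (Out M p) X'" "st P2 (Out N q) Y'" "unify p q = Some (\<sigma>, \<rho>)"
        "M \<inter> fn_proc P2 = {}" "N \<inter> fn_proc P1 = {}" "M \<inter> N = {}"
        "(M \<union> N \<union> bn p \<union> bn q) \<inter> (fn_proc Q1 \<union> fn_proc Q2) = {}"
        "X = cresS (M \<union> N) (cpar (csubst (tot \<sigma>) X') (csubst (tot \<rho>) Y'))"
        using st_com_freshE[OF com(3-8) w(1,3) fin] com(2) by metis
      note p = st_OutD[OF d(1) w(1)] and q = st_OutD[OF d(2) w(3)]
      note m = is_match_unify[OF d(3)]
      \<comment> \<open>The values of \<sigma> are made of free names of \<open>q\<close>, which are
        free in \<open>P2\<close> or lie in \<open>N\<close>, hence are never names that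
        \<open>P1\<close> extrudes.\<close>
      have f1: "fn_subst \<sigma> \<inter> M = {}" using unify_fn_subst[OF d(3)] q(7) d(4,6) by blast
      have f2: "(bn p \<union> M) \<inter> fn_proc Q1 = {}" using d(7) by blast
      obtain p' \<sigma>' X1 where 1: "is_match p' \<sigma>'" "compat p \<sigma> p' \<sigma>'" "st Q1 (Out M p') X1"
        "CL (csubst (tot \<sigma>) X') (csubst (tot \<sigma>') X1)"
        by (rule sim_OutE[OF assms(1) w(2) d(1) f2 conjunct1[OF m] f1 finite.emptyI]) (rule that)
      \<comment> \<open>The patterns are replaced one at a time: passing from \<open>p\<close> to
        \<open>p'\<close> keeps \<rho>, and passing from \<open>q\<close> to \<open>q'\<close> then
        keeps \<sigma>'.\<close>
      have u1: "unify p' q = Some (\<sigma>', \<rho>)" by (rule compat_unify[OF 1(2) d(3) p(4)])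
      have "fn_subst \<rho> \<subseteq> fn_pat p" using unify_fn_subst[OF d(3)] by blast
      then have g1: "fn_subst \<rho> \<inter> N = {}" using p(7) d(5,6) by blast
      have g2: "(bn q \<union> N) \<inter> fn_proc Q2 = {}" using d(7) by blast
      obtain q' \<rho>' Y1 where 2: "is_match q' \<rho>'" "compat q \<rho> q' \<rho>'" "st Q2 (Out N q') Y1"
        "CL (csubst (tot \<rho>) Y') (csubst (tot \<rho>') Y1)"
        by (rule sim_OutE[OF assms(2) w(4) d(2) g2 conjunct2[OF m] g1 finite.emptyI]) (rule that)
      have u2: "unify p' q' = Some (\<sigma>', \<rho>')" by (rule unify_sym[OF compat_unify[OF 2(2) unify_sym[OF u1] q(4)]])
      have "st (Par Q1 Q2) Tau (cresS (M \<union> N) (cpar (csubst (tot \<sigma>') X1) (csubst (tot \<rho>') Y1)))"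
        using d by (intro st_com[OF 1(3) 2(3) u2]) auto
      moreover have "CL X (cresS (M \<union> N) (cpar (csubst (tot \<sigma>') X1) (csubst (tot \<rho>') Y1)))"
        unfolding d(8) using p(1) q(1) 1(4) 2(4) by (intro CL_cresS CL_cpar) auto
      ultimately show ?thesis by blast
    qed
  next
    fix N p X \<sigma>
    assume a: "st (Par P1 P2) (Out N p) X" "(bn p \<union> N) \<inter> fn_proc (Par Q1 Q2) = {}" "is_match p \<sigma>" "fn_subst \<sigma> \<inter> N = {}"
    from a(1) show "\<exists>q \<rho> Y. is_match q \<rho> \<and> compat p \<sigma> q \<rho> \<and> st (Par Q1 Q2) (Out N q) Y
        \<and> CL (csubst (tot \<sigma>) X) (csubst (tot \<rho>) Y)"
    proof (cases rule: st_Par_cases)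
      case (l X')
      have f: "(bn p \<union> N) \<inter> fn_proc Q1 = {}" "(N \<union> bn p) \<inter> fn_proc P2 = {}" using a(2) l(2) by auto
      obtain q \<rho> Y where q: "is_match q \<rho>" "compat p \<sigma> q \<rho>" "st Q1 (Out N q) Y" "bn q \<inter> fn_proc Q2 = {}"
          "CL (csubst (tot \<sigma>) (cpar X' (cls P2))) (csubst (tot \<rho>) (cpar Y (cls Q2)))"
        by (rule sim_Out_par[OF assms(1) l(1) f(1) a(3,4) w(2) f(2) assms(4)]) (rule that)
      have "st (Par Q1 Q2) (Out N q) (cpar Y (cls Q2))" using q(3,4) a(2) by (intro st_l) auto
      then show ?thesis using q l(3) by blast
    next
      case (r X')
      have f: "(bn p \<union> N) \<inter> fn_proc Q2 = {}" "(N \<union> bn p) \<inter> fn_proc P1 = {}" using a(2) r(2) by auto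
      obtain q \<rho> Y where q: "is_match q \<rho>" "compat p \<sigma> q \<rho>" "st Q2 (Out N q) Y" "bn q \<inter> fn_proc Q1 = {}"
          "CL (csubst (tot \<sigma>) (cpar X' (cls P1))) (csubst (tot \<rho>) (cpar Y (cls Q1)))"
        by (rule sim_Out_par[OF assms(2) r(1) f(1) a(3,4) w(4) f(2) assms(3)]) (rule that)
      have "st (Par Q1 Q2) (Out N q) (cpar Y (cls Q1))" using q(3,4) a(2) by (intro st_r) auto
      then show ?thesis using q r(3) by blast
    qed simp
  }
qed

text \<open>Silent steps come from two copies, to which \<open>sim_par\<close> applies; a visible
  step comes from one copy beside the replication.\<close>

lemma sim_rep:
  assumes "sim P Q" "cl S P Q"
  shows "sim (Rep P) (Rep Q)"
proof (rule simI)
  have w: "wf_proc P" "wf_proc Q" using assms cl_wf by auto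
  have c: "cl S (Rep P) (Rep Q)" using assms(2) by (rule cl_rep)
  {
    fix X assume "st (Rep P) Tau X"
    then obtain X' where X': "st (Par P P) Tau X'" "X = cpar X' (cls (Rep P))" by (rule st_RepE)
    obtain Y where "st (Par Q Q) Tau Y" "CL X' Y" using sim_TauE[OF sim_par[OF assms(1,1,2,2)] X'(1)] .
    then show "\<exists>Y. st (Rep Q) Tau Y \<and> CL X Y" using X'(2) CL_cpar CL_cls[OF c] st_rep by blast
  next
    fix N p X \<sigma>
    assume a: "st (Rep P) (Out N p) X" "(bn p \<union> N) \<inter> fn_proc (Rep Q) = {}" "is_match p \<sigma>" "fn_subst \<sigma> \<inter> N = {}"
    obtain X' where X': "st P (Out N p) X'" "X = cpar X' (cls (Rep P))" using st_Rep_OutD[OF a(1) w(1)] .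
    have f: "(bn p \<union> N) \<inter> fn_proc Q = {}" "(N \<union> bn p) \<inter> fn_proc (Rep P) = {}"
      using a(2) st_OutD[OF X'(1) w(1)] by auto
    obtain q \<rho> Y where q: "is_match q \<rho>" "compat p \<sigma> q \<rho>" "st Q (Out N q) Y" "bn q \<inter> fn_proc (Rep Q) = {}"
        "CL (csubst (tot \<sigma>) (cpar X' (cls (Rep P)))) (csubst (tot \<rho>) (cpar Y (cls (Rep Q))))"
      by (rule sim_Out_par[OF assms(1) X'(1) f(1) a(3,4) w(2) f(2) c]) (rule that)
    then show "\<exists>q \<rho> Y. is_match q \<rho> \<and> compat p \<sigma> q \<rho> \<and> st (Rep Q) (Out N q) Y
        \<and> CL (csubst (tot \<sigma>) X) (csubst (tot \<rho>) Y)"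
      using X'(2) st_RepI[OF q(3) w(2)] by blast
  }
qed

lemma sim_res:
  assumes "csub \<theta>" "wf_proc P" "wf_proc Q"
    and IH: "\<And>m. sim (esub (\<theta>(n := Var m)) P) (esub (\<theta>(n := Var m)) Q)"
  shows "sim (esub \<theta> (Res n P)) (esub \<theta> (Res n Q))"
proof (rule simI)
  have fQ: "fn_proc (esub \<theta> (Res n Q)) = fimg \<theta> (fn_proc (Res n Q))" using assms(1) by (rule fn_esub)
  have wQ: "wf_proc (esub (\<theta>(n := Var m)) Q)" for m using assms by (intro wf_esub csub_upd)
  have wP: "wf_proc (esub (\<theta>(n := Var m)) P)" for m using assms by (intro wf_esub csub_upd)
  {
    fix X assume "st (esub \<theta> (Res n P)) Tau X"
    then obtain m \<mu> X' where m: "st (esub (\<theta>(n := Var m)) P) \<mu> X'" "resstep m \<mu> X' Tau X"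
      "m \<in> bnd Tau \<or> m \<notin> fimg \<theta> (fn_proc (Res n Q))"
      by (rule st_esub_Res_freshE[OF _ assms(1,2) finite_fimg[OF finite_fn_proc]]) (rule that)
    have *: "\<mu> = Tau" "X = cres m X'" using m(2) by (auto simp: resstep_def)
    obtain Y where Y: "st (esub (\<theta>(n := Var m)) Q) Tau Y" "CL X' Y" using sim_TauE[OF IH m(1)[unfolded *(1)]] .
    have "resstep m Tau Y Tau (cres m Y)" by (simp add: resstep_def)
    then have "st (esub \<theta> (Res n Q)) Tau (cres m Y)" using Y(1) m(3) unfolding st_esub_Res[OF assms(1)] by auto
    then show "\<exists>Y. st (esub \<theta> (Res n Q)) Tau Y \<and> CL X Y" using CL_cres[OF Y(2)] *(2) by blast
  next
    fix N p X \<sigma>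
    assume a: "st (esub \<theta> (Res n P)) (Out N p) X" "(bn p \<union> N) \<inter> fn_proc (esub \<theta> (Res n Q)) = {}"
      "is_match p \<sigma>" "fn_subst \<sigma> \<inter> N = {}"
    have sub: "is_subst \<sigma>" "dom \<sigma> = bn p" using a(3) by (auto simp: is_match_def)
    \<comment> \<open>A name that is not extruded must also avoid \<sigma>, so that its restriction
      can be moved past the match.\<close>
    define A where "A = fimg \<theta> (fn_proc (Res n Q)) \<union> names_subst \<sigma>"
    have "finite A" using finite_names_subst[OF sub(1)] by (simp add: A_def)
    then obtain m \<mu> X' where m: "st (esub (\<theta>(n := Var m)) P) \<mu> X'" "resstep m \<mu> X' (Out N p) X"
      "m \<in> bnd (Out N p) \<or> m \<notin> A"
      by (rule st_esub_Res_freshE[OF a(1) assms(1,2)]) (rule that)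
    have mQ: "m \<notin> fimg \<theta> (fn_proc (Res n Q))" using m(3) a(2) unfolding fQ by (auto simp: A_def)
    have fQm: "fn_proc (esub (\<theta>(n := Var m)) Q) \<subseteq> insert m (fimg \<theta> (fn_proc (Res n Q)))"
      by (auto simp: fn_esub[OF csub_upd[OF assms(1)]] fimg_def fun_upd_apply split: if_splits)
    from m(2) show "\<exists>q \<rho> Y. is_match q \<rho> \<and> compat p \<sigma> q \<rho> \<and> st (esub \<theta> (Res n Q)) (Out N q) Y
        \<and> CL (csubst (tot \<sigma>) X) (csubst (tot \<rho>) Y)"
    proof (cases rule: resstep_OutE)
      case non
      have mA: "m \<notin> A" using m(3) non(2) by (auto simp: names_pat_def)
      note s = m(1)[unfolded non(1)]
      note p = st_OutD[OF s wP]
      have "(bn p \<union> N) \<inter> fn_proc (esub (\<theta>(n := Var m)) Q) = {}"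
        using fQm a(2) non(2) unfolding fQ by (auto simp: names_pat_def)
      then obtain q \<rho> Y where q: "is_match q \<rho>" "compat p \<sigma> q \<rho>" "st (esub (\<theta>(n := Var m)) Q) (Out N q) Y"
        "CL (csubst (tot \<sigma>) X') (csubst (tot \<rho>) Y)" "bn q \<inter> {m} = {}"
        by (rule sim_OutE[OF IH wQ s _ a(3,4) finite.insertI[OF finite.emptyI]]) (rule that)
      have sub': "is_subst \<rho>" "dom \<rho> = bn q" using q(1) by (auto simp: is_match_def)
      have "m \<notin> fn_subst \<rho>" using compat_fn_subst[OF q(2) p(4)] mA by (auto simp: A_def names_subst_def)
      then have e: "csubst (tot \<rho>) (cres m Y) = cres m (csubst (tot \<rho>) Y)"
        using sub' q(5) by (intro csubst_tot_cres) auto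
      have e': "csubst (tot \<sigma>) (cres m X') = cres m (csubst (tot \<sigma>) X')"
        using sub mA by (intro csubst_tot_cres) (auto simp: A_def names_subst_def)
      have "m \<notin> N \<union> names_pat q" using non(2) q(5) compat_names[OF q(2)] by (auto simp: names_pat_def)
      then have "resstep m (Out N q) Y (Out N q) (cres m Y)" by (simp add: resstep_def)
      then have "st (esub \<theta> (Res n Q)) (Out N q) (cres m Y)" using q(3) mQ unfolding st_esub_Res[OF assms(1)] by blast
      moreover have "CL (csubst (tot \<sigma>) X) (csubst (tot \<rho>) (cres m Y))" unfolding non(3) e e' using q(4) by (rule CL_cres)
      ultimately show ?thesis using q by blast
    next
      case (opn M)
      note s = m(1)[unfolded opn(1)]
      note p = st_OutD[OF s wP]
      have mp: "m \<notin> bn p" using p(4) opn(3) vn_fn by (auto simp: wf_pat_def)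
      have "(bn p \<union> M) \<inter> fn_proc (esub (\<theta>(n := Var m)) Q) = {}"
        using fQm a(2) opn(2,4) mp unfolding fQ by auto
      moreover have "fn_subst \<sigma> \<inter> M = {}" using a(4) opn(2) by auto
      ultimately obtain q \<rho> Y where q: "is_match q \<rho>" "compat p \<sigma> q \<rho>" "st (esub (\<theta>(n := Var m)) Q) (Out M q) Y"
        "CL (csubst (tot \<sigma>) X') (csubst (tot \<rho>) Y)" "bn q \<inter> {m} = {}"
        by (rule sim_OutE[OF IH wQ s _ a(3) _ finite.insertI[OF finite.emptyI]]) (rule that)
      \<comment> \<open>Since compatibility never adds protection, \<open>m\<close> can be extruded
        with \<open>q\<close> as well.\<close>
      have "m \<in> vn q" "m \<notin> M \<union> pn q" using compat_names[OF q(2)] opn(3,4) by auto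
      then have "resstep m (Out M q) Y (Out N q) Y" using opn(2) by (simp add: resstep_def)
      then have "st (esub \<theta> (Res n Q)) (Out N q) Y" using q(3) mQ unfolding st_esub_Res[OF assms(1)] by blast
      then show ?thesis using q opn(5) by blast
    qed
  }
qed

text \<open>No game is played by the continuations: the answer has the same pattern and match, and
  the instantiated continuations are related because the closure is stable under
  substitution.\<close>

lemma sim_case:
  assumes "wf_pat p" "cl S P Q"
  shows "sim (Case p P) (Case p Q)"
proof (rule simI)
  have w: "wf_proc P" "wf_proc Q" using assms cl_wf by auto
  {
    fix X assume "st (Case p P) Tau X"
    then show "\<exists>Y. st (Case p Q) Tau Y \<and> CL X Y" by (rule st_Case_cases) simp
  next
    fix N q X \<sigma>
    assume a: "st (Case p P) (Out N q) X" "(bn q \<union> N) \<inter> fn_proc (Case p Q) = {}" "is_match q \<sigma>" "fn_subst \<sigma> \<inter> N = {}"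
    have wq: "wf_pat q" using st_OutD(4)[OF a(1)] w assms(1) by simp
    from a(1) obtain \<beta> where b: "Out N q = Out {} (psub Var \<beta> p)" "X = csubst (updb Var \<beta> (bn p)) (cls P)"
      "inj_on \<beta> (bn p)" "\<beta> ` bn p \<inter> fn_proc (Case p P) = {}" by (rule st_Case_cases)
    then have q: "N = {}" "q = psub Var \<beta> p" by auto
    have "\<beta> ` bn p \<inter> fn_proc (Case p Q) = {}" using a(2) unfolding q by (auto simp: bn_psub)
    then have s: "st (Case p Q) (Out N q) (csubst (updb Var \<beta> (bn p)) (cls Q))"
      unfolding q using b(3) by (intro st_case)
    have c: "compat q \<sigma> q \<sigma>" using compat_refl[OF wq] a(3) by (simp add: is_match_def)
    have "CL (csubst (tot \<sigma>) X) (csubst (tot \<sigma>) (csubst (updb Var \<beta> (bn p)) (cls Q)))"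
      unfolding b(2) using a(3) CL_cls[OF assms(2)] by (intro CL_csubst csub_tot) (auto simp: is_match_def)
    then show "\<exists>r \<rho> Y. is_match r \<rho> \<and> compat q \<sigma> r \<rho> \<and> st (Case p Q) (Out N r) Y
        \<and> CL (csubst (tot \<sigma>) X) (csubst (tot \<rho>) Y)"
      using c s a(3) by blast
  }
qed

text \<open>The substitution is generalised so that the induction hypothesis for a restriction covers every
  renaming of the restricted name.\<close>
lemma cl_sim_esub: "cl S P Q \<Longrightarrow> csub \<theta> \<Longrightarrow> sim (esub \<theta> P) (esub \<theta> Q)"
proof (induction arbitrary: \<theta> rule: cl.induct)
  case (cl_base P Q)
  obtain P' Q' where "(P', Q') \<in> S" "scong P' (esub \<theta> P)" "scong Q' (esub \<theta> Q)" using S_esub[OF cl_base] .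
  then show ?case using sim_scong[OF sim_base] S_wf by blast
next
  case cl_nil
  show ?case by (rule simI) (auto elim: st_NilE)
next
  case (cl_par P1 Q1 P2 Q2)
  then show ?case using cl_esub by (simp add: sim_par)
next
  case (cl_rep P Q)
  then show ?case using cl_esub by (simp add: sim_rep)
next
  case (cl_res P Q n)
  then show ?case using cl_wf csub_upd by (blast intro: sim_res)
next
  case (cl_case p P Q)
  have w: "wf_proc (Case p P)" "wf_proc (Case p Q)" using cl_wf cl_case by auto
  obtain \<beta> where b: "inj_on \<beta> (bn p)"
    and b': "\<beta> ` bn p \<inter> fimg \<theta> (fn_proc (Case p P)) = {}" "\<beta> ` bn p \<inter> fimg \<theta> (fn_proc (Case p Q)) = {}"
    using ex_fresh_binders[of "fimg \<theta> (fn_proc (Case p P)) \<union> fimg \<theta> (fn_proc (Case p Q))" p]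
    by (metis Int_Un_distrib Un_empty finite_UnI finite_fimg finite_fn_proc)
  note wr = wf_Case_rename[OF cl_case.prems w(1) b b'(1)] wf_Case_rename[OF cl_case.prems w(2) b b'(2)]
  have "sim (Case (psub \<theta> \<beta> p) (esub (updb \<theta> \<beta> (bn p)) P)) (Case (psub \<theta> \<beta> p) (esub (updb \<theta> \<beta> (bn p)) Q))"
    using wr(1) cl_esub[OF cl_case.hyps(2) csub_updb[OF cl_case.prems]] by (intro sim_case) auto
  then show ?case
    by (rule sim_scong[OF _ sc_sym[OF sc_alpha[OF alpha_esub_Case[OF cl_case.prems w(1) b b'(1)]]]
          sc_sym[OF sc_alpha[OF alpha_esub_Case[OF cl_case.prems w(2) b b'(2)]]] wr])
next
  case (cl_scong P Q P' Q')
  have w: "wf_proc P" "wf_proc Q" using cl_wf cl_scong by auto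
  show ?case
    by (rule sim_scong[OF cl_scong.IH[OF cl_scong.prems] scong_esub[OF cl_scong.hyps(2) w(1) cl_scong.prems]
          scong_esub[OF cl_scong.hyps(3) w(2) cl_scong.prems] wf_esub[OF cl_scong.prems w(1)] wf_esub[OF cl_scong.prems w(2)]])
qed

lemma cl_sim:
  assumes "cl S P Q"
  shows "sim P Q"
proof -
  have w: "wf_proc P" "wf_proc Q" using cl_wf assms by auto
  show ?thesis
    by (rule sim_scong[OF cl_sim_esub[OF assms csub_Var(1)] sc_sym[OF sc_alpha[OF alpha_norm[OF w(1)]]]
          sc_sym[OF sc_alpha[OF alpha_norm[OF w(2)]]] wf_esub[OF csub_Var(1) w(1)] wf_esub[OF csub_Var(1) w(2)]])
qed

lemma cl_barb:
  assumes "cl S P Q" "barb P M"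
  shows "barb Q M"
proof -
  have w: "wf_proc P" "wf_proc Q" using cl_wf assms by auto
  obtain N p X where a: "st P (Out N p) X" "M = fn_pat p - N" using assms(2) unfolding barb_iff[OF w(1)] by blast
  note p = st_OutD[OF a(1) w(1)]
  have fin: "finite (N \<union> bn p)" and disj: "(N \<union> bn p) \<inter> fn_proc P = {}" using p(1,5,6) by auto
  \<comment> \<open>The bound names of the label may be free in \<open>Q\<close>, which the game
    forbids. They are moved off, and the barb stays the same since it consists of free names of
    \<open>P\<close>.\<close>
  obtain \<pi> where \<pi>: "bij \<pi>" "\<pi> ` (N \<union> bn p) \<inter> fn_proc Q = {}" "\<And>x. x \<in> fn_proc P \<Longrightarrow> \<pi> x = x"
    by (rule ex_ren[OF finite_fn_proc[of Q] fin finite_fn_proc[of P] disj]) (rule that)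
  define N' where "N' = \<pi> ` N"
  define p' where "p' = psub (Var \<circ> \<pi>) \<pi> p"
  have s: "st P (Out N' p') (csubst (Var \<circ> \<pi>) X)"
    using st_fix[OF \<pi>(1) a(1) w(1) \<pi>(3)] by (simp only: ren_lab.simps N'_def p'_def)
  have f: "(bn p' \<union> N') \<inter> fn_proc Q = {}" using \<pi>(2) by (auto simp: N'_def p'_def bn_psub)
  have finN: "finite N'" using p(1) by (simp add: N'_def)
  then obtain z where z: "z \<notin> N'" using ex_fresh by blast
  \<comment> \<open>Only the pattern of the answer is of interest, so any admissible match will do;
    all binders are sent to one name outside the extruded ones.\<close>
  define \<sigma> where "\<sigma> x = (if x \<in> bn p' then Some (Var z) else None)" for x
  have dom: "dom \<sigma> = bn p'" by (auto simp: \<sigma>_def dom_def)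
  then have m: "is_match p' \<sigma>" by (auto simp: is_match_def is_subst_def ran_def \<sigma>_def split: if_splits)
  have "fn_subst \<sigma> \<inter> N' = {}" using z by (auto simp: fn_subst_def ran_def \<sigma>_def split: if_splits)
  then obtain q \<rho> Y where q: "compat p' \<sigma> q \<rho>" "st Q (Out N' q) Y"
    by (rule sim_OutE[OF cl_sim[OF assms(1)] w(2) s f m _ finite.emptyI]) (rule that)
  have "M = \<pi> ` M"
  proof -
    have "M \<subseteq> fn_proc P" using a(2) p(7) by auto
    then show ?thesis using \<pi>(3) by (force simp: image_iff)
  qed
  also have "\<dots> = fn_pat p' - N'"
    using bij_is_inj[OF \<pi>(1)] unfolding a(2) N'_def p'_def by (simp add: fn_psub image_set_diff)
  also have "\<dots> = fn_pat q - N'" using compat_names[OF q(1)] by simp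
  finally show ?thesis unfolding barb_iff[OF w(2)] using q(2) by blast
qed

lemma cl_red:
  assumes "cl S P Q" "red P P'"
  shows "\<exists>Q'. red Q Q' \<and> cl S P' Q'"
proof -
  have w: "wf_proc P" "wf_proc Q" using cl_wf assms by auto
  have "st P Tau (cls P')" "wf_proc P'" using red_st[OF assms(2) w(1)] by auto
  then obtain Y where Y: "st Q Tau Y" "CL (cls P') Y" using sim_TauE[OF cl_sim[OF assms(1)]] by blast
  \<comment> \<open>The answer is known only as a class. \<open>st_red\<close> supplies a process in
    it that \<open>Q\<close> reduces to, and \<open>CL_D\<close> turns the relation of classes back
    into \<open>cl S\<close>.\<close>
  obtain Q' where "red Q Q'" "wf_proc Q'" "Y = cls Q'" using st_red[OF Y(1) w(2)] by blast
  then show ?thesis using CL_D Y(2) \<open>wf_proc P'\<close> by blast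
qed

lemma cl_fill: "cl S P Q \<Longrightarrow> wf_ctx C \<Longrightarrow> cl S (fill C P) (fill C Q)"
  by (induction C) (auto intro: cl_par cl_rep cl_res cl_case cl_refl)

lemma cl_barbed_cong:
  assumes "cl S P Q"
  shows "barbed_cong P Q"
  unfolding barbed_cong_def
proof (intro exI[of _ "{(P, Q). cl S P Q}"] conjI)
  have "sym S" using S_bisim by (simp add: bisimulation_def)
  then show "sym {(P, Q). cl S P Q}" using cl_sym by (auto simp: sym_def)
  show "barb_preserving {(P, Q). cl S P Q}" using cl_barb by (auto simp: barb_preserving_def)
  show "reduction_closed {(P, Q). cl S P Q}" using cl_red by (auto simp: reduction_closed_def)
  show "context_closed {(P, Q). cl S P Q}" using cl_fill by (auto simp: context_closed_def)
qed (use cl_wf assms in auto)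

end

theorem theorem3p32:
  fixes P Q :: proc
  assumes "bisimilar P Q"
  shows "barbed_cong P Q"
proof -
  obtain S where S: "S \<subseteq> {(P, Q). wf_proc P \<and> wf_proc Q}" "bisimulation S" "subst_closed S" "(P, Q) \<in> S"
    using assms unfolding bisimilar_def by blast
  interpret bisim S using S by unfold_locales
  show ?thesis using cl_barbed_cong cl_base S(4) by blast
qed

end
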